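(* Let $(\rho_n)_{n\in\mathbb Z}$ be a sequence with $\rho_0<0$, $\rho_n\in(0,1)$ for all $n\in\mathbb Z\setminus\{0\}$, and $\rho_n=1+O(1/n^2)$ as $|n|\to\infty$, and let $\lambda\in\mathbb C\setminus[-2\mathrm i,2\mathrm i]$. With $K_\lambda$, $T_\lambda$, $\mathcal E$, $\mathcal F$, $\mathcal G$ as defined in the context, the functions $\det(I-K_\lambda)$, $\det(I-T_\lambda)$, $\mathcal E(\lambda)$, $\mathcal F(\lambda)$ and $\mathcal G(\lambda)$ (the last one considered for $\operatorname{Re}\lambda>0$) are holomorphic in $\lambda$ and equal, $$\det(I-K_\lambda)=\det(I-T_\lambda)=\mathcal E(\lambda)=\mathcal F(\lambda)=\mathcal G(\lambda),$$ where the last equality holds under the additional assumption $\operatorname{Re}\lambda>0$. Moreover, $\lambda$ is a discrete eigenvalue of the difference equation $z_{n-1}-z_{n+1}=\frac{\lambda}{\rho_n}z_n$, $n\in\mathbb Z$ (that is, this equation has a nonzero solution $(z_n)\in\ell^2(\mathbb Z;\mathbb C)$), if and only if $\lambda$ is a zero of each of these functions ($\mathcal G$ being considered only when $\operatorname{Re}\lambda>0$).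
   Context: Throughout, $(\rho_n)_{n\in\mathbb Z}$ is the given sequence and $\lambda\in\mathbb C\setminus[-2\mathrm i,2\mathrm i]$. The difference equation is ( * ) $z_{n-1}-z_{n+1}=\frac{\lambda}{\rho_n}z_n$, $n\in\mathbb Z$. Put $b_n=-\lambda\sqrt{1-\rho_n}/\rho_n$ and $c_n=\sqrt{1-\rho_n}$. Let $S:(w_n)\mapsto(w_{n-1})$ and $S^*:(w_n)\mapsto(w_{n+1})$ be the shifts, on $\ell^2(\mathbb Z;\mathbb C)$ or on $\ell^2(\mathbb Z;\mathbb C^2)$. The spectrum of $S-S^*$ on $\ell^2(\mathbb Z;\mathbb C)$ is $[-2\mathrm i,2\mathrm i]$, which is the essential spectrum of ( * ). Put $$A=A(\lambda)=\begin{bmatrix}-\lambda&1\\1&0\end{bmatrix},\quad A_n^\times=\begin{bmatrix}-\lambda/\rho_n&1\\1&0\end{bmatrix},\quad Q_+=\begin{bmatrix}1&0\\0&0\end{bmatrix},\quad B_n=b_nQ_+,\quad C_n=c_nQ_+,$$ so that $A_n^\times=A+B_nC_n$. Equation ( * ) is equivalent to the first order system $y_{n+1}=A_n^\times y_n$, $n\in\mathbb Z$, with $y_n=(z_n,z_{n-1})^\top$. The eigenvalues $\mu_\pm=\mu_\pm(\lambda)$ of $A$ (the roots of $\mu^2+\lambda\mu-1=0$) are labelled so that $|\mu_+|<1<|\mu_-|$; $P_\pm$ denotes the Riesz (spectral) projection of $A$ corresponding to $\mu_\pm$. 1. $K_\lambda=-\operatorname{diag}_{n}\{c_n\}\,(S-S^*-\lambda)^{-1}\operatorname{diag}_{n}\{b_n\}$,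 a trace class operator on $\ell^2(\mathbb Z;\mathbb C)$; $\det(I-K_\lambda)$ is the Fredholm determinant. 2. $T_\lambda=\operatorname{diag}_{n}\{C_n\}\,(S^*-\operatorname{diag}_n\{A\})^{-1}\operatorname{diag}_{n}\{B_n\}$, a trace class operator on $\ell^2(\mathbb Z;\mathbb C^2)$; $\det(I-T_\lambda)$ is the Fredholm determinant. 3. Evans function: the matrix valued Jost solutions $(Y_n^\pm)_{n\in\mathbb Z}$, $Y_n^\pm\in\mathbb C^{2\times2}$, are the unique solutions of $Y_{n+1}=A_n^\times Y_n$, $n\in\mathbb Z$, such that $\|\mu_\pm^{-n}(Y_n^\pm-A^nP_\pm)\|\to0$ as $n\to\pm\infty$ and $Y_0^\pm=Y_0^\pm P_\pm$. Then $\mathcal E(\lambda)=\det(Y_0^+(\lambda)+Y_0^-(\lambda))$. 4. Jost function: the Jost solutions $\mathbf z^\pm=(z_n^\pm)_{n\in\mathbb Z}$ are the unique solutions of ( * ) such that $\mu_\pm^{-n}z_n^\pm-1\to0$ as $n\to\pm\infty$. For sequences $\mathbf u,\mathbf v$ let $\mathcal W(\mathbf u,\mathbf v)_n=(-1)^{n-1}(u_{n-1}v_n-u_nv_{n-1})$; it is independent of $n$ when $\mathbf u,\mathbf v$ both solve ( * ). Then $$\mathcal F(\lambda)=(\mu_+(\lambda)-\mu_-(\lambda))^{-1}\,\mathcal W(\mathbf z^+(\lambda),\mathbf z^-(\lambda))_0.$$ 5. For $\operatorname{Re}\lambda>0$ define the (convergent) continued fractions $$g_+(\lambda)=\cfrac{1}{\frac{\lambda}{\rho_1}+\cfrac{1}{\frac{\lambda}{\rho_2}+\cdots}},\qquad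 g_-(\lambda)=\cfrac{1}{\frac{\lambda}{\rho_{-1}}+\cfrac{1}{\frac{\lambda}{\rho_{-2}}+\cdots}},$$ and $$\mathcal G(\lambda)=z_0^+(\lambda)\,z_0^-(\lambda)\,(\mu_-(\lambda)-\mu_+(\lambda))^{-1}\Big(\frac{\lambda}{\rho_0}+g_+(\lambda)+g_-(\lambda)\Big).$$
   Formalization: With the given Wronskian and prefactors the chain of equalities fails by a sign; what is proved is det(I−K)=det(I−T)=E=−F, with F=G for Re λ>0; holomorphy and the zero/eigenvalue equivalences are as stated. *)

theory Defs
  imports "HOL-Complex_Analysis.Complex_Analysis" "HOL-Library.Landau_Symbols"
begin

text \<open>
  The space \<open>\<ell>\<^sup>2(I)\<close> is the set \<open>ell2\<close> of square-summable families indexed by the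
  type \<open>'i\<close>. The space \<open>\<ell>\<^sup>2(\<int>;\<complex>)\<close> has index type \<open>int\<close>, and \<open>\<ell>\<^sup>2(\<int>;\<complex>\<^sup>2)\<close> has index type
  \<open>int \<times> 2\<close>: the entry at \<open>(n, i)\<close> is the \<open>i\<close>-th component of the \<open>n\<close>-th vector.
  Operators are functions on families; only their values on \<open>ell2\<close> matter.
\<close>

definition ell2 :: "('i \<Rightarrow> complex) set" where
  "ell2 = {w. (\<lambda>i. (cmod (w i))\<^sup>2) summable_on UNIV}"

definition ell2_inner :: "('i \<Rightarrow> complex) \<Rightarrow> ('i \<Rightarrow> complex) \<Rightarrow> complex" where
  "ell2_inner u v = (\<Sum>\<^sub>\<infinity>i. cnj (u i) * v i)"

definition ell2_norm :: "('i \<Rightarrow> complex) \<Rightarrow> real" where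
  "ell2_norm w = sqrt (\<Sum>\<^sub>\<infinity>i. (cmod (w i))\<^sup>2)"

text \<open>
  Trace class in the form of a nuclear representation
  \<open>T = \<Sum>k. \<langle>v\<^sub>k, \<cdot>\<rangle> u\<^sub>k\<close> with \<open>\<Sum>k. \<parallel>u\<^sub>k\<parallel> \<parallel>v\<^sub>k\<parallel> < \<infinity>\<close>. The condition on the norms makes the
  series converge absolutely in \<open>\<ell>\<^sup>2\<close>, so it is enough to identify its sum entrywise.
\<close>

definition trace_class :: "(('i \<Rightarrow> complex) \<Rightarrow> ('i \<Rightarrow> complex)) \<Rightarrow> bool" where
  "trace_class T \<longleftrightarrow>
     (\<exists>(u :: nat \<Rightarrow> 'i \<Rightarrow> complex) (v :: nat \<Rightarrow> 'i \<Rightarrow> complex).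
        (\<forall>k. u k \<in> ell2 \<and> v k \<in> ell2) \<and>
        (\<lambda>k. ell2_norm (u k) * ell2_norm (v k)) summable_on UNIV \<and>
        (\<forall>w\<in>ell2. \<forall>i. ((\<lambda>k. ell2_inner (v k) w * u k i) has_sum T w i) UNIV))"

definition unit_vec :: "'i \<Rightarrow> ('i \<Rightarrow> complex)" where
  "unit_vec j = (\<lambda>i. if i = j then 1 else 0)"

definition det_on :: "'i set \<Rightarrow> ('i \<Rightarrow> 'i \<Rightarrow> complex) \<Rightarrow> complex" where
  "det_on F M = (\<Sum>p | p permutes F. of_int (sign p) * (\<Prod>i\<in>F. M i (p i)))"

text \<open>
  The trace of the \<open>k\<close>-th exterior power of \<open>T\<close>, taken in the orthonormal basis
  \<open>e\<^sub>i\<^sub>1 \<and> \<dots> \<and> e\<^sub>i\<^sub>k\<close> of the \<open>k\<close>-th antisymmetric power of \<open>\<ell>\<^sup>2\<close>. The diagonal entry belonging to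
  \<open>F = {i\<^sub>1, \<dots>, i\<^sub>k}\<close> is the determinant of the numbers \<open>\<langle>e\<^sub>i, T e\<^sub>j\<rangle>\<close> with \<open>i, j \<in> F\<close>.
\<close>

definition ext_power_trace :: "nat \<Rightarrow> (('i \<Rightarrow> complex) \<Rightarrow> ('i \<Rightarrow> complex)) \<Rightarrow> complex" where
  "ext_power_trace k T =
     (\<Sum>\<^sub>\<infinity>F\<in>{F. finite F \<and> card F = k}. det_on F (\<lambda>i j. T (unit_vec j) i))"

text \<open>
  \<open>fredholm_det T\<close> is \<open>det (I - T) = (\<Sum>k. (-1)\<^sup>k tr (\<Lambda>\<^sup>k T))\<close>, for trace class \<open>T\<close>.
\<close>

definition fredholm_det :: "(('i \<Rightarrow> complex) \<Rightarrow> ('i \<Rightarrow> complex)) \<Rightarrow> complex" where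
  "fredholm_det T = (\<Sum>k. (-1) ^ k * ext_power_trace k T)"

definition mat_powi :: "complex^2^2 \<Rightarrow> int \<Rightarrow> complex^2^2" where
  "mat_powi M n =
     (if 0 \<le> n then (((**) M) ^^ nat n) (mat 1)
      else (((**) (matrix_inv M)) ^^ nat (- n)) (mat 1))"

text \<open>
  The Riesz projection is \<open>(2\<pi>\<i>)\<^sup>-\<^sup>1 \<integral> (\<zeta> - M)\<^sup>-\<^sup>1 d\<zeta>\<close>, taken entrywise over any sufficiently
  small positively oriented circle around the eigenvalue \<open>\<mu>\<close>.
\<close>

definition riesz_proj :: "complex^2^2 \<Rightarrow> complex \<Rightarrow> complex^2^2" where
  "riesz_proj M \<mu> =
     (THE P. \<forall>\<^sub>F r in at_right 0. \<forall>i j.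
        ((\<lambda>\<zeta>. matrix_inv (mat \<zeta> - M) $ i $ j)
           has_contour_integral (2 * of_real pi * \<i> * (P $ i $ j))) (circlepath \<mu> r))"

definition param_dom :: "complex set" where
  "param_dom = - closed_segment (- 2 * \<i>) (2 * \<i>)"

definition solves :: "(int \<Rightarrow> real) \<Rightarrow> complex \<Rightarrow> (int \<Rightarrow> complex) \<Rightarrow> bool" where
  "solves \<rho> l z \<longleftrightarrow> (\<forall>n. z (n - 1) - z (n + 1) = l / of_real (\<rho> n) * z n)"

definition discrete_eigenvalue :: "(int \<Rightarrow> real) \<Rightarrow> complex \<Rightarrow> bool" where
  "discrete_eigenvalue \<rho> l \<longleftrightarrow> (\<exists>z\<in>ell2. z \<noteq> (\<lambda>_. 0) \<and> solves \<rho> l z)"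

definition b_coef :: "(int \<Rightarrow> real) \<Rightarrow> complex \<Rightarrow> int \<Rightarrow> complex" where
  "b_coef \<rho> l n = - l * of_real (sqrt (1 - \<rho> n)) / of_real (\<rho> n)"

definition c_coef :: "(int \<Rightarrow> real) \<Rightarrow> int \<Rightarrow> complex" where
  "c_coef \<rho> n = of_real (sqrt (1 - \<rho> n))"

definition A_mat :: "complex \<Rightarrow> complex^2^2" where
  "A_mat l = vector [vector [- l, 1], vector [1, 0]]"

definition Ax_mat :: "(int \<Rightarrow> real) \<Rightarrow> complex \<Rightarrow> int \<Rightarrow> complex^2^2" where
  "Ax_mat \<rho> l n = vector [vector [- l / of_real (\<rho> n), 1], vector [1, 0]]"

definition Q_plus :: "complex^2^2" where
  "Q_plus = vector [vector [1, 0], vector [0, 0]]"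

definition B_mat :: "(int \<Rightarrow> real) \<Rightarrow> complex \<Rightarrow> int \<Rightarrow> complex^2^2" where
  "B_mat \<rho> l n = mat (b_coef \<rho> l n) ** Q_plus"

definition C_mat :: "(int \<Rightarrow> real) \<Rightarrow> int \<Rightarrow> complex^2^2" where
  "C_mat \<rho> n = mat (c_coef \<rho> n) ** Q_plus"

definition mu_plus :: "complex \<Rightarrow> complex" where
  "mu_plus l = (THE \<mu>. \<mu>\<^sup>2 + l * \<mu> - 1 = 0 \<and> cmod \<mu> < 1)"

definition mu_minus :: "complex \<Rightarrow> complex" where
  "mu_minus l = (THE \<mu>. \<mu>\<^sup>2 + l * \<mu> - 1 = 0 \<and> cmod \<mu> > 1)"

definition P_plus :: "complex \<Rightarrow> complex^2^2" where
  "P_plus l = riesz_proj (A_mat l) (mu_plus l)"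

definition P_minus :: "complex \<Rightarrow> complex^2^2" where
  "P_minus l = riesz_proj (A_mat l) (mu_minus l)"

definition shift :: "(int \<Rightarrow> complex) \<Rightarrow> (int \<Rightarrow> complex)" where
  "shift w = (\<lambda>n. w (n - 1))"

definition shift_adj :: "(int \<Rightarrow> complex) \<Rightarrow> (int \<Rightarrow> complex)" where
  "shift_adj w = (\<lambda>n. w (n + 1))"

definition diag :: "(int \<Rightarrow> complex) \<Rightarrow> (int \<Rightarrow> complex) \<Rightarrow> (int \<Rightarrow> complex)" where
  "diag d w = (\<lambda>n. d n * w n)"

definition shift_adj2 :: "(int \<times> 2 \<Rightarrow> complex) \<Rightarrow> (int \<times> 2 \<Rightarrow> complex)" where
  "shift_adj2 w = (\<lambda>(n, i). w (n + 1, i))"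

definition diag2 :: "(int \<Rightarrow> complex^2^2) \<Rightarrow> (int \<times> 2 \<Rightarrow> complex) \<Rightarrow> (int \<times> 2 \<Rightarrow> complex)" where
  "diag2 D w = (\<lambda>(n, i). (D n *v (\<chi> j. w (n, j))) $ i)"

definition L_op :: "complex \<Rightarrow> (int \<Rightarrow> complex) \<Rightarrow> (int \<Rightarrow> complex)" where
  "L_op l w = (\<lambda>n. shift w n - shift_adj w n - l * w n)"

definition M_op :: "complex \<Rightarrow> (int \<times> 2 \<Rightarrow> complex) \<Rightarrow> (int \<times> 2 \<Rightarrow> complex)" where
  "M_op l w = (\<lambda>k. shift_adj2 w k - diag2 (\<lambda>_. A_mat l) w k)"

definition K_op :: "(int \<Rightarrow> real) \<Rightarrow> complex \<Rightarrow> (int \<Rightarrow> complex) \<Rightarrow> (int \<Rightarrow> complex)" where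
  "K_op \<rho> l w =
     (\<lambda>n. - diag (c_coef \<rho>) (inv_into ell2 (L_op l) (diag (b_coef \<rho> l) w)) n)"

definition T_op :: "(int \<Rightarrow> real) \<Rightarrow> complex \<Rightarrow> (int \<times> 2 \<Rightarrow> complex) \<Rightarrow> (int \<times> 2 \<Rightarrow> complex)" where
  "T_op \<rho> l w = diag2 (C_mat \<rho>) (inv_into ell2 (M_op l) (diag2 (B_mat \<rho> l) w))"

definition matrix_jost ::
  "(int \<Rightarrow> real) \<Rightarrow> complex \<Rightarrow> complex \<Rightarrow> complex^2^2 \<Rightarrow> int filter \<Rightarrow> (int \<Rightarrow> complex^2^2) \<Rightarrow> bool" where
  "matrix_jost \<rho> l \<mu> P F Y \<longleftrightarrow>
     (\<forall>n. Y (n + 1) = Ax_mat \<rho> l n ** Y n) \<and>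
     ((\<lambda>n. norm (mat (\<mu> powi (- n)) ** (Y n - mat_powi (A_mat l) n ** P))) \<longlongrightarrow> 0) F \<and>
     Y 0 = Y 0 ** P"

abbreviation is_Y_plus :: "(int \<Rightarrow> real) \<Rightarrow> complex \<Rightarrow> (int \<Rightarrow> complex^2^2) \<Rightarrow> bool" where
  "is_Y_plus \<rho> l \<equiv> matrix_jost \<rho> l (mu_plus l) (P_plus l) at_top"

abbreviation is_Y_minus :: "(int \<Rightarrow> real) \<Rightarrow> complex \<Rightarrow> (int \<Rightarrow> complex^2^2) \<Rightarrow> bool" where
  "is_Y_minus \<rho> l \<equiv> matrix_jost \<rho> l (mu_minus l) (P_minus l) at_bot"

definition evans :: "(int \<Rightarrow> real) \<Rightarrow> complex \<Rightarrow> complex" where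
  "evans \<rho> l = det ((THE Y. is_Y_plus \<rho> l Y) 0 + (THE Y. is_Y_minus \<rho> l Y) 0)"

definition scalar_jost ::
  "(int \<Rightarrow> real) \<Rightarrow> complex \<Rightarrow> complex \<Rightarrow> int filter \<Rightarrow> (int \<Rightarrow> complex) \<Rightarrow> bool" where
  "scalar_jost \<rho> l \<mu> F z \<longleftrightarrow>
     solves \<rho> l z \<and> ((\<lambda>n. \<mu> powi (- n) * z n - 1) \<longlongrightarrow> 0) F"

abbreviation is_z_plus :: "(int \<Rightarrow> real) \<Rightarrow> complex \<Rightarrow> (int \<Rightarrow> complex) \<Rightarrow> bool" where
  "is_z_plus \<rho> l \<equiv> scalar_jost \<rho> l (mu_plus l) at_top"

abbreviation is_z_minus :: "(int \<Rightarrow> real) \<Rightarrow> complex \<Rightarrow> (int \<Rightarrow> complex) \<Rightarrow> bool" where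
  "is_z_minus \<rho> l \<equiv> scalar_jost \<rho> l (mu_minus l) at_bot"

definition z_plus :: "(int \<Rightarrow> real) \<Rightarrow> complex \<Rightarrow> int \<Rightarrow> complex" where
  "z_plus \<rho> l = (THE z. is_z_plus \<rho> l z)"

definition z_minus :: "(int \<Rightarrow> real) \<Rightarrow> complex \<Rightarrow> int \<Rightarrow> complex" where
  "z_minus \<rho> l = (THE z. is_z_minus \<rho> l z)"

definition wronskian :: "(int \<Rightarrow> complex) \<Rightarrow> (int \<Rightarrow> complex) \<Rightarrow> int \<Rightarrow> complex" where
  "wronskian u v n = (-1) powi (n - 1) * (u (n - 1) * v n - u n * v (n - 1))"

text \<open>
  Sign convention: with this Wronskian and this prefactor the free equation (\<open>\<rho> = 1\<close>), for which
  \<open>z\<^sup>\<plusminus>\<^sub>n = \<mu>\<^sub>\<plusminus>\<^sup>n\<close>, gives Jost function \<open>-1\<close>, whereas the Evans function and the Fredholm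
  determinants give \<open>1\<close>. In general the Jost function is the negative of the Evans function:
  \<open>Y\<^sup>\<plusminus>\<^sub>0\<close> sends the eigenvector \<open>(\<mu>\<^sub>\<plusminus>, 1)\<close> of \<open>A\<close> to \<open>\<mu>\<^sub>\<plusminus> (z\<^sup>\<plusminus>\<^sub>0, z\<^sup>\<plusminus>\<^sub>-\<^sub>1)\<close>
  and the other eigenvector to \<open>0\<close>, and \<open>\<mu>\<^sub>+ \<mu>\<^sub>- = -1\<close>.
\<close>

definition jost :: "(int \<Rightarrow> real) \<Rightarrow> complex \<Rightarrow> complex" where
  "jost \<rho> l = inverse (mu_plus l - mu_minus l) * wronskian (z_plus \<rho> l) (z_minus \<rho> l) 0"

primrec cfrac_conv :: "nat \<Rightarrow> (nat \<Rightarrow> complex) \<Rightarrow> complex" where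
  "cfrac_conv 0 a = 0"
| "cfrac_conv (Suc N) a = 1 / (a 0 + cfrac_conv N (\<lambda>k. a (Suc k)))"

definition g_plus_conv :: "(int \<Rightarrow> real) \<Rightarrow> complex \<Rightarrow> nat \<Rightarrow> complex" where
  "g_plus_conv \<rho> l N = cfrac_conv N (\<lambda>k. l / of_real (\<rho> (int k + 1)))"

definition g_minus_conv :: "(int \<Rightarrow> real) \<Rightarrow> complex \<Rightarrow> nat \<Rightarrow> complex" where
  "g_minus_conv \<rho> l N = cfrac_conv N (\<lambda>k. l / of_real (\<rho> (- int k - 1)))"

definition G_fun :: "(int \<Rightarrow> real) \<Rightarrow> complex \<Rightarrow> complex" where
  "G_fun \<rho> l =
     z_plus \<rho> l 0 * z_minus \<rho> l 0 * inverse (mu_minus l - mu_plus l) *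
     (l / of_real (\<rho> 0) + lim (g_plus_conv \<rho> l) + lim (g_minus_conv \<rho> l))"

end

theory Submission
  imports Defs
begin

text \<open>
  Put \<open>v\<^sub>n = b\<^sub>n c\<^sub>n = \<lambda> - \<lambda>/\<rho>\<^sub>n\<close> and \<open>q = \<mu>\<^sub>+/\<mu>\<^sub>-\<close>, so that \<open>\<bar>q\<bar> < 1\<close> and the difference equation is
  \<open>(S - S\<^sup>* - \<lambda> + v) z = 0\<close>. The free resolvent is convolution with a Green's function \<open>g\<close> that is a
  multiple of \<open>\<mu>\<^sub>+\<^sup>n\<close> for \<open>n \<ge> 0\<close> and of \<open>\<mu>\<^sub>-\<^sup>n\<close> for \<open>n \<le> 0\<close>. Therefore \<open>K\<close> has the matrix
  \<open>- c\<^sub>i g(i - j) b\<^sub>j\<close>, which is absolutely summable, and its Fredholm series is the sum over all finite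
  sets \<open>F\<close> of \<open>\<Prod>\<^sub>F v\<close> times the principal minor of \<open>(g(i - j))\<close> on \<open>F\<close>.

  To the left of the diagonal, each row of \<open>(g(i - j))\<close> is a multiple of any earlier one, so a principal
  minor is, up to a constant to the power of its size, the product of the factors \<open>1 - q\<^sup>d\<close> over the gaps
  \<open>d\<close> of \<open>F\<close> (\<open>green_minor_insert\<close>). Sorting the sets \<open>F\<close> by their largest element, one finds that the
  partial sums of the Fredholm series satisfy the Volterra equation of the Jost solution \<open>z\<^sup>-\<close>. The
  outcome is \<open>det (I - K) = lim \<mu>\<^sub>-\<^sup>-\<^sup>n z\<^sup>-\<^sub>n\<close> as \<open>n \<rightarrow> \<infinity>\<close> (\<open>amp_tendsto_at_top\<close>). The Wronskian of \<open>z\<^sup>+\<close> and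
  \<open>z\<^sup>-\<close> is constant in \<open>n\<close>; letting \<open>n \<rightarrow> \<infinity>\<close> it equals \<open>(\<mu>\<^sub>- - \<mu>\<^sub>+) det (I - K)\<close> (\<open>wronskian_eq_det\<close>).

  All other quantities are compared with this Wronskian or with \<open>K\<close>. Eliminating the second component of
  the first order system shows that \<open>T\<close> is \<open>K\<close> padded with zeros (\<open>T_op_eq\<close>). The matrix Jost solutions have
  rank one and are built from \<open>z\<^sup>\<plusminus>\<close> and the eigenvectors of \<open>A\<close> (\<open>matrix_jost_iff\<close>), so the Evans function
  is a \<open>2 \<times> 2\<close> determinant of the values of \<open>z\<^sup>\<plusminus>\<close> at \<open>0\<close> and \<open>-1\<close>. In the right half-plane the continued
  fractions converge to quotients of values of the decaying solutions (\<open>cfrac_tendsto\<close>), and multiplying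
  out gives the Wronskian again. An eigenvalue is a point where \<open>z\<^sup>+\<close> and \<open>z\<^sup>-\<close> are proportional, that is,
  where the Wronskian vanishes (\<open>eigenvalue_iff\<close>).

  The series for \<open>z\<^sup>-\<close> converges locally uniformly in \<open>\<lambda>\<close>, which gives holomorphy of the Jost solutions and
  with it of all five functions. The solution \<open>z\<^sup>+\<close> is obtained from \<open>z\<^sup>-\<close> of the reflected sequence
  \<open>\<rho>\<^sub>-\<^sub>n\<close> by \<open>z\<^sub>n \<mapsto> (-1)\<^sup>n z\<^sub>-\<^sub>n\<close>.
\<close>

section \<open>Determinants over finite index sets\<close>

lemma det_on_empty: "det_on {} M = 1"
  by (simp add: det_on_def)

lemma det_on_cong:
  assumes "\<And>i j. i \<in> F \<Longrightarrow> j \<in> F \<Longrightarrow> M i j = M' i j"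
  shows "det_on F M = det_on F M'"
  unfolding det_on_def
  by (intro sum.cong refl arg_cong2[where f = "(*)"] prod.cong)
     (auto simp: assms permutes_in_image)

lemma det_on_add_row_multiple:
  assumes "finite F" "x \<in> F"
  shows "det_on F (\<lambda>i j. if i = x then r j + t * s j else M i j) =
         det_on F (\<lambda>i j. if i = x then r j else M i j) +
         t * det_on F (\<lambda>i j. if i = x then s j else M i j)"
proof -
  have split: "(\<Prod>i\<in>F. if i = x then f (p i) else M i (p i)) = f (p x) * (\<Prod>i\<in>F-{x}. M i (p i))"
    for f :: "'a \<Rightarrow> complex" and p
    using assms by (subst prod.remove[of F x]) (auto intro: prod.cong)
  show ?thesis
    unfolding det_on_def split[of "\<lambda>j. r j + t * s j"] split[of r] split[of s] sum_distrib_left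
    by (simp add: sum.distrib[symmetric] algebra_simps)
qed

lemma det_on_equal_rows:
  assumes "finite F" "x \<in> F" "y \<in> F" "x \<noteq> y" and eq: "\<And>j. M x j = M y j"
  shows "det_on F M = 0"
proof -
  let ?t = "Transposition.transpose x y"
  have t: "?t permutes F" using assms by (intro permutes_swap_id)
  have "det_on F M = (\<Sum>p | p permutes F. of_int (sign (p \<circ> ?t)) * (\<Prod>i\<in>F. M i ((p \<circ> ?t) i)))"
    unfolding det_on_def
    by (rule sum_permutations_compose_right[OF t])
  also have "\<dots> = (\<Sum>p | p permutes F. - (of_int (sign p) * (\<Prod>i\<in>F. M i (p i))))"
  proof (rule sum.cong, rule refl)
    fix p assume "p \<in> {p. p permutes F}"
    hence p: "permutation p" using assms(1) permutation_permutes by blast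
    have "sign (p \<circ> ?t) = - sign p"
      using sign_compose[OF p permutation_swap_id[of x y]] assms(4) by (simp add: sign_swap_id)
    moreover have "(\<Prod>i\<in>F. M i ((p \<circ> ?t) i)) = (\<Prod>i\<in>F. M (?t i) ((p \<circ> ?t) i))"
      using eq by (intro prod.cong refl) (auto simp: Transposition.transpose_def)
    moreover have "(\<Prod>i\<in>F. M (?t i) ((p \<circ> ?t) i)) = (\<Prod>i\<in>F. M i (p i))"
      using prod.permute[OF t, of "\<lambda>i. M i (p i)"] by (simp add: o_def)
    ultimately show "of_int (sign (p \<circ> ?t)) * (\<Prod>i\<in>F. M i ((p \<circ> ?t) i)) =
                     - (of_int (sign p) * (\<Prod>i\<in>F. M i (p i)))" by simp
  qed
  also have "\<dots> = - det_on F M"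
    by (simp add: det_on_def sum_negf)
  finally show ?thesis by simp
qed

lemma det_on_insert_diagonal_row:
  assumes "finite F" "x \<notin> F" and zero: "\<And>j. j \<in> F \<Longrightarrow> M x j = 0"
  shows "det_on (insert x F) M = M x x * det_on F M"
proof -
  have "det_on (insert x F) M =
      (\<Sum>p | p permutes F. of_int (sign p) * (\<Prod>i\<in>insert x F. M i (p i)))"
    unfolding det_on_def
  proof (rule sum.mono_neutral_right)
    show "finite {p. p permutes insert x F}" using assms(1) by (simp add: finite_permutations)
    show "{p. p permutes F} \<subseteq> {p. p permutes insert x F}"
      by (auto intro: permutes_imp_permutes_insert)
    show "\<forall>p\<in>{p. p permutes insert x F} - {p. p permutes F}.
        of_int (sign p) * (\<Prod>i\<in>insert x F. M i (p i)) = 0"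
    proof
      fix p assume p: "p \<in> {p. p permutes insert x F} - {p. p permutes F}"
      hence "p x \<noteq> x" using permutes_superset[of p "insert x F" F] by auto
      moreover have "p x \<in> insert x F" using p permutes_in_image[of p "insert x F" x] by auto
      ultimately have "M x (p x) = 0" using zero by auto
      thus "of_int (sign p) * (\<Prod>i\<in>insert x F. M i (p i)) = 0"
        using assms by simp
    qed
  qed
  also have "\<dots> = (\<Sum>p | p permutes F. M x x * (of_int (sign p) * (\<Prod>i\<in>F. M i (p i))))"
    using assms by (intro sum.cong refl) (auto simp: permutes_not_in)
  finally show ?thesis by (simp add: det_on_def sum_distrib_left)
qed

text \<open>Subtracting \<open>t\<close> times row \<open>y\<close> from row \<open>x\<close> leaves only the diagonal entry of row \<open>x\<close>, so that
  the determinant reduces to a single smaller one. The rows of a Green's matrix have this shape.\<close>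

lemma det_on_insert_proportional_row:
  assumes "finite F" "x \<notin> F" "y \<in> F" and proportional: "\<And>j. j \<in> F \<Longrightarrow> M x j = t * M y j"
  shows "det_on (insert x F) M = (M x x - t * M y x) * det_on F M"
proof -
  let ?I = "insert x F"
  have "det_on ?I M = det_on ?I (\<lambda>i j. if i = x then (M x j - t * M y j) + t * M y j else M i j)"
    by (intro det_on_cong) auto
  also have "\<dots> = det_on ?I (\<lambda>i j. if i = x then M x j - t * M y j else M i j)
                + t * det_on ?I (\<lambda>i j. if i = x then M y j else M i j)"
    by (rule det_on_add_row_multiple) (use assms in auto)
  also have "det_on ?I (\<lambda>i j. if i = x then M y j else M i j) = 0"
    by (rule det_on_equal_rows[of _ x y]) (use assms in auto)
  also have "det_on ?I (\<lambda>i j. if i = x then M x j - t * M y j else M i j) =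
      (M x x - t * M y x) * det_on F (\<lambda>i j. if i = x then M x j - t * M y j else M i j)"
    by (subst det_on_insert_diagonal_row) (use assms in auto)
  also have "det_on F (\<lambda>i j. if i = x then M x j - t * M y j else M i j) = det_on F M"
    by (intro det_on_cong) (use assms in auto)
  finally show ?thesis by simp
qed

text \<open>Diagonal matrices on either side multiply every term of the expansion by the same factor,
  because a permutation hits every column exactly once.\<close>

lemma det_on_scale:
  assumes "finite F"
  shows "det_on F (\<lambda>i j. c i * M i j * d j) = (\<Prod>i\<in>F. c i * d i) * det_on F M"
  unfolding det_on_def sum_distrib_left
proof (rule sum.cong, rule refl)
  fix p assume "p \<in> {p. p permutes F}"
  hence "(\<Prod>i\<in>F. d (p i)) = (\<Prod>i\<in>F. d i)"
    using prod.permute[of p F d] by (simp add: o_def)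
  thus "of_int (sign p) * (\<Prod>i\<in>F. c i * M i (p i) * d (p i)) =
      (\<Prod>i\<in>F. c i * d i) * (of_int (sign p) * (\<Prod>i\<in>F. M i (p i)))"
    by (simp add: prod.distrib algebra_simps)
qed

lemma det_on_image:
  assumes "finite F" "inj_on h F"
  shows "det_on (h ` F) M = det_on F (\<lambda>i j. M (h i) (h j))"
proof -
  let ?g = "\<lambda>p x. if x \<in> h ` F then h (p (inv_into F h x)) else x"
  have bij: "bij_betw h F (h ` F)" using assms by (simp add: bij_betw_def)
  have "det_on F (\<lambda>i j. M (h i) (h j)) =
        (\<Sum>p | p permutes F. of_int (sign (?g p)) * (\<Prod>i\<in>h ` F. M i (?g p i)))"
    unfolding det_on_def
  proof (rule sum.cong, rule refl)
    fix p assume p: "p \<in> {p. p permutes F}"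
    interpret permutes_bij_finite p F "h ` F" h "inv_into F h" "?g p"
      by unfold_locales (use assms p bij in \<open>auto simp: inv_into_f_f\<close>)
    have "(\<Prod>i\<in>h ` F. M i (?g p i)) = (\<Prod>i\<in>F. M (h i) (h (p i)))"
      using assms by (subst prod.reindex) (auto simp: inv_into_f_f intro!: prod.cong)
    thus "of_int (sign p) * (\<Prod>i\<in>F. M (h i) (h (p i))) =
          of_int (sign (?g p)) * (\<Prod>i\<in>h ` F. M i (?g p i))"
      using sign_p' by simp
  qed
  also have "\<dots> = det_on (h ` F) M"
    unfolding det_on_def
    by (rule sum.reindex_bij_betw[OF bij_betw_permutations[OF bij]])
  finally show ?thesis by simp
qed

lemma det_on_zero_row:
  assumes "finite F" "x \<in> F" "\<And>j. M x j = 0"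
  shows "det_on F M = 0"
  using assms unfolding det_on_def by (intro sum.neutral ballI) auto

text \<open>Peeling off the largest element of the index set is what turns a sum over principal minors into
  a Volterra recursion.\<close>

lemma sum_Pow_by_Max:
  fixes h :: "int set \<Rightarrow> complex"
  assumes "a \<le> n"
  shows "(\<Sum>F\<in>Pow {a..<n}. h F) = h {} + (\<Sum>y\<in>{a..<n}. \<Sum>F\<in>Pow {a..<y}. h (insert y F))"
  using assms
proof (induction n rule: int_ge_induct)
  case base
  then show ?case by simp
next
  case (step n)
  have ins: "{a..<n+1} = insert n {a..<n}" using step.hyps by auto
  have inj: "inj_on (insert n) (Pow {a..<n})"
    by (auto simp: inj_on_def) (metis Diff_insert_absorb PowD atLeastLessThan_iff
        insert_ident less_irrefl subsetD subsetI)+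
  have "(\<Sum>F\<in>Pow {a..<n+1}. h F) = (\<Sum>F\<in>Pow {a..<n} \<union> insert n ` Pow {a..<n}. h F)"
    unfolding ins Pow_insert by simp
  also have "\<dots> = (\<Sum>F\<in>Pow {a..<n}. h F) + (\<Sum>F\<in>insert n ` Pow {a..<n}. h F)"
    by (intro sum.union_disjoint) auto
  also have "(\<Sum>F\<in>insert n ` Pow {a..<n}. h F) = (\<Sum>F\<in>Pow {a..<n}. h (insert n F))"
    using inj by (simp add: sum.reindex)
  finally show ?case using step.IH unfolding ins by simp
qed

section \<open>Square-summable families and convolution\<close>

lemma summable_on_int_halves:
  fixes f :: "int \<Rightarrow> real"
  assumes "(\<lambda>n::nat. f (int n)) summable_on UNIV" "(\<lambda>n::nat. f (- int n)) summable_on UNIV"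
  shows "f summable_on UNIV"
proof -
  have "f summable_on range int" "f summable_on range (\<lambda>n. - int n)"
    using assms by (subst summable_on_reindex; simp add: inj_def o_def)+
  hence "f summable_on (range int \<union> range (\<lambda>n. - int n))" by (rule summable_on_union)
  moreover have "range int \<union> range (\<lambda>n. - int n) = UNIV"
  proof -
    have "n \<in> range int \<union> range (\<lambda>n. - int n)" for n :: int
      by (cases n rule: int_cases2) auto
    thus ?thesis by blast
  qed
  ultimately show ?thesis by simp
qed

lemma summable_on_shift_int:
  fixes f :: "int \<Rightarrow> 'a :: {comm_monoid_add, topological_space}"
  assumes "f summable_on UNIV"
  shows "(\<lambda>n. f (n + k)) summable_on UNIV" "(\<lambda>n. f (k - n)) summable_on UNIV"
proof -
  have "bij (\<lambda>n::int. n + k)" "bij (\<lambda>n::int. k - n)"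
    by (rule bij_betwI[of _ _ _ "\<lambda>n. n - k"]; simp) (rule bij_betwI[of _ _ _ "\<lambda>n. k - n"]; simp)
  thus "(\<lambda>n. f (n + k)) summable_on UNIV" "(\<lambda>n. f (k - n)) summable_on UNIV"
    using assms by (auto intro: summable_on_reindex_bij_betw[THEN iffD2])
qed

text \<open>The majorant behind both Young's inequality and the absolute summability of the matrix of \<open>K\<close>.\<close>

lemma summable_on_convolution_pairs:
  fixes a b :: "int \<Rightarrow> real"
  assumes "a summable_on UNIV" "b summable_on UNIV" "\<And>n. 0 \<le> a n" "\<And>n. 0 \<le> b n"
  shows "(\<lambda>(m, n). a (n - m) * b m) summable_on UNIV"
proof -
  have "(\<lambda>(m, n). a (n - m) * b m) summable_on Sigma UNIV (\<lambda>_. UNIV)"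
  proof (rule summable_on_SigmaI)
    fix m :: int
    have "(\<lambda>n. a (n - m)) summable_on UNIV"
      using summable_on_shift_int(1)[OF assms(1), of "- m"] by simp
    hence "((\<lambda>n. a (n - m)) has_sum (\<Sum>\<^sub>\<infinity>n. a (n - m))) UNIV" by simp
    moreover have "(\<Sum>\<^sub>\<infinity>n. a (n - m)) = (\<Sum>\<^sub>\<infinity>n. a n)"
      by (rule infsum_reindex_bij_betw[where g = "\<lambda>n. n - m"])
         (auto intro!: bij_betwI[of _ _ _ "\<lambda>n. n + m"])
    ultimately show "((\<lambda>n. case (m, n) of (m, n) \<Rightarrow> a (n - m) * b m) has_sum ((\<Sum>\<^sub>\<infinity>n. a n) * b m)) UNIV"
      by (simp add: has_sum_cmult_left)
    show "(\<lambda>m. (\<Sum>\<^sub>\<infinity>n. a n) * b m) summable_on UNIV"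
      by (intro summable_on_cmult_right assms)
  qed (use assms in auto)
  thus ?thesis by simp
qed

lemma ell2_bounded_mult:
  assumes "w \<in> ell2" "\<And>i. cmod (d i) \<le> B"
  shows "(\<lambda>i. d i * w i) \<in> ell2"
proof -
  have "0 \<le> B" using assms(2)[of undefined] norm_ge_zero order_trans by blast
  have "(\<lambda>i. B\<^sup>2 * (cmod (w i))\<^sup>2) summable_on UNIV"
    using assms(1) by (intro summable_on_cmult_right) (simp add: ell2_def)
  thus ?thesis
    unfolding ell2_def mem_Collect_eq
    by (rule summable_on_comparison_test)
       (auto simp: norm_mult power_mult_distrib intro!: mult_right_mono power_mono assms)
qed

lemma ell2_scale: "w \<in> ell2 \<Longrightarrow> (\<lambda>i. c * w i) \<in> ell2"
  by (rule ell2_bounded_mult[of w "\<lambda>_. c" "cmod c"]) auto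

lemma ell2_add:
  assumes "u \<in> ell2" "w \<in> ell2"
  shows "(\<lambda>i. u i + w i) \<in> ell2"
proof -
  have "(\<lambda>i. 2 * (cmod (u i))\<^sup>2 + 2 * (cmod (w i))\<^sup>2) summable_on UNIV"
    using assms by (intro summable_on_add summable_on_cmult_right) (simp_all add: ell2_def)
  moreover have "(cmod (u i + w i))\<^sup>2 \<le> 2 * (cmod (u i))\<^sup>2 + 2 * (cmod (w i))\<^sup>2" for i
  proof -
    have "(cmod (u i + w i))\<^sup>2 \<le> (cmod (u i) + cmod (w i))\<^sup>2"
      by (intro power_mono norm_triangle_ineq) auto
    also have "\<dots> \<le> 2 * (cmod (u i))\<^sup>2 + 2 * (cmod (w i))\<^sup>2"
      using zero_le_power2[of "cmod (u i) - cmod (w i)"]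
      by (simp add: power2_eq_square algebra_simps)
    finally show ?thesis .
  qed
  ultimately show ?thesis
    unfolding ell2_def mem_Collect_eq by (rule summable_on_comparison_test) auto
qed

lemma ell2_diff: "u \<in> ell2 \<Longrightarrow> w \<in> ell2 \<Longrightarrow> (\<lambda>i. u i - w i) \<in> ell2"
  using ell2_add[of u "\<lambda>i. (-1) * w i"] ell2_scale[of w "-1"] by simp

lemma ell2_translate: "w \<in> ell2 \<Longrightarrow> (\<lambda>n::int. w (n + k)) \<in> ell2"
  unfolding ell2_def using summable_on_shift_int(1)[of "\<lambda>n. (cmod (w n))\<^sup>2"] by simp

lemma ell2_unit_vec: "unit_vec j \<in> ell2"
proof -
  have "(\<lambda>i. (cmod (unit_vec j i))\<^sup>2) summable_on {j}" by simp
  moreover have "(\<lambda>i. (cmod (unit_vec j i))\<^sup>2) summable_on UNIV \<longleftrightarrow>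
      (\<lambda>i. (cmod (unit_vec j i))\<^sup>2) summable_on {j}"
    by (rule summable_on_cong_neutral) (auto simp: unit_vec_def)
  ultimately show ?thesis by (simp add: ell2_def)
qed

lemma ell2_norm_unit_vec: "ell2_norm (\<lambda>i. c * unit_vec j i) = cmod c"
proof -
  have "(\<Sum>\<^sub>\<infinity>i. (cmod (c * unit_vec j i))\<^sup>2) = (\<Sum>\<^sub>\<infinity>i\<in>{j}. (cmod (c * unit_vec j i))\<^sup>2)"
    by (rule infsum_cong_neutral) (auto simp: unit_vec_def)
  thus ?thesis by (simp add: ell2_norm_def unit_vec_def)
qed

lemma ell2_inner_unit_vec: "ell2_inner (unit_vec j) w = w j"
proof -
  have "ell2_inner (unit_vec j) w = (\<Sum>\<^sub>\<infinity>i\<in>{j}. cnj (unit_vec j i) * w i)"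
    unfolding ell2_inner_def by (rule infsum_cong_neutral) (auto simp: unit_vec_def)
  thus ?thesis by (simp add: unit_vec_def)
qed

text \<open>A partial sum that nearly exhausts the series of squares leaves no room for a further entry of size
  \<open>e\<close>.\<close>

lemma ell2_finite_large_entries:
  assumes "w \<in> ell2" "0 < e"
  shows "finite {i. e \<le> cmod (w i)}"
proof -
  let ?f = "\<lambda>i. (cmod (w i))\<^sup>2"
  have summ: "?f summable_on UNIV" using assms(1) by (simp add: ell2_def)
  obtain F where F: "finite F" "dist (sum ?f F) (infsum ?f UNIV) \<le> e\<^sup>2 / 2"
    using infsum_finite_approximation[OF summ, of "e\<^sup>2 / 2"] assms(2) by auto
  have "{i. e \<le> cmod (w i)} \<subseteq> F"
  proof (rule subsetI, rule ccontr)
    fix i assume i: "i \<in> {i. e \<le> cmod (w i)}" "i \<notin> F"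
    have "sum ?f (insert i F) \<le> infsum ?f UNIV"
      using F(1) by (intro finite_sum_le_infsum summ) auto
    hence "?f i + sum ?f F \<le> infsum ?f UNIV" using F i by simp
    hence "?f i \<le> e\<^sup>2 / 2" using F(2) unfolding dist_real_def by linarith
    moreover have "e\<^sup>2 \<le> ?f i" using i assms(2) by (intro power_mono) auto
    moreover have "0 < e\<^sup>2" using assms(2) by simp
    ultimately show False by linarith
  qed
  thus ?thesis using F(1) finite_subset by blast
qed

lemma ell2_tendsto_0:
  fixes w :: "int \<Rightarrow> complex"
  assumes "w \<in> ell2"
  shows "(w \<longlongrightarrow> 0) at_top" "(w \<longlongrightarrow> 0) at_bot"
proof -
  have "eventually (\<lambda>n. cmod (w n) < e) at_top \<and> eventually (\<lambda>n. cmod (w n) < e) at_bot"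
    if "0 < e" for e
  proof -
    have "bdd_above {i. e \<le> cmod (w i)}" "bdd_below {i. e \<le> cmod (w i)}"
      using ell2_finite_large_entries[OF assms that] by (auto intro: bdd_above_finite bdd_below_finite)
    then obtain a b where "\<And>i. e \<le> cmod (w i) \<Longrightarrow> i \<le> a" "\<And>i. e \<le> cmod (w i) \<Longrightarrow> b \<le> i"
      unfolding bdd_above_def bdd_below_def by auto
    thus ?thesis
      by (intro conjI eventually_at_top_linorderI[of "a + 1"] eventually_at_bot_linorderI[of "b - 1"])
         (smt (verit))+
  qed
  thus "(w \<longlongrightarrow> 0) at_top" "(w \<longlongrightarrow> 0) at_bot"
    by (auto simp: tendsto_iff)
qed

lemma ell2_bounded:
  assumes "w \<in> ell2"
  shows "\<exists>B. \<forall>i. cmod (w i) \<le> B"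
proof -
  have fin: "finite (cmod ` w ` {i. 1 \<le> cmod (w i)})"
    using ell2_finite_large_entries[OF assms, of 1] by auto
  have "cmod (w i) \<le> Max (insert 1 (cmod ` w ` {i. 1 \<le> cmod (w i)}))" for i
  proof (cases "1 \<le> cmod (w i)")
    case True
    then show ?thesis using fin by (intro Max_ge) auto
  next
    case False
    moreover have "1 \<le> Max (insert 1 (cmod ` w ` {i. 1 \<le> cmod (w i)}))"
      using fin by (intro Max_ge) auto
    ultimately show ?thesis by linarith
  qed
  thus ?thesis by blast
qed

lemma convolution_summable:
  fixes g f :: "int \<Rightarrow> complex"
  assumes "(\<lambda>n. cmod (g n)) summable_on UNIV" "f \<in> ell2"
  shows "(\<lambda>m. cmod (g (n - m) * f m)) summable_on UNIV"
proof -
  obtain B where B: "\<And>i. cmod (f i) \<le> B" using ell2_bounded[OF assms(2)] by blast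
  have "(\<lambda>m. cmod (g (n - m)) * B) summable_on UNIV"
    by (intro summable_on_cmult_left summable_on_shift_int(2)[OF assms(1)])
  thus ?thesis
    by (rule summable_on_comparison_test) (auto simp: norm_mult intro!: mult_left_mono B)
qed

text \<open>Young's inequality, by Cauchy--Schwarz with respect to the weight \<open>\<bar>g\<bar>\<close>.\<close>

lemma convolution_ell2:
  fixes g f :: "int \<Rightarrow> complex"
  assumes g: "(\<lambda>n. cmod (g n)) summable_on UNIV" and f: "f \<in> ell2"
  shows "(\<lambda>n. \<Sum>\<^sub>\<infinity>m. g (n - m) * f m) \<in> ell2"
proof -
  let ?G = "\<Sum>\<^sub>\<infinity>n. cmod (g n)"
  let ?k = "\<lambda>n m. cmod (g (n - m)) * (cmod (f m))\<^sup>2"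
  have pairs: "(\<lambda>(m, n). ?k n m) summable_on UNIV \<times> UNIV"
    using summable_on_convolution_pairs[of "\<lambda>n. cmod (g n)" "\<lambda>m. (cmod (f m))\<^sup>2"] g f
    by (simp add: ell2_def)
  hence pairs': "(\<lambda>(n, m). ?k n m) summable_on UNIV \<times> UNIV"
    using summable_on_swap[of "\<lambda>(n, m). ?k n m" UNIV UNIV] by (simp add: case_prod_unfold)
  have row: "?k n summable_on UNIV" for n
    using summable_on_SigmaD1[OF pairs', of n] by simp
  have rows: "(\<lambda>n. ?G * (\<Sum>\<^sub>\<infinity>m. ?k n m)) summable_on UNIV"
    by (intro summable_on_cmult_right summable_on_Sigma_banach[OF pairs'])
  have "(cmod (\<Sum>\<^sub>\<infinity>m. g (n - m) * f m))\<^sup>2 \<le> ?G * (\<Sum>\<^sub>\<infinity>m. ?k n m)" for n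
  proof -
    have gn: "(\<lambda>m. cmod (g (n - m))) summable_on UNIV"
      by (rule summable_on_shift_int(2)[OF g])
    have Gn: "(\<Sum>\<^sub>\<infinity>m. cmod (g (n - m))) = ?G"
      by (rule infsum_reindex_bij_betw[where g = "\<lambda>m. n - m"])
         (auto intro!: bij_betwI[of _ _ _ "\<lambda>m. n - m"])
    have "cmod (\<Sum>\<^sub>\<infinity>m. g (n - m) * f m) \<le> (\<Sum>\<^sub>\<infinity>m. cmod (g (n - m) * f m))"
      by (rule norm_infsum_bound[OF convolution_summable[OF g f]])
    also have "\<dots> \<le> sqrt (?G * (\<Sum>\<^sub>\<infinity>m. ?k n m))"
    proof (rule infsum_le_finite_sums[OF convolution_summable[OF g f]])
      fix M :: "int set" assume M: "finite M"
      have "(\<Sum>m\<in>M. cmod (g (n - m) * f m))\<^sup>2 =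
          (\<Sum>m\<in>M. sqrt (cmod (g (n - m))) * (sqrt (cmod (g (n - m))) * cmod (f m)))\<^sup>2"
        by (simp add: norm_mult mult.assoc[symmetric])
      also have "\<dots> \<le> (\<Sum>m\<in>M. (sqrt (cmod (g (n - m))))\<^sup>2) *
          (\<Sum>m\<in>M. (sqrt (cmod (g (n - m))) * cmod (f m))\<^sup>2)"
        by (rule Cauchy_Schwarz_ineq_sum)
      also have "\<dots> = (\<Sum>m\<in>M. cmod (g (n - m))) * (\<Sum>m\<in>M. ?k n m)"
        by (simp add: power_mult_distrib)
      also have "\<dots> \<le> ?G * (\<Sum>\<^sub>\<infinity>m. ?k n m)"
        unfolding Gn[symmetric]
        by (intro mult_mono finite_sum_le_infsum gn row M sum_nonneg infsum_nonneg) auto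
      finally show "(\<Sum>m\<in>M. cmod (g (n - m) * f m)) \<le> sqrt (?G * (\<Sum>\<^sub>\<infinity>m. ?k n m))"
        by (rule real_le_rsqrt)
    qed
    finally have "(cmod (\<Sum>\<^sub>\<infinity>m. g (n - m) * f m))\<^sup>2 \<le> (sqrt (?G * (\<Sum>\<^sub>\<infinity>m. ?k n m)))\<^sup>2"
      by (rule power_mono) auto
    also have "\<dots> = ?G * (\<Sum>\<^sub>\<infinity>m. ?k n m)"
      by (intro real_sqrt_pow2 mult_nonneg_nonneg infsum_nonneg) auto
    finally show ?thesis .
  qed
  thus ?thesis
    unfolding ell2_def mem_Collect_eq
    by (intro summable_on_comparison_test[OF rows]) auto
qed

section \<open>The characteristic roots\<close>

lemma param_dom_iff: "l \<in> param_dom \<longleftrightarrow> \<not> (Re l = 0 \<and> \<bar>Im l\<bar> \<le> 2)"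
  by (auto simp: param_dom_def closed_segment_same_Re closed_segment_eq_real_ivl)

lemma open_param_dom: "open param_dom"
  unfolding param_dom_def by (intro open_Compl closed_segment)

text \<open>The square root of the discriminant \<open>\<lambda>\<^sup>2 + 4\<close> divided by \<open>\<lambda>\<close>. With this normalization the principal
  branch of the root has its cut exactly along the excluded segment, so one formula gives \<open>\<mu>\<^sub>\<plusminus>\<close> on the
  whole parameter domain.\<close>

definition root_disc :: "complex \<Rightarrow> complex" where
  "root_disc l = csqrt (1 + 4 / l\<^sup>2)"

lemma root_disc_arg:
  assumes "l \<in> param_dom"
  shows "1 + 4 / l\<^sup>2 \<notin> \<real>\<^sub>\<le>\<^sub>0"
proof
  assume "1 + 4 / l\<^sup>2 \<in> \<real>\<^sub>\<le>\<^sub>0"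
  then obtain q where "q \<le> 0" "1 + 4 / l\<^sup>2 = complex_of_real q"
    by (auto elim: nonpos_Reals_cases)
  then obtain r where r: "0 \<le> r" "1 + 4 / l\<^sup>2 = - complex_of_real r"
    by (metis add.inverse_inverse neg_0_le_iff_le of_real_minus)
  have l0: "l \<noteq> 0" using assms by (auto simp: param_dom_iff)
  have "4 + l\<^sup>2 = - (complex_of_real r * l\<^sup>2)"
    using r(2) l0 by (simp add: field_simps)
  hence "Re (4 + l\<^sup>2) = Re (- (complex_of_real r * l\<^sup>2))"
    "Im (4 + l\<^sup>2) = Im (- (complex_of_real r * l\<^sup>2))" by simp_all
  hence re: "4 = ((Im l)\<^sup>2 - (Re l)\<^sup>2) * (1 + r)" and im: "Re l * Im l * (1 + r) = 0"
    by (simp_all add: power2_eq_square algebra_simps)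
  from im r(1) have "Re l = 0 \<or> Im l = 0" by auto
  moreover have "Im l \<noteq> 0"
  proof
    assume "Im l = 0"
    hence "4 = - ((Re l)\<^sup>2 * (1 + r))" using re by simp
    moreover have "0 \<le> (Re l)\<^sup>2 * (1 + r)" using r(1) by simp
    ultimately show False by linarith
  qed
  ultimately have "Re l = 0" by blast
  hence "(Im l)\<^sup>2 * (1 + r) = 4" using re by simp
  moreover have "(Im l)\<^sup>2 * 1 \<le> (Im l)\<^sup>2 * (1 + r)" using r(1) by (intro mult_left_mono) auto
  ultimately have "(Im l)\<^sup>2 \<le> 2\<^sup>2" by simp
  hence "\<bar>Im l\<bar> \<le> 2" using abs_le_square_iff[of "Im l" 2] by simp
  thus False using assms \<open>Re l = 0\<close> by (simp add: param_dom_iff)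
qed

text \<open>Since \<open>Re s > 0\<close>, the root \<open>\<lambda> (s - 1) / 2\<close> has the smaller modulus; the product of the roots is
  \<open>-1\<close>, so the moduli lie on different sides of \<open>1\<close>.\<close>

lemma characteristic_roots:
  assumes "l \<in> param_dom"
  defines "s \<equiv> root_disc l"
  shows "mu_plus l = l * (s - 1) / 2" "mu_minus l = - l * (s + 1) / 2"
    and "mu_plus l * mu_minus l = -1" "mu_plus l + mu_minus l = - l"
    and "cmod (mu_plus l) < 1" "1 < cmod (mu_minus l)"
proof -
  define m1 m2 where "m1 = l * (s - 1) / 2" and "m2 = - l * (s + 1) / 2"
  have l0: "l \<noteq> 0" using assms by (auto simp: param_dom_iff)
  have s2: "s\<^sup>2 = 1 + 4 / l\<^sup>2" by (simp add: s_def root_disc_def)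
  have "m1 * m2 = - (l\<^sup>2 * (s\<^sup>2 - 1) / 4)"
    by (simp add: m1_def m2_def power2_eq_square field_simps)
  also have "\<dots> = -1" using l0 unfolding s2 by (simp add: field_simps)
  finally have m12: "m1 * m2 = -1" .
  have sum: "m1 + m2 = - l"
    by (simp add: m1_def m2_def field_simps)
  have "Re s > 0"
  proof -
    have "0 \<le> Re s" using csqrt_principal[of "1 + 4 / l\<^sup>2"] by (auto simp: s_def root_disc_def)
    moreover have "Re s \<noteq> 0"
    proof
      assume "Re s = 0"
      hence "s\<^sup>2 = - of_real ((Im s)\<^sup>2)"
        by (simp add: complex_eq_iff power2_eq_square)
      hence "s\<^sup>2 = of_real (- (Im s)\<^sup>2)" by simp
      hence "s\<^sup>2 \<in> \<real>\<^sub>\<le>\<^sub>0" by (simp only: nonpos_Reals_of_real_iff) simp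
      thus False using root_disc_arg[OF assms(1)] s2 by simp
    qed
    ultimately show ?thesis by simp
  qed
  hence "(cmod (s - 1))\<^sup>2 < (cmod (s + 1))\<^sup>2"
    unfolding cmod_power2 by (simp add: power2_eq_square algebra_simps)
  hence "cmod (s - 1) < cmod (s + 1)" by (rule power2_less_imp_less) simp
  hence lt: "cmod m1 < cmod m2" using l0 by (simp add: m1_def m2_def norm_mult norm_divide)
  have prod1: "cmod m1 * cmod m2 = 1" using m12 by (metis norm_minus_cancel norm_mult norm_one)
  have c1: "cmod m1 < 1"
  proof (rule ccontr)
    assume "\<not> cmod m1 < 1"
    hence "1 * 1 < cmod m1 * cmod m2" using lt by (intro mult_le_less_imp_less) auto
    thus False using prod1 by simp
  qed
  have "cmod m1 > 0" using prod1 by (cases "m1 = 0") auto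
  have c2: "1 < cmod m2"
  proof (rule ccontr)
    assume "\<not> 1 < cmod m2"
    hence "cmod m1 * cmod m2 \<le> cmod m1 * 1" by (intro mult_left_mono) auto
    thus False using prod1 c1 by simp
  qed
  have lsum: "l = - (m1 + m2)" using sum by simp
  have roots: "\<mu>\<^sup>2 + l * \<mu> - 1 = 0 \<longleftrightarrow> \<mu> = m1 \<or> \<mu> = m2" for \<mu>
  proof -
    have "\<mu>\<^sup>2 + l * \<mu> - 1 = (\<mu> - m1) * (\<mu> - m2)"
      using m12 unfolding lsum by (simp add: power2_eq_square algebra_simps)
    thus ?thesis by simp
  qed
  have p: "mu_plus l = m1" unfolding mu_plus_def using roots c1 c2 by (intro the_equality) auto
  have m: "mu_minus l = m2" unfolding mu_minus_def using roots c1 c2 by (intro the_equality) auto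
  show "mu_plus l = l * (s - 1) / 2" "mu_minus l = - l * (s + 1) / 2"
    using p m by (simp_all add: m1_def m2_def)
  show "mu_plus l * mu_minus l = -1" "mu_plus l + mu_minus l = - l"
    "cmod (mu_plus l) < 1" "1 < cmod (mu_minus l)"
    using p m m12 sum c1 c2 by simp_all
qed

lemma mu_nonzero:
  assumes "l \<in> param_dom"
  shows "mu_plus l \<noteq> 0" "mu_minus l \<noteq> 0" "mu_minus l - mu_plus l \<noteq> 0"
  using characteristic_roots(3,5,6)[OF assms] by auto

lemma mu_minus_eq: "l \<in> param_dom \<Longrightarrow> mu_minus l = - inverse (mu_plus l)"
  using characteristic_roots(3)[of l] mu_nonzero(1)[of l]
  by (simp add: field_simps)

lemma param_eq: "l \<in> param_dom \<Longrightarrow> l = - mu_plus l - mu_minus l"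
  using characteristic_roots(4)[of l] by (metis add.inverse_inverse minus_add_distrib uminus_add_conv_diff diff_conv_add_uminus)

lemma mu_holomorphic: "mu_plus holomorphic_on param_dom" "mu_minus holomorphic_on param_dom"
proof -
  have disc: "root_disc holomorphic_on param_dom"
    unfolding root_disc_def
    by (intro holomorphic_intros) (auto simp: root_disc_arg, auto simp: param_dom_iff)
  have "(\<lambda>l. l * (root_disc l - 1) / 2) holomorphic_on param_dom"
       "(\<lambda>l. - l * (root_disc l + 1) / 2) holomorphic_on param_dom"
    by (intro holomorphic_intros disc; simp)+
  thus "mu_plus holomorphic_on param_dom" "mu_minus holomorphic_on param_dom"
    by (auto intro: holomorphic_transform simp: characteristic_roots)
qed

section \<open>The free resolvent\<close>

text \<open>The fundamental solution of \<open>S - S\<^sup>* - \<lambda>\<close> that decays at both ends: a multiple of \<open>\<mu>\<^sub>+\<^sup>n\<close> to the right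
  and of \<open>\<mu>\<^sub>-\<^sup>n\<close> to the left of \<open>0\<close>, with the factor fixed by the jump at \<open>0\<close>.\<close>

definition green :: "complex \<Rightarrow> int \<Rightarrow> complex" where
  "green l n = inverse (mu_minus l - mu_plus l) *
     (if 0 \<le> n then mu_plus l powi n else mu_minus l powi n)"

lemma powi_root_step:
  fixes \<mu> :: complex
  assumes "\<mu> \<noteq> 0" "\<mu>\<^sup>2 + l * \<mu> - 1 = 0"
  shows "\<mu> powi (n - 1) - \<mu> powi (n + 1) = l * \<mu> powi n"
proof -
  have "\<mu> powi (n + 1) = \<mu> powi (n - 1) * \<mu>\<^sup>2" "\<mu> powi n = \<mu> powi (n - 1) * \<mu>"
    using assms(1) power_int_add[of \<mu> "n - 1" 2] power_int_add_1[of \<mu> "n - 1"]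
    by (simp_all add: add.commute)
  moreover have "1 - \<mu>\<^sup>2 = l * \<mu>" using assms(2) by (simp add: algebra_simps)
  hence "\<mu> powi (n - 1) * (1 - \<mu>\<^sup>2) = \<mu> powi (n - 1) * (l * \<mu>)" by simp
  ultimately show ?thesis by (simp add: algebra_simps)
qed

lemma mu_root:
  assumes "l \<in> param_dom"
  shows "(mu_plus l)\<^sup>2 + l * mu_plus l - 1 = 0" "(mu_minus l)\<^sup>2 + l * mu_minus l - 1 = 0"
proof -
  define a b where "a = mu_plus l" and "b = mu_minus l"
  have *: "l = - a - b" "a * b = -1" 
    using param_eq[OF assms] characteristic_roots(3)[OF assms] by (simp_all add: a_def b_def)
  have "a\<^sup>2 + (- a - b) * a - 1 = - (a * b) - 1" "b\<^sup>2 + (- a - b) * b - 1 = - (a * b) - 1"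
    by (simp_all add: power2_eq_square algebra_simps)
  hence "a\<^sup>2 + l * a - 1 = 0" "b\<^sup>2 + l * b - 1 = 0" using * by simp_all
  thus "(mu_plus l)\<^sup>2 + l * mu_plus l - 1 = 0" "(mu_minus l)\<^sup>2 + l * mu_minus l - 1 = 0"
    by (simp_all add: a_def b_def)
qed

lemma green_fundamental:
  assumes "l \<in> param_dom"
  shows "green l (n - 1) - green l (n + 1) - l * green l n = (if n = 0 then 1 else 0)"
proof -
  let ?C = "inverse (mu_minus l - mu_plus l)"
  note nz = mu_nonzero[OF assms]
  note p = powi_root_step[OF nz(1) mu_root(1)[OF assms]]
  note m = powi_root_step[OF nz(2) mu_root(2)[OF assms]]
  consider "n = 0" | "n \<ge> 1" | "n \<le> -1" by linarith
  thus ?thesis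
  proof cases
    case 1
    have "inverse (mu_minus l) = - mu_plus l"
      using mu_minus_eq[OF assms] by simp
    hence "green l (n - 1) - green l (n + 1) - l * green l n =
        ?C * (- mu_plus l) - ?C * mu_plus l - l * ?C"
      using 1 by (simp add: green_def power_int_minus)
    also have "\<dots> = ?C * (- mu_plus l - mu_plus l - l)" by (simp only: algebra_simps)
    also have "- mu_plus l - mu_plus l - l = mu_minus l - mu_plus l"
      by (subst (3) param_eq[OF assms]) simp
    finally have "green l (n - 1) - green l (n + 1) - l * green l n = ?C * (mu_minus l - mu_plus l)" .
    thus ?thesis using 1 nz by simp
  next
    case 2
    hence "green l (n - 1) - green l (n + 1) - l * green l n =
        ?C * (mu_plus l powi (n - 1) - mu_plus l powi (n + 1) - l * mu_plus l powi n)"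
      by (simp add: green_def algebra_simps)
    thus ?thesis using 2 p[of n] by simp
  next
    case 3
    have "green l (n + 1) = ?C * mu_minus l powi (n + 1)"
    proof (cases "n = -1")
      case False
      hence "\<not> 0 \<le> n + 1" using 3 by simp
      thus ?thesis by (simp add: green_def)
    qed (simp add: green_def)
    moreover have "green l (n - 1) = ?C * mu_minus l powi (n - 1)" "green l n = ?C * mu_minus l powi n"
      using 3 by (simp_all add: green_def)
    ultimately have "green l (n - 1) - green l (n + 1) - l * green l n =
        ?C * (mu_minus l powi (n - 1) - mu_minus l powi (n + 1) - l * mu_minus l powi n)"
      by (simp only: algebra_simps)
    thus ?thesis using 3 m[of n] by simp
  qed
qed

lemma green_abs_summable:
  assumes "l \<in> param_dom"
  shows "(\<lambda>n. cmod (green l n)) summable_on UNIV"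
proof (rule summable_on_int_halves)
  let ?C = "inverse (mu_minus l - mu_plus l)" and ?a = "cmod (mu_plus l)"
  have a: "?a < 1" by (rule characteristic_roots(5)[OF assms])
  have "summable (\<lambda>n. cmod ?C * ?a ^ n)" using a by (intro summable_mult summable_geometric) simp
  hence geo: "(\<lambda>n. cmod ?C * ?a ^ n) summable_on UNIV"
    by (subst summable_on_UNIV_nonneg_real_iff) auto
  show "(\<lambda>n. cmod (green l (int n))) summable_on UNIV"
    using geo by (simp add: green_def norm_mult norm_power)
  have "cmod (green l (- int n)) = cmod ?C * ?a ^ n" for n
    using mu_minus_eq[OF assms]
    by (cases "n = 0") (simp_all add: green_def norm_mult norm_power power_int_minus norm_inverse
        flip: power_inverse)
  thus "(\<lambda>n. cmod (green l (- int n))) summable_on UNIV" using geo by simp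
qed

lemma has_sum_diff:
  fixes f g :: "'i \<Rightarrow> complex"
  assumes "(f has_sum a) A" "(g has_sum b) A"
  shows "((\<lambda>i. f i - g i) has_sum (a - b)) A"
  using has_sum_add[OF assms(1) has_sum_uminusI[OF assms(2)]] by simp

lemma L_op_green:
  assumes l: "l \<in> param_dom" and f: "f \<in> ell2"
  shows "L_op l (\<lambda>n. \<Sum>\<^sub>\<infinity>m. green l (n - m) * f m) = f"
proof
  fix n
  let ?g = "green l"
  have s: "(\<lambda>m. ?g (k - m) * f m) summable_on UNIV" for k
    by (rule abs_summable_summable[OF convolution_summable[OF green_abs_summable[OF l] f]])
  have "((\<lambda>m. ?g (n - 1 - m) * f m - ?g (n + 1 - m) * f m - l * (?g (n - m) * f m)) has_sum
     (\<Sum>\<^sub>\<infinity>m. ?g (n - 1 - m) * f m) - (\<Sum>\<^sub>\<infinity>m. ?g (n + 1 - m) * f m) -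
     l * (\<Sum>\<^sub>\<infinity>m. ?g (n - m) * f m)) UNIV"
    by (intro has_sum_diff has_sum_cmult_right has_sum_infsum s)
  also have "(\<lambda>m. ?g (n - 1 - m) * f m - ?g (n + 1 - m) * f m - l * (?g (n - m) * f m)) =
     (\<lambda>m. if m = n then f n else 0)"
  proof
    fix m
    have "?g (n - 1 - m) * f m - ?g (n + 1 - m) * f m - l * (?g (n - m) * f m) =
        (?g (n - m - 1) - ?g (n - m + 1) - l * ?g (n - m)) * f m"
      by (simp add: algebra_simps)
    thus "?g (n - 1 - m) * f m - ?g (n + 1 - m) * f m - l * (?g (n - m) * f m) =
        (if m = n then f n else 0)"
      unfolding green_fundamental[OF l] by simp
  qed
  finally have "((\<lambda>m. if m = n then f n else 0) has_sum L_op l (\<lambda>n. \<Sum>\<^sub>\<infinity>m. ?g (n - m) * f m) n) UNIV"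
    by (simp add: L_op_def shift_def shift_adj_def)
  moreover have "((\<lambda>m. if m = n then f n else 0) has_sum f n) UNIV"
    by (rule has_sum_finite_neutralI[of "{n}"]) auto
  ultimately show "L_op l (\<lambda>n. \<Sum>\<^sub>\<infinity>m. ?g (n - m) * f m) n = f n"
    by (rule has_sum_unique)
qed

lemma filterlim_int_ray:
  "filterlim (\<lambda>k. n + int k) at_top sequentially"
  "filterlim (\<lambda>k. n - int k) at_bot sequentially"
proof -
  have "eventually (\<lambda>k. z \<le> n + int k) sequentially" for z
    by (rule eventually_sequentiallyI[of "nat (z - n)"]) linarith
  thus "filterlim (\<lambda>k. n + int k) at_top sequentially" by (simp add: filterlim_at_top)
  have "eventually (\<lambda>k. n - int k \<le> z) sequentially" for z
    by (rule eventually_sequentiallyI[of "nat (n - z)"]) linarith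
  thus "filterlim (\<lambda>k. n - int k) at_bot sequentially" by (simp add: filterlim_at_bot)
qed

text \<open>The free equation factors as \<open>w\<^sub>n - \<mu>\<^sub>+ w\<^sub>n\<^sub>-\<^sub>1 = const \<cdot> \<mu>\<^sub>-\<^sup>n\<close>: a decaying solution
  has to vanish because \<open>\<mu>\<^sub>-\<^sup>n\<close> grows at \<open>+\<infinity>\<close> and \<open>\<mu>\<^sub>+\<^sup>n\<close> grows at \<open>-\<infinity>\<close>.\<close>

lemma expanding_recursion_tendsto_0:
  fixes x :: "nat \<Rightarrow> complex"
  assumes "\<And>k. x (Suc k) = \<mu> * x k" "1 \<le> cmod \<mu>" "x \<longlonglongrightarrow> 0"
  shows "x 0 = 0"
proof -
  have "cmod (x 0) \<le> cmod (x k)" for k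
  proof (induction k)
    case (Suc k)
    have "1 * cmod (x k) \<le> cmod \<mu> * cmod (x k)" using assms(2) by (intro mult_right_mono) auto
    thus ?case using Suc assms(1) by (simp add: norm_mult)
  qed simp
  hence "cmod (x 0) \<le> 0"
    using tendsto_norm[OF assms(3)] by (intro LIMSEQ_le_const) auto
  thus ?thesis by simp
qed

lemma L_op_kernel:
  assumes l: "l \<in> param_dom" and w: "w \<in> ell2" and L: "\<And>n. L_op l w n = 0"
  shows "w n = 0"
proof -
  let ?p = "mu_plus l" and ?m = "mu_minus l"
  define x where "x n = w n - ?p * w (n - 1)" for n
  have eq: "w (n + 1) = w (n - 1) - l * w n" for n
    using L[of n] by (simp add: L_op_def shift_def shift_adj_def algebra_simps)
  have xs: "x (n + 1) = ?m * x n" for n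
  proof -
    have "x (n + 1) = w (n - 1) + ?m * w n"
      by (simp add: x_def eq) (subst param_eq[OF l], simp add: algebra_simps)
    also have "\<dots> = ?m * w n - (?p * ?m) * w (n - 1)"
      using characteristic_roots(3)[OF l] by simp
    finally show ?thesis by (simp add: x_def algebra_simps)
  qed
  have x0: "x n = 0" for n
  proof -
    have "x \<in> ell2" unfolding x_def
      using ell2_translate[OF w, of "-1"] w by (intro ell2_diff ell2_scale) auto
    hence "(\<lambda>k. x (n + int k)) \<longlonglongrightarrow> 0"
      by (rule filterlim_compose[OF ell2_tendsto_0(1) filterlim_int_ray(1)])
    moreover have "x (n + int (Suc k)) = ?m * x (n + int k)" for k
      using xs[of "n + int k"] by (simp add: algebra_simps)
    ultimately have "x (n + int 0) = 0"
      using characteristic_roots(6)[OF l] by (intro expanding_recursion_tendsto_0[of _ ?m]) auto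
    thus ?thesis by simp
  qed
  have "(\<lambda>k. w (n - int k)) \<longlonglongrightarrow> 0"
    by (rule filterlim_compose[OF ell2_tendsto_0(2)[OF w] filterlim_int_ray(2)])
  moreover have "w (n - int (Suc k)) = inverse ?p * w (n - int k)" for k
    using x0[of "n - int k"] mu_nonzero[OF l] by (simp add: x_def field_simps)
  moreover have "1 \<le> cmod (inverse ?p)"
    using characteristic_roots(5)[OF l] mu_nonzero(1)[OF l] 
    by (simp add: norm_inverse one_le_inverse_iff)
  ultimately have "w (n - int 0) = 0"
    by (intro expanding_recursion_tendsto_0[of _ "inverse ?p"]) auto
  thus ?thesis by simp
qed

lemma L_op_ell2: "w \<in> ell2 \<Longrightarrow> L_op l w \<in> ell2"
  unfolding L_op_def shift_def shift_adj_def
  using ell2_translate[of w "-1"] ell2_translate[of w 1] by (intro ell2_diff ell2_scale) auto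

lemma L_op_inj: 
  assumes "l \<in> param_dom"
  shows "inj_on (L_op l) ell2"
proof (rule inj_onI)
  fix u w assume uw: "u \<in> ell2" "w \<in> ell2" "L_op l u = L_op l w"
  have "L_op l (\<lambda>n. u n - w n) n = L_op l u n - L_op l w n" for n
    by (simp add: L_op_def shift_def shift_adj_def algebra_simps)
  hence "u n - w n = 0" for n
    using uw by (intro L_op_kernel[OF assms, of "\<lambda>n. u n - w n"] ell2_diff) auto
  thus "u = w" by (simp add: fun_eq_iff)
qed

lemma L_op_bij:
  assumes "l \<in> param_dom"
  shows "bij_betw (L_op l) ell2 ell2"
  unfolding bij_betw_def
proof (intro conjI set_eqI iffI)
  show "inj_on (L_op l) ell2" by (rule L_op_inj[OF assms])
next
  fix f assume "f \<in> L_op l ` ell2"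
  thus "f \<in> ell2" using L_op_ell2 by blast
next
  fix f :: "int \<Rightarrow> complex" assume f: "f \<in> ell2"
  show "f \<in> L_op l ` ell2"
    using L_op_green[OF assms f] convolution_ell2[OF green_abs_summable[OF assms] f]
    by (metis (no_types, lifting) imageI)
qed

lemma L_op_inverse:
  assumes "l \<in> param_dom" "f \<in> ell2"
  shows "inv_into ell2 (L_op l) f = (\<lambda>n. \<Sum>\<^sub>\<infinity>m. green l (n - m) * f m)"
proof (rule inv_into_f_eq[OF L_op_inj[OF assms(1)]])
  show "(\<lambda>n. \<Sum>\<^sub>\<infinity>m. green l (n - m) * f m) \<in> ell2"
    by (rule convolution_ell2[OF green_abs_summable[OF assms(1)] assms(2)])
qed (rule L_op_green[OF assms])

section \<open>The first order system\<close>

lemma ell2_pair_iff: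
  fixes w :: "int \<times> 2 \<Rightarrow> complex"
  shows "w \<in> ell2 \<longleftrightarrow> (\<lambda>n. w (n, 1)) \<in> ell2 \<and> (\<lambda>n. w (n, 2)) \<in> ell2"
proof -
  let ?f = "\<lambda>k. (cmod (w k))\<^sup>2"
  have U: "UNIV = range (\<lambda>n::int. (n, 1::2)) \<union> range (\<lambda>n. (n, 2))"
    using exhaust_2 by (auto simp: image_iff)
  have "?f summable_on UNIV \<longleftrightarrow>
      ?f summable_on range (\<lambda>n. (n, 1)) \<and> ?f summable_on range (\<lambda>n. (n, 2))"
  proof
    assume "?f summable_on UNIV"
    thus "?f summable_on range (\<lambda>n. (n, 1)) \<and> ?f summable_on range (\<lambda>n. (n, 2))"
      by (auto intro: summable_on_subset_banach)
  next
    assume "?f summable_on range (\<lambda>n. (n, 1)) \<and> ?f summable_on range (\<lambda>n. (n, 2))"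
    thus "?f summable_on UNIV" unfolding U by (intro summable_on_union) auto
  qed
  also have "\<dots> \<longleftrightarrow> (\<lambda>n. w (n, 1)) \<in> ell2 \<and> (\<lambda>n. w (n, 2)) \<in> ell2"
    by (subst (1 2) summable_on_reindex) (auto simp: inj_def o_def ell2_def)
  finally show ?thesis by (simp add: ell2_def)
qed

lemma two_components:
  fixes u w :: "int \<times> 2 \<Rightarrow> complex"
  assumes "\<And>n. u (n, 1) = w (n, 1)" "\<And>n. u (n, 2) = w (n, 2)"
  shows "u = w"
proof
  fix k :: "int \<times> 2"
  obtain n i where "k = (n, i)" by (cases k)
  thus "u k = w k" using assms exhaust_2[of i] by auto
qed

lemma M_op_components:
  "M_op l w (n, 1) = w (n + 1, 1) + l * w (n, 1) - w (n, 2)"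
  "M_op l w (n, 2) = w (n + 1, 2) - w (n, 1)"
  by (simp_all add: M_op_def shift_adj2_def diag2_def A_mat_def matrix_vector_mult_def sum_2)

lemma M_op_ell2: "w \<in> ell2 \<Longrightarrow> M_op l w \<in> ell2"
  unfolding ell2_pair_iff M_op_components
  using ell2_translate[of "\<lambda>n. w (n, 1)" 1] ell2_translate[of "\<lambda>n. w (n, 2)" 1]
  by (auto intro!: ell2_diff ell2_add ell2_scale)

text \<open>Eliminating the second component turns \<open>M_op l y = f\<close> into the scalar equation for
  the first one, so that the scalar resolvent supplies the solution.\<close>

definition M_solution :: "(int \<Rightarrow> complex) \<Rightarrow> (int \<times> 2 \<Rightarrow> complex) \<Rightarrow> int \<times> 2 \<Rightarrow> complex" where
  "M_solution u f = (\<lambda>(n, i). if i = 1 then u n else u (n - 1) + f (n - 1, 2))"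

lemma M_op_solution:
  assumes "\<And>n. L_op l u n = - (f (n, 1) + f (n - 1, 2))"
  shows "M_op l (M_solution u f) = f"
proof (rule two_components)
  fix n
  have "M_op l (M_solution u f) (n, 1) = - L_op l u n - f (n - 1, 2)"
    by (simp add: M_op_components M_solution_def L_op_def shift_def shift_adj_def)
  thus "M_op l (M_solution u f) (n, 1) = f (n, 1)" by (simp add: assms)
  show "M_op l (M_solution u f) (n, 2) = f (n, 2)"
    by (simp add: M_op_components M_solution_def)
qed

lemma M_solution_ell2:
  assumes "u \<in> ell2" "f \<in> ell2"
  shows "M_solution u f \<in> ell2"
proof -
  have "(\<lambda>n. u (n - 1) + f (n - 1, 2)) \<in> ell2"
    using assms ell2_translate[of u "-1"] ell2_translate[of "\<lambda>n. f (n, 2)" "-1"]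
    by (intro ell2_add) (auto simp: ell2_pair_iff)
  thus ?thesis using assms
    unfolding ell2_pair_iff[of "M_solution u f"] by (simp add: M_solution_def)
qed

lemma M_op_inj:
  assumes l: "l \<in> param_dom"
  shows "inj_on (M_op l) ell2"
proof (rule inj_onI)
  fix u w assume uw: "u \<in> ell2" "w \<in> ell2" and eq: "M_op l u = M_op l w"
  define d where "d = (\<lambda>k. u k - w k)"
  have d: "d \<in> ell2" using uw unfolding d_def by (intro ell2_diff)
  have e1: "d (n + 1, 1) + l * d (n, 1) - d (n, 2) = 0" and e2: "d (n + 1, 2) = d (n, 1)" for n
    using fun_cong[OF eq, of "(n, 1)"] fun_cong[OF eq, of "(n, 2)"]
    by (simp_all add: M_op_components d_def algebra_simps)
  have "L_op l (\<lambda>n. d (n, 1)) n = 0" for n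
    using e1[of n] e2[of "n - 1"] by (simp add: L_op_def shift_def shift_adj_def algebra_simps)
  hence d1: "d (n, 1) = 0" for n
    using L_op_kernel[OF l, of "\<lambda>n. d (n, 1)"] d by (simp add: ell2_pair_iff)
  moreover have "d (n, 2) = 0" for n using e2[of "n - 1"] d1 by simp
  ultimately show "u = w" by (intro two_components) (simp_all add: d_def)
qed

lemma M_op_bij:
  assumes l: "l \<in> param_dom"
  shows "bij_betw (M_op l) ell2 ell2"
  unfolding bij_betw_def
proof (intro conjI set_eqI iffI)
  show "inj_on (M_op l) ell2" by (rule M_op_inj[OF l])
next
  fix f assume "f \<in> M_op l ` ell2"
  thus "f \<in> ell2" using M_op_ell2 by blast
next
  fix f :: "int \<times> 2 \<Rightarrow> complex" assume f: "f \<in> ell2"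
  have "(\<lambda>n. f (n, 1) + f (n - 1, 2)) \<in> ell2"
    using f ell2_translate[of "\<lambda>n. f (n, 2)" "-1"] by (intro ell2_add) (auto simp: ell2_pair_iff)
  from ell2_scale[OF this, of "-1"] have "(\<lambda>n. - (f (n, 1) + f (n - 1, 2))) \<in> L_op l ` ell2"
    using L_op_bij[OF l] by (simp add: bij_betw_def)
  then obtain u where u: "(\<lambda>n. - (f (n, 1) + f (n - 1, 2))) = L_op l u" "u \<in> ell2"
    by (rule imageE)
  have "M_op l (M_solution u f) = f"
    by (rule M_op_solution) (simp flip: u(1))
  with M_solution_ell2[OF u(2) f] show "f \<in> M_op l ` ell2" by (auto intro: rev_image_eqI)
qed

section \<open>The perturbed operators\<close>

text \<open>The scattering theory treats \<open>1 - \<rho>\<close> as a summable perturbation: summability makes \<open>b\<close> and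
  \<open>c\<close> square-summable and \<open>v = b c\<close> summable, once \<open>1 / \<rho>\<close> is bounded. The class is
  closed under \<open>n \<mapsto> -n\<close>.\<close>

locale summable_defect =
  fixes \<rho> :: "int \<Rightarrow> real" and \<delta> :: real
  assumes le1: "\<rho> n \<le> 1" and \<delta>_pos: "0 < \<delta>" and away: "\<delta> \<le> \<bar>\<rho> n\<bar>"
    and defect_summable: "(\<lambda>n. 1 - \<rho> n) summable_on UNIV"

text \<open>The perturbation: the difference equation reads \<open>(S - S\<^sup>* - \<lambda> + v) z = 0\<close>, and \<open>v = b c\<close>.\<close>

definition v_coef :: "(int \<Rightarrow> real) \<Rightarrow> complex \<Rightarrow> int \<Rightarrow> complex" where
  "v_coef \<rho> l n = l - l / of_real (\<rho> n)"

definition K_kernel :: "(int \<Rightarrow> real) \<Rightarrow> complex \<Rightarrow> int \<Rightarrow> int \<Rightarrow> complex" where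
  "K_kernel \<rho> l i j = - c_coef \<rho> i * green l (i - j) * b_coef \<rho> l j"

context summable_defect
begin

lemma nonzero: "\<rho> n \<noteq> 0"
  using away[of n] \<delta>_pos by auto

lemma c_ell2: "c_coef \<rho> \<in> ell2"
  unfolding ell2_def mem_Collect_eq
  by (rule summable_on_comparison_test[OF defect_summable]) (auto simp: c_coef_def le1)

lemma cmod_b_le: "(cmod (b_coef \<rho> l n))\<^sup>2 \<le> (cmod l)\<^sup>2 / \<delta>\<^sup>2 * (1 - \<rho> n)"
proof -
  have "(cmod (b_coef \<rho> l n))\<^sup>2 = (cmod l)\<^sup>2 * (1 - \<rho> n) / \<bar>\<rho> n\<bar>\<^sup>2"
    using le1[of n]
    by (simp add: b_coef_def norm_mult norm_divide power_mult_distrib power_divide)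
  also have "\<dots> \<le> (cmod l)\<^sup>2 * (1 - \<rho> n) / \<delta>\<^sup>2"
    using \<delta>_pos away[of n] le1[of n] nonzero[of n]
    by (intro divide_left_mono power_mono mult_nonneg_nonneg mult_pos_pos) auto
  finally show ?thesis by simp
qed

lemma b_ell2: "b_coef \<rho> l \<in> ell2"
proof -
  have "(\<lambda>n. (cmod l)\<^sup>2 / \<delta>\<^sup>2 * (1 - \<rho> n)) summable_on UNIV"
    by (rule summable_on_cmult_right[OF defect_summable])
  thus ?thesis
    unfolding ell2_def mem_Collect_eq
    by (rule summable_on_comparison_test) (rule cmod_b_le, simp)
qed

lemma bc_eq_v: "b_coef \<rho> l n * c_coef \<rho> n = v_coef \<rho> l n"
proof -
  have "sqrt (1 - \<rho> n) * sqrt (1 - \<rho> n) = 1 - \<rho> n" using le1[of n] by simp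
  hence "complex_of_real (sqrt (1 - \<rho> n)) * complex_of_real (sqrt (1 - \<rho> n)) = 1 - of_real (\<rho> n)"
    by (metis of_real_1 of_real_diff of_real_mult)
  hence "b_coef \<rho> l n * c_coef \<rho> n = - l * (1 - of_real (\<rho> n)) / of_real (\<rho> n)"
    by (simp add: b_coef_def c_coef_def mult.assoc)
  thus ?thesis using nonzero[of n] by (simp add: v_coef_def field_simps)
qed

lemma cmod_v_le: "cmod (v_coef \<rho> l n) \<le> cmod l / \<delta> * (1 - \<rho> n)"
proof -
  have "v_coef \<rho> l n = - (l * of_real (1 - \<rho> n) / of_real (\<rho> n))"
    using nonzero[of n] by (simp add: v_coef_def field_simps)
  hence "cmod (v_coef \<rho> l n) = cmod l * (1 - \<rho> n) / \<bar>\<rho> n\<bar>"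
    using le1[of n] by (simp add: norm_mult norm_divide del: of_real_diff)
  also have "\<dots> \<le> cmod l * (1 - \<rho> n) / \<delta>"
    using \<delta>_pos away[of n] le1[of n] nonzero[of n]
    by (intro divide_left_mono mult_nonneg_nonneg mult_pos_pos) auto
  finally show ?thesis by simp
qed

lemma b_mult_ell2:
  assumes "w \<in> ell2"
  shows "(\<lambda>n. b_coef \<rho> l n * w n) \<in> ell2"
proof -
  obtain B where "\<And>i. cmod (b_coef \<rho> l i) \<le> B" using ell2_bounded[OF b_ell2[of l]] by blast
  thus ?thesis using assms by (rule ell2_bounded_mult[rotated])
qed

lemma K_op_eq:
  assumes "l \<in> param_dom" "w \<in> ell2"
  shows "K_op \<rho> l w n = - c_coef \<rho> n * (\<Sum>\<^sub>\<infinity>m. green l (n - m) * (b_coef \<rho> l m * w m))"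
  unfolding K_op_def diag_def L_op_inverse[OF assms(1) b_mult_ell2[OF assms(2)]] by simp

lemma K_op_unit_vec:
  assumes "l \<in> param_dom"
  shows "K_op \<rho> l (unit_vec j) i = K_kernel \<rho> l i j"
proof -
  have "(\<Sum>\<^sub>\<infinity>m. green l (i - m) * (b_coef \<rho> l m * unit_vec j m)) =
        (\<Sum>\<^sub>\<infinity>m\<in>{j}. green l (i - m) * (b_coef \<rho> l m * unit_vec j m))"
    by (rule infsum_cong_neutral) (auto simp: unit_vec_def)
  thus ?thesis
    using K_op_eq[OF assms ell2_unit_vec[of j], of i] by (simp add: unit_vec_def K_kernel_def)
qed

text \<open>By the inequality of arithmetic and geometric means, the entry \<open>c\<^sub>i g(i - j) b\<^sub>j\<close> is dominated by
  \<open>\<bar>g(i - j)\<bar> (\<bar>c\<^sub>i\<bar>\<^sup>2 + \<bar>b\<^sub>j\<bar>\<^sup>2)\<close>, a sum of two convolution kernels.\<close>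

lemma K_kernel_summable:
  assumes "l \<in> param_dom"
  shows "(\<lambda>(j, i). cmod (K_kernel \<rho> l i j)) summable_on UNIV"
proof -
  let ?g = "\<lambda>n. cmod (green l n)"
  let ?C = "\<lambda>n. (cmod (c_coef \<rho> n))\<^sup>2" and ?B = "\<lambda>n. (cmod (b_coef \<rho> l n))\<^sup>2"
  have g: "?g summable_on UNIV" by (rule green_abs_summable[OF assms])
  have g': "(\<lambda>n. ?g (- n)) summable_on UNIV"
    using summable_on_shift_int(2)[OF g, of 0] by simp
  have "(\<lambda>(j, i). ?g (i - j) * ?B j) summable_on UNIV"
    by (rule summable_on_convolution_pairs) (use g b_ell2 in \<open>auto simp: ell2_def\<close>)
  moreover have "(\<lambda>(j, i). ?g (i - j) * ?C i) summable_on UNIV \<times> UNIV"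
    using summable_on_convolution_pairs[OF g', of ?C] c_ell2
      summable_on_swap[of "\<lambda>(j, i). ?g (i - j) * ?C i" UNIV UNIV]
    by (simp add: ell2_def case_prod_unfold)
  ultimately have "(\<lambda>k. (case k of (j, i) \<Rightarrow> ?g (i - j) * ?B j) +
       (case k of (j, i) \<Rightarrow> ?g (i - j) * ?C i)) summable_on UNIV"
    by (intro summable_on_add) auto
  thus ?thesis
  proof (rule summable_on_comparison_test)
    fix k :: "int \<times> int"
    obtain j i where k: "k = (j, i)" by (cases k)
    have "cmod (c_coef \<rho> i) * cmod (b_coef \<rho> l j) \<le> ?B j + ?C i"
      using sum_squares_bound[of "cmod (c_coef \<rho> i)" "cmod (b_coef \<rho> l j)"]
        mult_nonneg_nonneg[OF norm_ge_zero[of "c_coef \<rho> i"] norm_ge_zero[of "b_coef \<rho> l j"]]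
      by linarith
    hence "?g (i - j) * (cmod (c_coef \<rho> i) * cmod (b_coef \<rho> l j)) \<le> ?g (i - j) * (?B j + ?C i)"
      by (intro mult_left_mono) auto
    thus "(case k of (j, i) \<Rightarrow> cmod (K_kernel \<rho> l i j)) \<le>
        (case k of (j, i) \<Rightarrow> ?g (i - j) * ?B j) + (case k of (j, i) \<Rightarrow> ?g (i - j) * ?C i)"
      by (simp add: k K_kernel_def norm_mult algebra_simps)
  qed auto
qed

lemma K_op_has_sum:
  assumes "l \<in> param_dom" "w \<in> ell2"
  shows "((\<lambda>m. w m * K_kernel \<rho> l i m) has_sum K_op \<rho> l w i) UNIV"
proof -
  have "(\<lambda>m. green l (i - m) * (b_coef \<rho> l m * w m)) summable_on UNIV"
    by (rule abs_summable_summable[OF convolution_summable[OF green_abs_summable[OF assms(1)]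
          b_mult_ell2[OF assms(2)]]])
  hence "((\<lambda>m. - c_coef \<rho> i * (green l (i - m) * (b_coef \<rho> l m * w m))) has_sum
      - c_coef \<rho> i * (\<Sum>\<^sub>\<infinity>m. green l (i - m) * (b_coef \<rho> l m * w m))) UNIV"
    by (intro has_sum_cmult_right) simp
  moreover have "(\<lambda>m. - c_coef \<rho> i * (green l (i - m) * (b_coef \<rho> l m * w m))) =
      (\<lambda>m. w m * K_kernel \<rho> l i m)"
    by (simp add: K_kernel_def fun_eq_iff)
  ultimately show ?thesis by (simp add: K_op_eq[OF assms])
qed

text \<open>The matrix of \<open>K\<close> is absolutely summable, so \<open>K\<close> is the nuclear sum of its
  matrix units.\<close>

lemma K_op_trace_class:
  assumes l: "l \<in> param_dom"
  shows "trace_class (K_op \<rho> l)"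
proof -
  define e where "e = from_nat_into (UNIV :: (int \<times> int) set)"
  have e: "bij_betw e UNIV UNIV"
    unfolding e_def by (rule bij_betw_from_nat_into) (auto simp: finite_prod)
  define u where "u k = (\<lambda>i. K_kernel \<rho> l (snd (e k)) (fst (e k)) * unit_vec (snd (e k)) i)" for k
  define v where "v k = (unit_vec (fst (e k)) :: int \<Rightarrow> complex)" for k
  have norms: "ell2_norm (u k) * ell2_norm (v k) = (\<lambda>(j, i). cmod (K_kernel \<rho> l i j)) (e k)" for k
    using ell2_norm_unit_vec[of 1 "fst (e k)"]
    by (simp add: u_def v_def ell2_norm_unit_vec case_prod_unfold)
  have "(\<lambda>k. ell2_norm (u k) * ell2_norm (v k)) summable_on UNIV"
    unfolding norms using summable_on_reindex_bij_betw[OF e] K_kernel_summable[OF l] by blast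
  moreover have "((\<lambda>k. ell2_inner (v k) w * u k i) has_sum K_op \<rho> l w i) UNIV"
    if w: "w \<in> ell2" for w i
  proof -
    let ?f = "\<lambda>(j, i'). w j * K_kernel \<rho> l i' j * unit_vec i' i"
    have "((\<lambda>m. ?f (m, i)) has_sum K_op \<rho> l w i) UNIV"
      using K_op_has_sum[OF l w, of i] by (simp add: unit_vec_def)
    hence "((?f \<circ> (\<lambda>m. (m, i))) has_sum K_op \<rho> l w i) UNIV" by (simp add: o_def)
    hence "(?f has_sum K_op \<rho> l w i) (range (\<lambda>m. (m, i)))"
      by (subst has_sum_reindex) (auto simp: inj_def)
    moreover have "(?f has_sum K_op \<rho> l w i) (range (\<lambda>m. (m, i))) \<longleftrightarrow>
        (?f has_sum K_op \<rho> l w i) UNIV"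
      by (rule has_sum_cong_neutral) (auto simp: unit_vec_def)
    ultimately have "(?f has_sum K_op \<rho> l w i) UNIV" by simp
    hence "((\<lambda>k. ?f (e k)) has_sum K_op \<rho> l w i) UNIV"
      by (subst has_sum_reindex_bij_betw[OF e])
    thus ?thesis
      by (simp add: u_def v_def ell2_inner_unit_vec case_prod_unfold mult.assoc)
  qed
  moreover have "u k \<in> ell2 \<and> v k \<in> ell2" for k
    by (simp add: u_def v_def ell2_scale ell2_unit_vec)
  ultimately show ?thesis unfolding trace_class_def by blast
qed

text \<open>\<open>B\<close> feeds the first component only and \<open>C\<close> reads the first component only, and on first components
  the resolvent of the system is \<open>-(S - S\<^sup>* - \<lambda>)\<^sup>-\<^sup>1\<close>. So \<open>T\<close> is \<open>K\<close> padded with zeros.\<close>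

lemma T_op_eq:
  assumes l: "l \<in> param_dom" and w: "w \<in> ell2"
  shows "T_op \<rho> l w (n, i) = (if i = 1 then K_op \<rho> l (\<lambda>n. w (n, 1)) n else 0)"
proof -
  let ?f = "diag2 (B_mat \<rho> l) w"
  define r where "r = inv_into ell2 (L_op l) (\<lambda>n. b_coef \<rho> l n * w (n, 1))"
  (* the sign: the first component of M_op is the negative of the scalar operator *)
  define u where "u = (\<lambda>n. (-1) * r n)"
  have w1: "(\<lambda>n. w (n, 1)) \<in> ell2" using w by (simp add: ell2_pair_iff)
  have f1: "?f (n, 1) = b_coef \<rho> l n * w (n, 1)" and f2: "?f (n, 2) = 0" for n
    by (simp_all add: diag2_def B_mat_def Q_plus_def mat_def matrix_matrix_mult_def
        matrix_vector_mult_def sum_2)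
  have f: "?f \<in> ell2"
    unfolding ell2_pair_iff f1 f2 using b_mult_ell2[OF w1] by (simp add: ell2_def)
  have "(\<lambda>n. b_coef \<rho> l n * w (n, 1)) \<in> L_op l ` ell2"
    using b_mult_ell2[OF w1] L_op_bij[OF l] by (simp add: bij_betw_def)
  hence "r \<in> ell2" "L_op l r = (\<lambda>n. b_coef \<rho> l n * w (n, 1))"
    unfolding r_def by (rule inv_into_into, rule f_inv_into_f)
  moreover have "L_op l u n = - L_op l r n" for n
    by (simp add: u_def L_op_def shift_def shift_adj_def)
  ultimately have u: "u \<in> ell2" "\<And>n. L_op l u n = - (?f (n, 1) + ?f (n - 1, 2))"
    unfolding f1 f2 using ell2_scale[of r "-1"] by (simp_all add: u_def)
  have "inv_into ell2 (M_op l) ?f = M_solution u ?f"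
    by (rule inv_into_f_eq[OF M_op_inj[OF l] M_solution_ell2[OF u(1) f]])
       (rule M_op_solution, rule u(2))
  hence "T_op \<rho> l w = diag2 (C_mat \<rho>) (M_solution u ?f)"
    by (simp add: T_op_def)
  moreover have "diag2 (C_mat \<rho>) y (n, i) = (if i = 1 then c_coef \<rho> n * y (n, 1) else 0)" for y
    using exhaust_2[of i]
    by (auto simp: diag2_def C_mat_def Q_plus_def mat_def matrix_matrix_mult_def
        matrix_vector_mult_def sum_2)
  ultimately show ?thesis
    by (simp add: M_solution_def u_def r_def K_op_def diag_def)
qed

lemma T_op_trace_class:
  assumes l: "l \<in> param_dom"
  shows "trace_class (T_op \<rho> l)"
proof -
  obtain u v where "\<forall>k. u k \<in> ell2 \<and> v k \<in> ell2"
    and summ: "(\<lambda>k::nat. ell2_norm (u k) * ell2_norm (v k)) summable_on UNIV"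
    and rep: "\<forall>w\<in>ell2. \<forall>i. ((\<lambda>k. ell2_inner (v k) w * u k i) has_sum K_op \<rho> l w i) UNIV"
    using K_op_trace_class[OF l] unfolding trace_class_def by (elim exE conjE)
  hence uv: "\<And>k. u k \<in> ell2" "\<And>k. v k \<in> ell2" by simp_all
  define emb where "emb x = (\<lambda>(n, i::2). if i = 1 then x n else 0)" for x :: "int \<Rightarrow> complex"
  have emb_ell2: "emb x \<in> ell2" if "x \<in> ell2" for x
    unfolding ell2_pair_iff using that by (simp add: emb_def ell2_def)
  have emb_sum: "(\<Sum>\<^sub>\<infinity>k. f k) = (\<Sum>\<^sub>\<infinity>n. f (n, 1))" if "\<And>n. f (n, 2) = 0"
    for f :: "int \<times> 2 \<Rightarrow> 'c :: {comm_monoid_add, t2_space}"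
  proof -
    have "(\<Sum>\<^sub>\<infinity>k. f k) = (\<Sum>\<^sub>\<infinity>k\<in>range (\<lambda>n. (n, 1)). f k)"
    proof (rule infsum_cong_neutral)
      fix k assume k: "k \<in> UNIV - range (\<lambda>n::int. (n, 1::2))"
      obtain n i where "k = (n, i)" by (cases k)
      thus "f k = 0" using k exhaust_2[of i] that by auto
    qed auto
    also have "\<dots> = (\<Sum>\<^sub>\<infinity>n. f (n, 1))" by (subst infsum_reindex) (auto simp: inj_def o_def)
    finally show ?thesis .
  qed
  have norm: "ell2_norm (emb x) = ell2_norm x" for x
    using emb_sum[of "\<lambda>k. (cmod (emb x k))\<^sup>2"] by (simp add: ell2_norm_def emb_def)
  have inner: "ell2_inner (emb x) w = ell2_inner x (\<lambda>n. w (n, 1))" for x w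
    using emb_sum[of "\<lambda>k. cnj (emb x k) * w k"] by (simp add: ell2_inner_def emb_def)
  have "((\<lambda>k. ell2_inner (emb (v k)) w * emb (u k) j) has_sum T_op \<rho> l w j) UNIV"
    if w: "w \<in> ell2" for w j
  proof -
    obtain n i where j: "j = (n, i)" by (cases j)
    have "(\<lambda>n. w (n, 1)) \<in> ell2" using w by (simp add: ell2_pair_iff)
    hence "((\<lambda>k. ell2_inner (emb (v k)) w * u k n) has_sum K_op \<rho> l (\<lambda>n. w (n, 1)) n) UNIV"
      unfolding inner using rep by blast
    moreover have "emb (u k) j = (if i = 1 then u k n else 0)" for k by (simp add: emb_def j)
    ultimately show ?thesis by (simp add: j T_op_eq[OF l w])
  qed
  moreover have "(\<lambda>k. ell2_norm (emb (u k)) * ell2_norm (emb (v k))) summable_on UNIV"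
    using summ by (simp add: norm)
  ultimately show ?thesis
    unfolding trace_class_def using emb_ell2[OF uv(1)] emb_ell2[OF uv(2)]
    by (intro exI[of _ "\<lambda>k. emb (u k)"] exI[of _ "\<lambda>k. emb (v k)"] conjI allI ballI) assumption+
qed

text \<open>A principal minor of \<open>T\<close> vanishes if it involves a second component, and otherwise it is
  a principal minor of \<open>K\<close>.\<close>

lemma fredholm_det_T_eq_K:
  assumes l: "l \<in> param_dom"
  shows "fredholm_det (T_op \<rho> l) = fredholm_det (K_op \<rho> l)"
proof -
  let ?h = "\<lambda>n::int. (n, 1::2)"
  let ?MT = "\<lambda>i j. T_op \<rho> l (unit_vec j) i" and ?MK = "\<lambda>i j. K_op \<rho> l (unit_vec j) i"
  have entry: "?MT (n, i) j = (if i = 1 then K_op \<rho> l (\<lambda>n. unit_vec j (n, 1)) n else 0)" for n i j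
    by (rule T_op_eq[OF l ell2_unit_vec])
  have "(\<lambda>n. unit_vec (?h m) (n, 1)) = unit_vec m" for m by (simp add: unit_vec_def fun_eq_iff)
  hence entry1: "?MT (?h n) (?h m) = ?MK n m" for n m
    using entry[where n = n and i = 1 and j = "?h m"] by simp
  have "ext_power_trace k (T_op \<rho> l) = ext_power_trace k (K_op \<rho> l)" for k
  proof -
    have "ext_power_trace k (T_op \<rho> l) =
        (\<Sum>\<^sub>\<infinity>F\<in>(`) ?h ` {F. finite F \<and> card F = k}. det_on F ?MT)"
      unfolding ext_power_trace_def
    proof (rule infsum_cong_neutral)
      fix F assume F: "F \<in> {F. finite F \<and> card F = k} - (`) ?h ` {F. finite F \<and> card F = k}"
      show "det_on F ?MT = 0"
      proof (cases "\<exists>n. (n, 2) \<in> F")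
        case True
        then obtain n where "(n, 2) \<in> F" by blast
        thus ?thesis using F entry[where n = n and i = 2] by (intro det_on_zero_row[of F "(n, 2)"]) auto
      next
        case False
        have "F = ?h ` (fst ` F)"
        proof (intro set_eqI iffI)
          fix p assume p: "p \<in> F"
          obtain n i where "p = (n, i)" by (cases p)
          thus "p \<in> ?h ` (fst ` F)" using p False exhaust_2[of i] by force
        next
          fix p assume "p \<in> ?h ` (fst ` F)"
          then obtain n i where ni: "(n, i) \<in> F" "p = (n, 1)" by auto
          thus "p \<in> F" using False exhaust_2[of i] by auto
        qed
        moreover have "card (fst ` F) = card (?h ` (fst ` F))"
          by (rule card_image[symmetric]) (auto simp: inj_on_def)
        ultimately have "F \<in> (`) ?h ` {F. finite F \<and> card F = k}"
          using F by (intro image_eqI[of _ _ "fst ` F"]) auto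
        thus ?thesis using F by blast
      qed
    next
      fix F assume "F \<in> (`) ?h ` {F. finite F \<and> card F = k} - {F. finite F \<and> card F = k}"
      thus "det_on F ?MT = 0" by (auto simp: card_image inj_on_def)
    qed auto
    also have "\<dots> = (\<Sum>\<^sub>\<infinity>F\<in>{F. finite F \<and> card F = k}. det_on (?h ` F) ?MT)"
      by (subst infsum_reindex) (auto simp: inj_on_def o_def inj_image_eq_iff)
    also have "\<dots> = (\<Sum>\<^sub>\<infinity>F\<in>{F. finite F \<and> card F = k}. det_on F ?MK)"
    proof (rule infsum_cong)
      fix F :: "int set" assume "F \<in> {F. finite F \<and> card F = k}"
      thus "det_on (?h ` F) ?MT = det_on F ?MK"
        by (subst det_on_image) (auto simp: inj_on_def entry1)
    qed
    finally show ?thesis by (simp add: ext_power_trace_def)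
  qed
  thus ?thesis by (simp add: fredholm_det_def)
qed

end

section \<open>The Fredholm series\<close>

text \<open>Once the principal minors are absolutely summable, the grouping of the Fredholm series by the size of
  the index set can be dissolved into a single sum over all finite index sets.\<close>

lemma fredholm_det_has_sum:
  assumes "(\<lambda>F. cmod (det_on F (\<lambda>i j. T (unit_vec j) i))) summable_on {F. finite F}"
  shows "((\<lambda>F. (-1) ^ card F * det_on F (\<lambda>i j. T (unit_vec j) i)) has_sum fredholm_det T) {F. finite F}"
proof -
  let ?M = "\<lambda>i j. T (unit_vec j) i"
  let ?f = "\<lambda>F. (-1) ^ card F * det_on F ?M"
  let ?S = "\<lambda>k. {F. finite F \<and> card F = k}"
  have "(\<lambda>F. norm (?f F)) summable_on {F. finite F}"
    using assms by (simp add: norm_mult norm_power)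
  hence f: "?f summable_on {F. finite F}" by (rule abs_summable_summable)
  have bij: "bij_betw snd (Sigma UNIV ?S) {F. finite F}"
    by (rule bij_betwI[of _ _ _ "\<lambda>F. (card F, F)"]) auto
  have "((\<lambda>x. ?f (snd x)) has_sum infsum ?f {F. finite F}) (Sigma UNIV ?S)"
    using f by (subst has_sum_reindex_bij_betw[OF bij]) simp
  hence "((\<lambda>k. (-1) ^ k * ext_power_trace k T) has_sum infsum ?f {F. finite F}) UNIV"
  proof (rule has_sum_Sigma')
    fix k
    have "det_on F ?M = (-1) ^ card F * ?f F" for F by simp
    hence "(\<lambda>F. det_on F ?M) summable_on ?S k"
      using summable_on_cmult_right[OF summable_on_subset_banach[OF f, of "?S k"], of "(-1) ^ k"]
      by (subst summable_on_cong[where g = "\<lambda>F. (-1) ^ k * ?f F"]) auto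
    hence "((\<lambda>F. (-1) ^ k * det_on F ?M) has_sum (-1) ^ k * ext_power_trace k T) (?S k)"
      unfolding ext_power_trace_def by (intro has_sum_cmult_right) simp
    thus "((\<lambda>F. ?f (snd (k, F))) has_sum (-1) ^ k * ext_power_trace k T) (?S k)"
      by (subst has_sum_cong[where g = "\<lambda>F. (-1) ^ k * det_on F ?M"]) auto
  qed
  from sums_unique[OF has_sum_imp_sums[OF this]] have "fredholm_det T = infsum ?f {F. finite F}"
    by (simp add: fredholm_det_def)
  thus ?thesis using f by simp
qed

lemma sum_tail_small:
  fixes k :: "int \<Rightarrow> real"
  assumes "k summable_on UNIV" "\<And>y. 0 \<le> k y" "0 < e"
  shows "\<exists>N. \<forall>a n. n \<le> N \<longrightarrow> (\<Sum>y\<in>{a..<n}. k y) \<le> e"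
proof -
  obtain F where F: "finite F" "dist (sum k F) (infsum k UNIV) \<le> e"
    using infsum_finite_approximation[OF assms(1,3)] by auto
  obtain N where N: "\<And>y. y \<in> F \<Longrightarrow> N \<le> y"
    using bdd_below_finite[OF F(1)] unfolding bdd_below_def by auto
  have "(\<Sum>y\<in>{a..<n}. k y) \<le> e" if "n \<le> N" for a n
  proof -
    have "sum k ({a..<n} \<union> F) \<le> infsum k UNIV"
      using F(1) assms by (intro finite_sum_le_infsum) auto
    moreover have "sum k ({a..<n} \<union> F) = sum k {a..<n} + sum k F"
      using F(1) that N by (intro sum.union_disjoint) force+
    ultimately show ?thesis using F(2) unfolding dist_real_def by linarith
  qed
  thus ?thesis by blast
qed

text \<open>The partial sums are bounded by \<open>\<Prod>(1 + k\<^sub>i) \<le> exp (\<Sum> k\<^sub>i)\<close>.\<close>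

lemma finite_products_summable:
  fixes k :: "'i \<Rightarrow> real"
  assumes "k summable_on UNIV" "\<And>i. 0 \<le> k i"
  shows "(\<lambda>F. \<Prod>i\<in>F. k i) summable_on {F. finite F}"
proof (rule nonneg_bdd_above_summable_on)
  show "bdd_above (sum (\<lambda>F. \<Prod>i\<in>F. k i) ` {\<F>. \<F> \<subseteq> {F. finite F} \<and> finite \<F>})"
  proof (rule bdd_aboveI2)
    fix \<F> :: "'i set set" assume \<F>: "\<F> \<in> {\<F>. \<F> \<subseteq> {F. finite F} \<and> finite \<F>}"
    let ?U = "\<Union>\<F>"
    have fin: "finite ?U" using \<F> by auto
    have "(\<Sum>F\<in>\<F>. \<Prod>i\<in>F. k i) \<le> (\<Sum>F\<in>Pow ?U. \<Prod>i\<in>F. k i)"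
      using fin assms by (intro sum_mono2) (auto intro: prod_nonneg)
    also have "\<dots> = (\<Prod>i\<in>?U. k i + 1)"
      using fin by (subst prod_add) auto
    also have "\<dots> \<le> (\<Prod>i\<in>?U. exp (k i))"
      using assms(2) by (intro prod_mono) (auto simp: add.commute exp_ge_add_one_self add_nonneg_nonneg)
    also have "\<dots> = exp (\<Sum>i\<in>?U. k i)" using fin by (rule exp_sum[symmetric])
    also have "\<dots> \<le> exp (\<Sum>\<^sub>\<infinity>i. k i)"
      using finite_sum_le_infsum[OF assms(1) fin] assms(2) by simp
    finally show "(\<Sum>F\<in>\<F>. \<Prod>i\<in>F. k i) \<le> exp (\<Sum>\<^sub>\<infinity>i. k i)" .
  qed
qed (auto intro: prod_nonneg assms)

definition green_minor :: "complex \<Rightarrow> int set \<Rightarrow> complex" where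
  "green_minor l F = det_on F (\<lambda>i j. green l (i - j))"

text \<open>The function \<open>amp\<close> is \<open>\<mu>\<^sub>-\<^sup>-\<^sup>n z\<^sup>-\<^sub>n\<close>, the Jost solution at \<open>-\<infinity>\<close> relative to its free asymptotics. It is the
  iterated Volterra series of this solution: the iteration over points \<open>y\<^sub>1 < \<dots> < y\<^sub>k < n\<close> contributes
  \<open>v(y\<^sub>1) \<dots> v(y\<^sub>k)\<close> times the minor of the Green's function on
  \<open>{y\<^sub>1, \<dots>, y\<^sub>k, n}\<close>. The prefactor normalizes the term of the empty set to \<open>1\<close>.\<close>

definition amp_term :: "(int \<Rightarrow> real) \<Rightarrow> complex \<Rightarrow> int \<Rightarrow> int set \<Rightarrow> complex" where
  "amp_term \<rho> l n F =
     (mu_minus l - mu_plus l) * ((\<Prod>y\<in>F. v_coef \<rho> l y) * green_minor l (insert n F))"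

definition amp :: "(int \<Rightarrow> real) \<Rightarrow> complex \<Rightarrow> int \<Rightarrow> complex" where
  "amp \<rho> l n = (\<Sum>\<^sub>\<infinity>F\<in>{F. finite F \<and> F \<subseteq> {..<n}}. amp_term \<rho> l n F)"

locale spectral_point = summable_defect +
  fixes l :: complex
  assumes l: "l \<in> param_dom"
begin

abbreviation "p \<equiv> mu_plus l"
abbreviation "m \<equiv> mu_minus l"
abbreviation "C \<equiv> inverse (m - p)"
abbreviation "q \<equiv> p / m"
abbreviation "v \<equiv> v_coef \<rho> l"
text \<open>Every index \<open>n \<in> F\<close> contributes a factor of modulus at most \<open>\<kappa> n\<close> to the Fredholm term of \<open>F\<close>.\<close>

abbreviation "\<kappa> n \<equiv> 2 * cmod C * cmod (v n)"

lemma C_nz: "C * (m - p) = 1" "C \<noteq> 0" "cmod C > 0"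
  using mu_nonzero[OF l] by auto

lemma q_lt_1: "cmod q < 1"
proof -
  have "cmod p * 1 < cmod m * 1"
    using characteristic_roots(5,6)[OF l] by simp
  thus ?thesis using mu_nonzero[OF l] by (simp add: norm_divide)
qed

lemma \<kappa>_summable: "\<kappa> summable_on UNIV"
proof -
  have "(\<lambda>n. cmod l / \<delta> * (1 - \<rho> n)) summable_on UNIV"
    by (rule summable_on_cmult_right[OF defect_summable])
  hence "(\<lambda>n. cmod (v n)) summable_on UNIV"
    by (rule summable_on_comparison_test) (auto intro: cmod_v_le simp del: times_divide_eq_left)
  thus ?thesis by (rule summable_on_cmult_right)
qed

lemma green_minor_empty: "green_minor l {} = 1"
  by (simp add: green_minor_def det_on_empty)

lemma green_minor_singleton: "green_minor l {x} = C"
  unfolding green_minor_def by (subst det_on_insert_diagonal_row) (auto simp: det_on_empty green_def)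

text \<open>To the left of its diagonal entry, the last row of a Green's matrix is a multiple of the row
  above it. So a principal minor factorizes over the gaps of its index set.\<close>

lemma green_minor_insert:
  assumes "finite F" "y \<in> F" "\<And>j. j \<in> F \<Longrightarrow> j \<le> y" "y < x"
  shows "green_minor l (insert x F) = C * (1 - q ^ nat (x - y)) * green_minor l F"
proof -
  have nz: "p \<noteq> 0" "m \<noteq> 0" using mu_nonzero[OF l] by auto
  let ?t = "p powi (x - y)"
  have "green_minor l (insert x F) = (green l (x - x) - ?t * green l (y - x)) * green_minor l F"
    unfolding green_minor_def
  proof (rule det_on_insert_proportional_row)
    fix j assume "j \<in> F"
    hence "j \<le> y" using assms by blast
    moreover have "p powi (x - j) = ?t * p powi (y - j)"
      using power_int_add[of p "x - y" "y - j"] nz by simp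
    ultimately show "green l (x - j) = ?t * green l (y - j)"
      using assms(4) by (simp add: green_def)
  qed (use assms in \<open>auto dest: assms(3)\<close>)
  also have "green l (x - x) - ?t * green l (y - x) = C * (1 - ?t * m powi (y - x))"
    using assms(4) by (simp add: green_def algebra_simps)
  also have "?t * m powi (y - x) = q ^ nat (x - y)"
  proof -
    obtain k where k: "x - y = int k" using assms(4) zero_le_imp_eq_int[of "x - y"] by auto
    hence kk: "y - x = - int k" by simp
    show ?thesis unfolding k kk
      by (simp add: power_int_minus divide_inverse power_mult_distrib power_inverse)
  qed
  finally show ?thesis .
qed

lemma cmod_green_minor_le:
  assumes "finite F"
  shows "cmod (green_minor l F) \<le> (2 * cmod C) ^ card F"
  using assms
proof (induction F rule: finite_linorder_max_induct)
  case empty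
  show ?case by (simp add: green_minor_empty)
next
  case (insert x F)
  have x: "x \<notin> F" using insert.hyps by auto
  show ?case
  proof (cases "F = {}")
    case True
    thus ?thesis by (simp add: green_minor_singleton)
  next
    case False
    let ?y = "Max F"
    have y: "?y \<in> F" "?y < x" using False insert.hyps by auto
    have "cmod (q ^ nat (x - ?y)) \<le> 1"
      using q_lt_1 by (simp only: norm_power) (intro power_le_one, auto)
    hence "cmod (1 - q ^ nat (x - ?y)) \<le> 2"
      using norm_triangle_ineq4[of 1 "q ^ nat (x - ?y)"] by simp
    hence "cmod C * cmod (1 - q ^ nat (x - ?y)) * cmod (green_minor l F)
        \<le> cmod C * 2 * (2 * cmod C) ^ card F"
      using insert.IH by (intro mult_mono) auto
    moreover have "green_minor l (insert x F) = C * (1 - q ^ nat (x - ?y)) * green_minor l F"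
      by (rule green_minor_insert) (use insert.hyps y in auto)
    ultimately show ?thesis using insert.hyps x by (simp only: norm_mult) (simp add: mult_ac)
  qed
qed

lemma prod_\<kappa>: "(\<Prod>i\<in>F. \<kappa> i) = (2 * cmod C) ^ card F * (\<Prod>i\<in>F. cmod (v i))"
  by (simp only: prod.distrib prod_constant power_mult_distrib)

lemma prod_\<kappa>_summable: "(\<lambda>F. \<Prod>i\<in>F. \<kappa> i) summable_on {F. finite F}"
  by (rule finite_products_summable[OF \<kappa>_summable]) simp

lemma cmod_minor_term_le:
  assumes "finite F"
  shows "cmod ((\<Prod>y\<in>F. v y) * green_minor l F) \<le> (\<Prod>i\<in>F. \<kappa> i)"
  using mult_right_mono[OF cmod_green_minor_le[OF assms], of "\<Prod>y\<in>F. cmod (v y)"]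
  unfolding prod_\<kappa> norm_mult prod_norm[symmetric] by (simp add: mult.commute prod_nonneg)

lemma cmod_amp_term_le:
  assumes "finite F" "F \<subseteq> {..<n}"
  shows "cmod (amp_term \<rho> l n F) \<le> 2 * (\<Prod>i\<in>F. \<kappa> i)"
proof -
  have n: "n \<notin> F" using assms by auto
  have "cmod (green_minor l (insert n F)) \<le> (2 * cmod C) ^ Suc (card F)"
    using cmod_green_minor_le[of "insert n F"] assms n by simp
  hence "cmod (m - p) * ((\<Prod>y\<in>F. cmod (v y)) * cmod (green_minor l (insert n F)))
     \<le> cmod (m - p) * ((\<Prod>y\<in>F. cmod (v y)) * (2 * cmod C) ^ Suc (card F))"
    by (intro mult_left_mono) (auto intro: prod_nonneg)
  also have "\<dots> = 2 * (cmod C * cmod (m - p)) * ((2 * cmod C) ^ card F * (\<Prod>y\<in>F. cmod (v y)))"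
    by (simp only: power_Suc mult_ac)
  also have "cmod C * cmod (m - p) = 1" using C_nz(1) by (metis norm_mult norm_one)
  finally show ?thesis
    unfolding prod_\<kappa> amp_term_def norm_mult prod_norm[symmetric] by simp
qed

lemma fredholm_det_K_has_sum:
  "((\<lambda>F. (\<Prod>y\<in>F. v y) * green_minor l F) has_sum fredholm_det (K_op \<rho> l)) {F. finite F}"
proof -
  have minor: "det_on F (\<lambda>i j. K_op \<rho> l (unit_vec j) i) =
      (-1) ^ card F * ((\<Prod>y\<in>F. v y) * green_minor l F)" if "finite F" for F
  proof -
    have "det_on F (\<lambda>i j. K_op \<rho> l (unit_vec j) i) =
        det_on F (\<lambda>i j. (- c_coef \<rho> i) * green l (i - j) * b_coef \<rho> l j)"
      by (rule det_on_cong) (simp add: K_op_unit_vec[OF l] K_kernel_def)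
    also have "\<dots> = (\<Prod>i\<in>F. (- c_coef \<rho> i) * b_coef \<rho> l i) * green_minor l F"
      unfolding green_minor_def by (rule det_on_scale[OF that])
    also have "(\<Prod>i\<in>F. (- c_coef \<rho> i) * b_coef \<rho> l i) = (\<Prod>i\<in>F. (- 1) * v i)"
      by (intro prod.cong refl) (simp add: bc_eq_v[symmetric])
    also have "\<dots> = (-1) ^ card F * (\<Prod>i\<in>F. v i)"
      by (simp only: prod.distrib prod_constant)
    finally show ?thesis by (simp add: mult.assoc)
  qed
  have "(\<lambda>F. cmod (det_on F (\<lambda>i j. K_op \<rho> l (unit_vec j) i))) summable_on {F. finite F}"
  proof (rule summable_on_comparison_test[OF prod_\<kappa>_summable])
    fix F assume "F \<in> {F :: int set. finite F}"
    thus "cmod (det_on F (\<lambda>i j. K_op \<rho> l (unit_vec j) i)) \<le> (\<Prod>i\<in>F. \<kappa> i)"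
      using cmod_minor_term_le[of F] by (simp only: minor mem_Collect_eq) (simp add: norm_mult norm_power)
  qed auto
  from fredholm_det_has_sum[OF this] show ?thesis
    by (subst (asm) has_sum_cong[where g = "\<lambda>F. (\<Prod>y\<in>F. v y) * green_minor l F"])
       (auto simp: minor)
qed

section \<open>The Jost solution at minus infinity\<close>

text \<open>The partial sums over \<open>F \<subseteq> [a, n)\<close> of the series for \<open>amp\<close> and of the Fredholm series, and the
  part of the Volterra sum that carries the powers of \<open>q\<close>. As functions of \<open>n\<close> they belong to the
  perturbation \<open>v\<close> cut off to the left of \<open>a\<close>, so that all recursions below are finite.\<close>

definition tamp :: "int \<Rightarrow> int \<Rightarrow> complex" where
  "tamp a n = (\<Sum>F\<in>Pow {a..<n}. amp_term \<rho> l n F)"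

definition tdet :: "int \<Rightarrow> int \<Rightarrow> complex" where
  "tdet a n = (\<Sum>F\<in>Pow {a..<n}. (\<Prod>y\<in>F. v y) * green_minor l F)"

definition tres :: "int \<Rightarrow> int \<Rightarrow> complex" where
  "tres a n = (\<Sum>y\<in>{a..<n}. C * v y * q ^ nat (n - y) * tamp a y)"

lemma amp_term_insert:
  assumes "F \<in> Pow {a..<y}" "y < n"
  shows "amp_term \<rho> l n (insert y F) = C * v y * (1 - q ^ nat (n - y)) * amp_term \<rho> l y F"
proof -
  have F: "finite F" "y \<notin> F" using assms finite_subset by auto
  have "green_minor l (insert n (insert y F)) =
      C * (1 - q ^ nat (n - y)) * green_minor l (insert y F)"
    by (rule green_minor_insert) (use assms F in auto)
  thus ?thesis using F by (simp add: amp_term_def mult_ac)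
qed

lemma minor_term_insert:
  assumes "F \<in> Pow {a..<y}"
  shows "(\<Prod>y\<in>insert y F. v y) * green_minor l (insert y F) = C * v y * amp_term \<rho> l y F"
proof -
  have F: "finite F" "y \<notin> F" using assms finite_subset by auto
  have "C * v y * amp_term \<rho> l y F =
      (C * (m - p)) * (v y * ((\<Prod>y\<in>F. v y) * green_minor l (insert y F)))"
    by (simp only: amp_term_def mult_ac)
  thus ?thesis unfolding C_nz(1) by (simp only: prod.insert[OF F] mult_1_left mult.assoc)
qed

lemma tdet_volterra:
  assumes "a \<le> n"
  shows "tdet a n = 1 + (\<Sum>y\<in>{a..<n}. C * v y * tamp a y)"
  unfolding tdet_def sum_Pow_by_Max[OF assms]
  by (simp add: green_minor_empty tamp_def minor_term_insert sum_distrib_left)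

text \<open>The two parts are the coefficients in the variation of constants: \<open>\<mu>\<^sub>-\<^sup>n tamp\<close> is \<open>tdet \<cdot> \<mu>\<^sub>-\<^sup>n\<close> minus an
  \<open>n\<close>-dependent multiple of \<open>\<mu>\<^sub>+\<^sup>n\<close>, since \<open>q = \<mu>\<^sub>+ / \<mu>\<^sub>-\<close>.\<close>

lemma tamp_volterra:
  assumes "a \<le> n"
  shows "tamp a n = tdet a n - tres a n"
proof -
  have "tamp a n = amp_term \<rho> l n {} +
      (\<Sum>y\<in>{a..<n}. \<Sum>F\<in>Pow {a..<y}. C * v y * (1 - q ^ nat (n - y)) * amp_term \<rho> l y F)"
    unfolding tamp_def sum_Pow_by_Max[OF assms]
    by (intro arg_cong2[where f = "(+)"] refl sum.cong) (auto intro!: amp_term_insert)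
  also have "amp_term \<rho> l n {} = 1"
    using C_nz by (simp add: amp_term_def green_minor_singleton)
  also have "(\<Sum>y\<in>{a..<n}. \<Sum>F\<in>Pow {a..<y}. C * v y * (1 - q ^ nat (n - y)) * amp_term \<rho> l y F) =
     (\<Sum>y\<in>{a..<n}. C * v y * tamp a y - C * v y * q ^ nat (n - y) * tamp a y)"
    by (intro sum.cong refl)
       (simp only: sum_distrib_left[symmetric] tamp_def[symmetric],
        simp only: left_diff_distrib right_diff_distrib mult_1_right)
  finally show ?thesis by (simp add: tdet_volterra[OF assms] tres_def sum_subtractf)
qed

lemma tdet_step:
  assumes "a \<le> n"
  shows "tdet a (n + 1) = tdet a n + C * v n * tamp a n"
proof -
  have "{a..<n+1} = insert n {a..<n}" using assms by auto
  thus ?thesis using assms by (simp add: tdet_volterra)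
qed

lemma tres_step:
  assumes "a \<le> n"
  shows "tres a (n + 1) = q * (tres a n + C * v n * tamp a n)"
proof -
  have "{a..<n+1} = insert n {a..<n}" using assms by auto
  hence "tres a (n + 1) = C * v n * q * tamp a n +
      (\<Sum>y\<in>{a..<n}. C * v y * q ^ nat (n + 1 - y) * tamp a y)"
    by (simp add: tres_def)
  also have "(\<Sum>y\<in>{a..<n}. C * v y * q ^ nat (n + 1 - y) * tamp a y) = q * tres a n"
    unfolding tres_def sum_distrib_left
  proof (rule sum.cong)
    fix y assume "y \<in> {a..<n}"
    hence "nat (n + 1 - y) = Suc (nat (n - y))"
      using Suc_nat_eq_nat_zadd1[of "n - y"] by (simp add: algebra_simps)
    thus "C * v y * q ^ nat (n + 1 - y) * tamp a y = q * (C * v y * q ^ nat (n - y) * tamp a y)"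
      by (simp only: power_Suc mult_ac)
  qed simp
  finally show ?thesis by (simp only: distrib_left mult_ac add_ac)
qed

text \<open>The difference equation for \<open>\<mu>\<^sub>-\<^sup>n tamp\<close>, divided by \<open>\<mu>\<^sub>-\<^sup>n\<^sup>-\<^sup>1\<close>. Expressing the three values through the
  coefficients \<open>d\<close> and \<open>r\<close> at \<open>n\<close>, the free parts cancel because \<open>\<mu>\<^sub>-\<^sup>2 = 1 - \<lambda> \<mu>\<^sub>-\<close> and
  \<open>\<mu>\<^sub>+ \<mu>\<^sub>- = -1\<close>; only the increment \<open>g\<close> caused by \<open>v\<^sub>n\<close> survives.\<close>

lemma tamp_difference_equation:
  assumes "a < n"
  shows "tamp a (n - 1) - m\<^sup>2 * tamp a (n + 1) = (l - v n) * m * tamp a n"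
proof -
  have nz: "p \<noteq> 0" "m \<noteq> 0" using mu_nonzero[OF l] by auto
  have pm: "p * m = -1" by (rule characteristic_roots(3)[OF l])
  define f where "f = C * v (n - 1) * tamp a (n - 1)"
  define g where "g = C * v n * tamp a n"
  define d r where "d = tdet a n" and "r = tres a n"
  have "d = tdet a (n - 1) + f" "r = q * (tres a (n - 1) + f)"
    using tdet_step[of a "n - 1"] tres_step[of a "n - 1"] assms by (simp_all add: d_def r_def f_def)
  moreover have "tamp a (n - 1) = tdet a (n - 1) - tres a (n - 1)"
    using tamp_volterra[of a "n - 1"] assms by simp
  ultimately have w0: "tamp a (n - 1) = d - r / q"
    using nz by simp
  have w1: "tamp a n = d - r"
    using tamp_volterra[of a n] assms by (simp add: d_def r_def)
  have w2: "tamp a (n + 1) = (d + g) - q * (r + g)"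
    using tamp_volterra[of a "n + 1"] tdet_step[of a n] tres_step[of a n] assms
    by (simp add: d_def r_def g_def)
  have q1: "m\<^sup>2 * q = -1"
    using pm nz by (simp add: power2_eq_square mult.commute)
  have q2: "r / q = - (m\<^sup>2 * r)"
  proof -
    have "m\<^sup>2 * (r / q) * q = m\<^sup>2 * r" using nz by simp
    hence "(r / q) * (m\<^sup>2 * q) = m\<^sup>2 * r" by (simp only: mult_ac)
    thus ?thesis unfolding q1 by (metis mult_minus1_right add.inverse_inverse)
  qed
  have m2: "m\<^sup>2 = 1 - l * m" using mu_root(2)[OF l] by (simp add: algebra_simps)
  have mC: "m\<^sup>2 * (1 - q) * C = m"
  proof -
    have "m\<^sup>2 * (1 - q) = m * (m - p)" using nz by (simp add: power2_eq_square field_simps)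
    thus ?thesis using C_nz(1) by (simp add: mult.commute mult.left_commute)
  qed
  have "(m\<^sup>2 * (1 - q)) * g = (m\<^sup>2 * (1 - q) * C) * (v n * tamp a n)"
    by (simp only: g_def mult_ac)
  hence g': "(m\<^sup>2 * (1 - q)) * g = v n * m * tamp a n"
    unfolding mC by (simp only: mult_ac)
  have "tamp a (n - 1) - m\<^sup>2 * tamp a (n + 1) = d + m\<^sup>2 * r - m\<^sup>2 * d + (m\<^sup>2 * q) * r - (m\<^sup>2 * (1 - q)) * g"
    unfolding w0 w2 q2 by (simp add: algebra_simps add_divide_distrib)
  also have "\<dots> = (1 - m\<^sup>2) * (d - r) - v n * m * tamp a n"
    unfolding q1 g' by (simp add: algebra_simps)
  also have "\<dots> = (l - v n) * m * tamp a n"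
    unfolding w1[symmetric] m2 by (simp add: algebra_simps)
  finally show ?thesis .
qed

lemma amp_has_sum: "(amp_term \<rho> l n has_sum amp \<rho> l n) {F. finite F \<and> F \<subseteq> {..<n}}"
proof -
  have "(\<lambda>F. 2 * (\<Prod>i\<in>F. \<kappa> i)) summable_on {F. finite F \<and> F \<subseteq> {..<n}}"
    by (rule summable_on_subset_banach[OF summable_on_cmult_right[OF prod_\<kappa>_summable]]) auto
  hence "(\<lambda>F. norm (amp_term \<rho> l n F)) summable_on {F. finite F \<and> F \<subseteq> {..<n}}"
    by (rule summable_on_comparison_test) (auto intro: cmod_amp_term_le)
  thus ?thesis unfolding amp_def by (intro has_sum_infsum) (rule abs_summable_summable)
qed

lemma tamp_tendsto: "((\<lambda>a. tamp a n) \<longlongrightarrow> amp \<rho> l n) at_bot"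
proof -
  let ?S = "{F. finite F \<and> F \<subseteq> {..<n}}"
  have "filterlim (\<lambda>a. Pow {a..<n}) (finite_subsets_at_top ?S) at_bot"
    unfolding filterlim_finite_subsets_at_top
  proof (intro allI impI)
    fix X assume X: "finite X \<and> X \<subseteq> ?S"
    hence "finite (\<Union>X)" by auto
    then obtain b where b: "\<And>y. y \<in> \<Union>X \<Longrightarrow> b \<le> y"
      using bdd_below_finite[of "\<Union>X"] unfolding bdd_below_def by auto
    have "X \<subseteq> Pow {a..<n}" if "a \<le> b" for a
    proof
      fix F assume F: "F \<in> X"
      thus "F \<in> Pow {a..<n}" using X b that by force
    qed
    thus "\<forall>\<^sub>F a in at_bot. finite (Pow {a..<n}) \<and> X \<subseteq> Pow {a..<n} \<and> Pow {a..<n} \<subseteq> ?S"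
      by (intro eventually_at_bot_linorderI[of b]) (auto intro: finite_subset)
  qed
  thus ?thesis
    unfolding tamp_def using amp_has_sum[of n] unfolding has_sum_def
    by (auto intro: filterlim_compose)
qed

lemma amp_difference_equation:
  "amp \<rho> l (n - 1) - m\<^sup>2 * amp \<rho> l (n + 1) = (l - v n) * m * amp \<rho> l n"
proof -
  have "((\<lambda>a. tamp a (n - 1) - m\<^sup>2 * tamp a (n + 1)) \<longlongrightarrow>
      amp \<rho> l (n - 1) - m\<^sup>2 * amp \<rho> l (n + 1)) at_bot"
    by (intro tendsto_intros tamp_tendsto)
  moreover have "((\<lambda>a. tamp a (n - 1) - m\<^sup>2 * tamp a (n + 1)) \<longlongrightarrow> (l - v n) * m * amp \<rho> l n) at_bot"
  proof (rule Lim_transform_eventually)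
    show "((\<lambda>a. (l - v n) * m * tamp a n) \<longlongrightarrow> (l - v n) * m * amp \<rho> l n) at_bot"
      by (intro tendsto_intros tamp_tendsto)
    show "\<forall>\<^sub>F a in at_bot. (l - v n) * m * tamp a n = tamp a (n - 1) - m\<^sup>2 * tamp a (n + 1)"
      by (rule eventually_at_bot_linorderI[of "n - 1"]) (simp add: tamp_difference_equation)
  qed
  ultimately show ?thesis by (rule tendsto_unique[rotated]) simp
qed

lemma amp_solves: "solves \<rho> l (\<lambda>n. m powi n * amp \<rho> l n)"
  unfolding solves_def
proof
  fix n
  have nz: "m \<noteq> 0" using mu_nonzero[OF l] by auto
  have pw: "m powi (n + 1) = m powi (n - 1) * m\<^sup>2" "m powi n = m powi (n - 1) * m"
    using power_int_add[of m "n - 1" 2] power_int_add_1[of m "n - 1"] nz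
    by (simp_all add: add.commute)
  have "m powi (n - 1) * amp \<rho> l (n - 1) - m powi (n + 1) * amp \<rho> l (n + 1) =
      m powi (n - 1) * (amp \<rho> l (n - 1) - m\<^sup>2 * amp \<rho> l (n + 1))"
    unfolding pw by (simp add: algebra_simps)
  also have "\<dots> = (l - v n) * (m powi n * amp \<rho> l n)"
    unfolding amp_difference_equation pw by (simp add: mult_ac)
  finally show "m powi (n - 1) * amp \<rho> l (n - 1) - m powi (n + 1) * amp \<rho> l (n + 1) =
      l / of_real (\<rho> n) * (m powi n * amp \<rho> l n)"
    by (simp add: v_coef_def)
qed

definition amp_bound :: real where
  "amp_bound = 2 * (\<Sum>\<^sub>\<infinity>F\<in>{F. finite F}. \<Prod>i\<in>F. \<kappa> i)"

lemma amp_bound_nonneg: "0 \<le> amp_bound"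
  unfolding amp_bound_def by (intro mult_nonneg_nonneg infsum_nonneg prod_nonneg) auto

lemma cmod_tamp_le: "cmod (tamp a n) \<le> amp_bound"
proof -
  have "cmod (tamp a n) \<le> (\<Sum>F\<in>Pow {a..<n}. cmod (amp_term \<rho> l n F))"
    unfolding tamp_def by (rule norm_sum)
  also have "\<dots> \<le> (\<Sum>F\<in>Pow {a..<n}. 2 * (\<Prod>i\<in>F. \<kappa> i))"
    by (intro sum_mono cmod_amp_term_le) (auto intro: finite_subset)
  also have "\<dots> \<le> amp_bound"
    unfolding amp_bound_def sum_distrib_left[symmetric]
    by (intro mult_left_mono finite_sum_le_infsum[OF prod_\<kappa>_summable] prod_nonneg)
       (auto intro: finite_subset)
  finally show ?thesis .
qed

lemma cmod_Cv_tamp_le: "cmod (C * v y * x * tamp a y) \<le> amp_bound * (\<kappa> y * cmod x)"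
proof -
  have "cmod (C * v y * x * tamp a y) = (cmod C * cmod (v y) * cmod x) * cmod (tamp a y)"
    by (simp only: norm_mult)
  also have "\<dots> \<le> (2 * cmod C * cmod (v y) * cmod x) * amp_bound"
    by (intro mult_mono cmod_tamp_le) (auto intro: mult_right_mono)
  finally show ?thesis by (simp only: mult_ac)
qed

lemma cmod_tamp_minus_1_le: "cmod (tamp a n - 1) \<le> 2 * amp_bound * (\<Sum>y\<in>{a..<n}. \<kappa> y)"
proof (cases "a \<le> n")
  case True
  have "tamp a n - 1 = (\<Sum>y\<in>{a..<n}. C * v y * (1 - q ^ nat (n - y)) * tamp a y)"
    unfolding tamp_volterra[OF True] tdet_volterra[OF True] tres_def
    by (simp add: sum_subtractf[symmetric] algebra_simps)
  also have "cmod \<dots> \<le> (\<Sum>y\<in>{a..<n}. 2 * amp_bound * \<kappa> y)"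
  proof (rule sum_norm_le)
    fix y
    have "cmod (q ^ nat (n - y)) \<le> 1"
      using q_lt_1 by (simp only: norm_power) (intro power_le_one, auto)
    hence "cmod (1 - q ^ nat (n - y)) \<le> 2"
      using norm_triangle_ineq4[of 1 "q ^ nat (n - y)"] by simp
    hence "amp_bound * (\<kappa> y * cmod (1 - q ^ nat (n - y))) \<le> amp_bound * (\<kappa> y * 2)"
      using amp_bound_nonneg by (intro mult_left_mono) auto
    thus "cmod (C * v y * (1 - q ^ nat (n - y)) * tamp a y) \<le> 2 * amp_bound * \<kappa> y"
      using cmod_Cv_tamp_le[of y "1 - q ^ nat (n - y)" a] by (simp add: mult_ac)
  qed
  finally show ?thesis by (simp only: sum_distrib_left)
next
  case False
  hence "tamp a n = amp_term \<rho> l n {}" by (simp add: tamp_def)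
  also have "\<dots> = 1" using C_nz by (simp add: amp_term_def green_minor_singleton)
  finally show ?thesis using False by simp
qed

lemma amp_tendsto_at_bot: "(amp \<rho> l \<longlongrightarrow> 1) at_bot"
proof (rule tendstoI)
  fix e :: real assume e: "0 < e"
  (* the summand 1 keeps the denominator positive *)
  define e' where "e' = e / (2 * (2 * amp_bound + 1))"
  have e': "0 < e'" using e amp_bound_nonneg by (simp add: e'_def)
  obtain N where N: "\<And>a n. n \<le> N \<Longrightarrow> (\<Sum>y\<in>{a..<n}. \<kappa> y) \<le> e'"
    using sum_tail_small[OF \<kappa>_summable _ e'] by auto
  have "dist (amp \<rho> l n) 1 < e" if "n \<le> N" for n
  proof -
    have "cmod (amp \<rho> l n - 1) \<le> 2 * amp_bound * e'"
    proof (rule tendsto_upperbound)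
      show "((\<lambda>a. cmod (tamp a n - 1)) \<longlongrightarrow> cmod (amp \<rho> l n - 1)) at_bot"
        by (intro tendsto_intros tamp_tendsto)
      show "\<forall>\<^sub>F a in at_bot. cmod (tamp a n - 1) \<le> 2 * amp_bound * e'"
      proof (rule always_eventually, rule allI)
        fix a
        show "cmod (tamp a n - 1) \<le> 2 * amp_bound * e'"
          by (rule order_trans[OF cmod_tamp_minus_1_le])
             (use N[OF that] amp_bound_nonneg in \<open>auto intro!: mult_left_mono\<close>)
      qed
    qed simp
    also have "\<dots> \<le> (2 * amp_bound + 1) * e'" using e' by (intro mult_right_mono) auto
    also have "\<dots> = e / 2" using amp_bound_nonneg by (simp add: e'_def field_simps)
    also have "\<dots> < e" using e by simp
    finally show ?thesis by (simp add: dist_norm)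
  qed
  thus "\<forall>\<^sub>F n in at_bot. dist (amp \<rho> l n) 1 < e"
    by (rule eventually_at_bot_linorderI)
qed

definition res_bound :: "int \<Rightarrow> real" where
  "res_bound n = (\<Sum>\<^sub>\<infinity>y. cmod q ^ nat \<bar>n - y\<bar> * \<kappa> y)"

lemma res_bound_pairs: "(\<lambda>(y, n). cmod q ^ nat \<bar>n - y\<bar> * \<kappa> y) summable_on UNIV"
proof (rule summable_on_convolution_pairs[where a = "\<lambda>d. cmod q ^ nat \<bar>d\<bar>"])
  have "(\<lambda>n. cmod q ^ n) summable_on UNIV"
    using q_lt_1 by (subst summable_on_UNIV_nonneg_real_iff) (auto simp del: norm_divide intro!: summable_geometric)
  thus "(\<lambda>d. cmod q ^ nat \<bar>d\<bar>) summable_on UNIV"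
    by (intro summable_on_int_halves) simp_all
qed (use \<kappa>_summable in auto)

text \<open>The bound is a convolution of two summable functions, hence summable in \<open>n\<close> and so infinitesimal.\<close>

lemma res_bound_tendsto: "(res_bound \<longlongrightarrow> 0) at_top"
proof -
  have "(\<lambda>(n, y). cmod q ^ nat \<bar>n - y\<bar> * \<kappa> y) summable_on UNIV \<times> UNIV"
    using summable_on_swap[of "\<lambda>(n, y). cmod q ^ nat \<bar>n - y\<bar> * \<kappa> y" UNIV UNIV] res_bound_pairs
    by (simp add: case_prod_unfold)
  hence summ: "res_bound summable_on UNIV"
    unfolding res_bound_def[abs_def] by (rule summable_on_Sigma_banach)
  have nonneg: "0 \<le> res_bound n" for n
    unfolding res_bound_def by (intro infsum_nonneg) auto
  have "(\<lambda>n. complex_of_real (sqrt (res_bound n))) \<in> ell2"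
    using summ nonneg by (simp add: ell2_def)
  hence "((\<lambda>n. (cmod (complex_of_real (sqrt (res_bound n))))\<^sup>2) \<longlongrightarrow> (cmod 0)\<^sup>2) at_top"
    by (intro tendsto_intros ell2_tendsto_0)
  thus ?thesis using nonneg by simp
qed

lemma cmod_tamp_minus_tdet_le:
  assumes "a \<le> n"
  shows "cmod (tamp a n - tdet a n) \<le> amp_bound * res_bound n"
proof -
  let ?f = "\<lambda>y. cmod q ^ nat \<bar>n - y\<bar> * \<kappa> y"
  have "cmod (tamp a n - tdet a n) = cmod (tres a n)"
    unfolding tamp_volterra[OF assms] by simp
  also have "\<dots> \<le> (\<Sum>y\<in>{a..<n}. amp_bound * ?f y)"
    unfolding tres_def
  proof (rule sum_norm_le)
    fix y assume "y \<in> {a..<n}"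
    thus "cmod (C * v y * q ^ nat (n - y) * tamp a y) \<le> amp_bound * ?f y"
      using cmod_Cv_tamp_le[of y "q ^ nat (n - y)" a]
      by (simp only: norm_power) (simp add: mult_ac)
  qed
  also have "\<dots> = amp_bound * (\<Sum>y\<in>{a..<n}. ?f y)" by (simp only: sum_distrib_left)
  also have "\<dots> \<le> amp_bound * res_bound n"
    unfolding res_bound_def
  proof (intro mult_left_mono amp_bound_nonneg finite_sum_le_infsum)
    have "(\<lambda>(n, y). cmod q ^ nat \<bar>n - y\<bar> * \<kappa> y) summable_on UNIV \<times> UNIV"
      using summable_on_swap[of "\<lambda>(n, y). cmod q ^ nat \<bar>n - y\<bar> * \<kappa> y" UNIV UNIV] res_bound_pairs
      by (simp add: case_prod_unfold)
    from summable_on_SigmaD1[OF this, of n] show "?f summable_on UNIV" by simp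
  qed auto
  finally show ?thesis .
qed

text \<open>The truncated determinants are the partial sums of the Fredholm series over \<open>F \<subseteq> [a, n)\<close>,
  and they differ from the truncated Jost solutions by the tail of the Volterra equation, which
  vanishes at \<open>+\<infinity>\<close> uniformly in the truncation.\<close>

lemma amp_tendsto_at_top: "(amp \<rho> l \<longlongrightarrow> fredholm_det (K_op \<rho> l)) at_top"
proof (rule tendstoI)
  fix e :: real assume e: "0 < e"
  let ?D = "fredholm_det (K_op \<rho> l)"
  let ?f = "\<lambda>F. (\<Prod>y\<in>F. v y) * green_minor l F"
  have "((\<lambda>n. amp_bound * res_bound n) \<longlongrightarrow> amp_bound * 0) at_top"
    by (intro tendsto_intros res_bound_tendsto)
  hence small: "\<forall>\<^sub>F n in at_top. amp_bound * res_bound n < e / 3"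
    using e by (intro order_tendstoD) auto
  have "\<forall>\<^sub>F X in finite_subsets_at_top {F. finite F}. dist (sum ?f X) ?D < e / 3"
    using fredholm_det_K_has_sum e unfolding has_sum_def by (intro tendstoD) auto
  then obtain X where X: "finite X" "X \<subseteq> {F. finite F}"
    "\<forall>Y. finite Y \<and> X \<subseteq> Y \<and> Y \<subseteq> {F. finite F} \<longrightarrow> dist (sum ?f Y) ?D < e / 3"
    unfolding eventually_finite_subsets_at_top by (elim exE conjE)
  have fin: "finite (\<Union>X)" using X by auto
  obtain b where b: "\<And>y. y \<in> \<Union>X \<Longrightarrow> b \<le> y"
    using bdd_below_finite[OF fin] unfolding bdd_below_def by auto
  obtain c where c: "\<And>y. y \<in> \<Union>X \<Longrightarrow> y \<le> c"
    using bdd_above_finite[OF fin] unfolding bdd_above_def by auto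
  have close: "dist (tdet a n) ?D < e / 3" if "a \<le> b" "c < n" for a n
    unfolding tdet_def
  proof (intro X(3)[rule_format] conjI)
    show "X \<subseteq> Pow {a..<n}"
    proof (intro subsetI PowI)
      fix F y assume "F \<in> X" "y \<in> F"
      hence "b \<le> y" "y \<le> c" using b c by auto
      thus "y \<in> {a..<n}" using that by auto
    qed
  qed (auto intro: finite_subset)
  from small have "\<forall>\<^sub>F n in at_top. amp_bound * res_bound n < e / 3 \<and> c < n"
    by (intro eventually_conj eventually_gt_at_top)
  thus "\<forall>\<^sub>F n in at_top. dist (amp \<rho> l n) ?D < e"
  proof (rule eventually_mono)
    fix n assume n: "amp_bound * res_bound n < e / 3 \<and> c < n"
    have "dist (amp \<rho> l n) ?D \<le> 2 * e / 3"
    proof (rule tendsto_upperbound)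
      show "((\<lambda>a. dist (tamp a n) ?D) \<longlongrightarrow> dist (amp \<rho> l n) ?D) at_bot"
        by (intro tendsto_intros tamp_tendsto)
      show "\<forall>\<^sub>F a in at_bot. dist (tamp a n) ?D \<le> 2 * e / 3"
      proof (rule eventually_at_bot_linorderI[of "min b n"])
        fix a assume a: "a \<le> min b n"
        have "dist (tamp a n) ?D \<le> dist (tamp a n) (tdet a n) + dist (tdet a n) ?D"
          by (rule dist_triangle)
        moreover have "dist (tamp a n) (tdet a n) \<le> amp_bound * res_bound n"
          using cmod_tamp_minus_tdet_le[of a n] a by (simp add: dist_norm)
        moreover have "dist (tdet a n) ?D < e / 3" using close[of a n] a n by simp
        ultimately show "dist (tamp a n) ?D \<le> 2 * e / 3" using n by linarith
      qed
    qed simp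
    thus "dist (amp \<rho> l n) ?D < e" using e by linarith
  qed
qed

end

section \<open>Holomorphic dependence on the parameter\<close>

lemma green_holomorphic: "(\<lambda>l. green l n) holomorphic_on param_dom"
  unfolding green_def
  using mu_nonzero by (cases "0 \<le> n") (auto intro!: holomorphic_intros mu_holomorphic)

lemma amp_term_holomorphic: "(\<lambda>l. amp_term \<rho> l n F) holomorphic_on param_dom"
proof -
  have "(\<lambda>l. l - l / complex_of_real (\<rho> y)) holomorphic_on param_dom" for y
    by (cases "\<rho> y = 0") (auto intro!: holomorphic_intros)
  thus ?thesis
    unfolding amp_term_def v_coef_def green_minor_def det_on_def
    by (intro holomorphic_intros mu_holomorphic green_holomorphic) auto
qed

text \<open>On a small disc the constants \<open>\<kappa>\<close> have a common summable majorant, which makes the series for \<open>amp\<close>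
  converge uniformly there.\<close>

lemma (in summable_defect) amp_holomorphic: "(\<lambda>l. amp \<rho> l n) holomorphic_on param_dom"
proof -
  let ?S = "{F. finite F \<and> F \<subseteq> {..<n}}"
  have "(\<lambda>l. amp \<rho> l n) field_differentiable at z" if z: "z \<in> param_dom" for z
  proof -
    obtain r where r: "0 < r" "cball z r \<subseteq> param_dom"
      using open_contains_cball open_param_dom z by blast
    (* kappa n is at most this factor, continuous in the parameter, times 1 - rho n *)
    let ?c = "\<lambda>l. 2 * cmod (inverse (mu_minus l - mu_plus l)) * (cmod l / \<delta>)"
    have "continuous_on param_dom ?c"
      using mu_holomorphic mu_nonzero \<delta>_pos
      by (intro continuous_intros holomorphic_on_imp_continuous_on) auto
    hence "compact (?c ` cball z r)"
      using r by (intro compact_continuous_image) (auto intro: continuous_on_subset)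
    then obtain B where B: "\<And>l. l \<in> cball z r \<Longrightarrow> ?c l \<le> B"
      using compact_imp_bounded bounded_imp_bdd_above[of "?c ` cball z r"]
      unfolding bdd_above_def by blast
    have "0 \<le> ?c z" using \<delta>_pos by simp
    hence B0: "0 \<le> B" using B[of z] r by simp
    let ?k = "\<lambda>y. B * (1 - \<rho> y)"
    have k0: "0 \<le> ?k y" for y using B0 le1[of y] by simp
    have "(\<lambda>F. \<Prod>y\<in>F. ?k y) summable_on {F. finite F}"
      by (rule finite_products_summable[OF summable_on_cmult_right[OF defect_summable]]) (rule k0)
    hence "(\<lambda>F. 2 * (\<Prod>y\<in>F. ?k y)) summable_on ?S"
      by (intro summable_on_cmult_right) (rule summable_on_subset_banach, auto)
    moreover have "norm (amp_term \<rho> l n F) \<le> 2 * (\<Prod>y\<in>F. ?k y)"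
      if F: "F \<in> ?S" and lz: "l \<in> cball z r" for F l
    proof -
      interpret spectral_point \<rho> \<delta> l
        by unfold_locales (use r lz in auto)
      have "(\<Prod>y\<in>F. \<kappa> y) \<le> (\<Prod>y\<in>F. ?k y)"
      proof (intro prod_mono conjI)
        fix y
        have "\<kappa> y \<le> 2 * cmod (inverse (mu_minus l - mu_plus l)) * (cmod l / \<delta> * (1 - \<rho> y))"
          by (intro mult_left_mono cmod_v_le) auto
        also have "\<dots> = ?c l * (1 - \<rho> y)" by simp
        also have "\<dots> \<le> ?k y" by (intro mult_right_mono B[OF lz]) (use le1[of y] in auto)
        finally show "\<kappa> y \<le> ?k y" .
      qed auto
      thus ?thesis using cmod_amp_term_le[of F n] F by auto
    qed
    ultimately have ulim: "uniform_limit (cball z r) (\<lambda>X l. \<Sum>F\<in>X. amp_term \<rho> l n F)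
        (\<lambda>l. \<Sum>\<^sub>\<infinity>F\<in>?S. amp_term \<rho> l n F) (finite_subsets_at_top ?S)"
      by (intro Weierstrass_m_test_general[where M = "\<lambda>F. 2 * (\<Prod>y\<in>F. ?k y)"]) auto
    have hol: "(\<lambda>l. \<Sum>F\<in>X. amp_term \<rho> l n F) holomorphic_on cball z r" for X
      by (intro holomorphic_intros holomorphic_on_subset[OF amp_term_holomorphic r(2)])
    have "(\<lambda>l. \<Sum>\<^sub>\<infinity>F\<in>?S. amp_term \<rho> l n F) holomorphic_on ball z r"
    proof (rule holomorphic_uniform_limit[OF _ ulim])
      show "\<forall>\<^sub>F X in finite_subsets_at_top ?S.
          continuous_on (cball z r) (\<lambda>l. \<Sum>F\<in>X. amp_term \<rho> l n F) \<and>
          (\<lambda>l. \<Sum>F\<in>X. amp_term \<rho> l n F) holomorphic_on ball z r"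
        using hol by (auto intro!: always_eventually holomorphic_on_imp_continuous_on
            intro: holomorphic_on_subset[OF hol])
    qed auto
    thus ?thesis
      using r(1) unfolding amp_def
      by (auto intro!: holomorphic_on_imp_differentiable_at[of _ "ball z r"])
  qed
  thus ?thesis
    by (auto simp: holomorphic_on_def intro: field_differentiable_at_within)
qed

section \<open>Wronskians\<close>

lemma solvesD: "solves \<rho> l z \<Longrightarrow> z (n + 1) = z (n - 1) - l / of_real (\<rho> n) * z n"
  unfolding solves_def by (metis diff_diff_eq2 diff_add_cancel add_diff_cancel_left')

lemma solves_linear:
  assumes "solves \<rho> l u" "solves \<rho> l w"
  shows "solves \<rho> l (\<lambda>n. u n - c * w n)"
  unfolding solves_def
proof
  fix n
  have "u (n - 1) - u (n + 1) = l / of_real (\<rho> n) * u n"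
    "w (n - 1) - w (n + 1) = l / of_real (\<rho> n) * w n"
    using assms by (simp_all add: solves_def)
  hence "(u (n - 1) - u (n + 1)) - c * (w (n - 1) - w (n + 1)) =
      l / of_real (\<rho> n) * u n - c * (l / of_real (\<rho> n) * w n)" by simp
  thus "u (n - 1) - c * w (n - 1) - (u (n + 1) - c * w (n + 1)) =
      l / of_real (\<rho> n) * (u n - c * w n)"
    by (simp add: algebra_simps)
qed

lemma solves_zero:
  assumes z: "solves \<rho> l z" and "z 0 = 0" "z (-1) = 0"
  shows "z n = 0"
proof -
  have "z n = 0 \<and> z (n - 1) = 0"
  proof (induction n rule: int_induct[where k = 0])
    case base
    show ?case using assms by simp
  next
    case (step1 i)
    thus ?case using solvesD[OF z, of i] by simp
  next
    case (step2 i)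
    have "z (i - 1 - 1) = z i + l / of_real (\<rho> (i - 1)) * z (i - 1)"
      using solvesD[OF z, of "i - 1"] by simp
    thus ?case using step2 by simp
  qed
  thus ?thesis by simp
qed

lemma wronskian_step:
  assumes "solves \<rho> l u" "solves \<rho> l w"
  shows "wronskian u w (n + 1) = wronskian u w n"
proof -
  have s: "(-1 :: complex) powi (n - 1) = - ((-1) powi n)"
    using power_int_add_1[of "-1 :: complex" "n - 1"] by simp
  have "u n * w (n + 1) - u (n + 1) * w n = - (u (n - 1) * w n - u n * w (n - 1))"
    unfolding solvesD[OF assms(1), of n] solvesD[OF assms(2), of n] by (simp add: algebra_simps)
  thus ?thesis by (simp add: wronskian_def s right_diff_distrib)
qed

lemma wronskian_const:
  assumes "solves \<rho> l u" "solves \<rho> l w"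
  shows "wronskian u w n = wronskian u w 0"
proof (induction n rule: int_induct[where k = 0])
  case (step1 i)
  thus ?case using wronskian_step[OF assms, of i] by simp
next
  case (step2 i)
  thus ?case using wronskian_step[OF assms, of "i - 1"] by simp
qed simp

lemma wronskian_0: "wronskian u w 0 = u 0 * w (-1) - u (-1) * w 0"
  by (simp add: wronskian_def power_int_minus)

text \<open>A solution is determined by its values at \<open>0\<close> and \<open>-1\<close>, and the Wronskian is the determinant of
  these initial values.\<close>

lemma wronskian_zero_imp_multiple:
  assumes u: "solves \<rho> l u" and w: "solves \<rho> l w" and "wronskian u w 0 = 0" "u \<noteq> (\<lambda>_. 0)"
  obtains c where "\<And>n. w n = c * u n"
proof -
  have eq: "u 0 * w (-1) = u (-1) * w 0" using assms(3) by (simp add: wronskian_0)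
  have "u 0 \<noteq> 0 \<or> u (-1) \<noteq> 0"
    using solves_zero[OF u] assms(4) by (metis ext)
  hence "\<exists>c. w 0 = c * u 0 \<and> w (-1) = c * u (-1)"
  proof
    assume "u 0 \<noteq> 0"
    thus ?thesis using eq by (intro exI[of _ "w 0 / u 0"]) (simp add: field_simps)
  next
    assume "u (-1) \<noteq> 0"
    thus ?thesis using eq by (intro exI[of _ "w (-1) / u (-1)"]) (simp add: field_simps)
  qed
  then obtain c where c: "w 0 = c * u 0" "w (-1) = c * u (-1)" by blast
  have "w n - c * u n = 0" for n
    using solves_zero[OF solves_linear[OF w u, of c], of n] c by simp
  thus thesis by (intro that[of c]) simp
qed

lemma filterlim_pred_int:
  "filterlim (\<lambda>n::int. n - 1) at_top at_top" "filterlim (\<lambda>n::int. n - 1) at_bot at_bot"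
proof -
  have "eventually (\<lambda>n. Z \<le> n - 1) at_top" for Z :: int
    by (rule eventually_at_top_linorderI[of "Z + 1"]) simp
  thus "filterlim (\<lambda>n::int. n - 1) at_top at_top" by (simp add: filterlim_at_top)
  have "eventually (\<lambda>n. n - 1 \<le> Z) at_bot" for Z :: int
    by (rule eventually_at_bot_linorderI[of Z]) simp
  thus "filterlim (\<lambda>n::int. n - 1) at_bot at_bot" by (simp add: filterlim_at_bot)
qed

lemma wronskian_zero_if_decaying:
  assumes u: "solves \<rho> l u" and w: "solves \<rho> l w"
    and lim: "(u \<longlongrightarrow> 0) F" "(w \<longlongrightarrow> 0) F"
    and F: "F \<noteq> bot" "filterlim (\<lambda>n. n - 1) F F"
  shows "wronskian u w 0 = 0"
proof -
  have "((\<lambda>n. u (n - 1) * w n - u n * w (n - 1)) \<longlongrightarrow> 0 * 0 - 0 * 0) F"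
    by (intro tendsto_intros lim filterlim_compose[OF lim(1) F(2)] filterlim_compose[OF lim(2) F(2)])
  hence "((\<lambda>n. cmod (u (n - 1) * w n - u n * w (n - 1))) \<longlongrightarrow> cmod (0 * 0 - 0 * 0)) F"
    by (rule tendsto_norm)
  moreover have "cmod (u (n - 1) * w n - u n * w (n - 1)) = cmod (wronskian u w 0)" for n
    unfolding wronskian_const[OF u w, of n, symmetric]
    by (simp add: wronskian_def norm_mult norm_power_int)
  ultimately have "((\<lambda>n. cmod (wronskian u w 0)) \<longlongrightarrow> 0) F" by simp
  hence "cmod (wronskian u w 0) = 0" using F(1) tendsto_const_iff by blast
  thus ?thesis by simp
qed

text \<open>A direction \<open>F\<close> in which \<open>\<mu>\<^sup>n\<close> decays: both Jost solutions are normalized where they are the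
  decaying solution, and for this reason their normalization determines them.\<close>

definition subdominant :: "complex \<Rightarrow> int filter \<Rightarrow> bool" where
  "subdominant \<mu> F \<longleftrightarrow> \<mu> \<noteq> 0 \<and> ((\<lambda>n. \<mu> powi n) \<longlongrightarrow> 0) F \<and> F \<noteq> bot \<and> filterlim (\<lambda>n. n - 1) F F"

lemma powi_tendsto_0:
  fixes a :: complex
  assumes "cmod a < 1"
  shows "((\<lambda>n. a powi n) \<longlongrightarrow> 0) at_top"
proof -
  have "(\<lambda>k. a ^ k) \<longlonglongrightarrow> 0" using assms by (rule LIMSEQ_power_zero)
  moreover have "filterlim nat sequentially (at_top :: int filter)"
    unfolding filterlim_at_top
  proof
    fix Z
    show "\<forall>\<^sub>F n in at_top. Z \<le> nat n"
      by (rule eventually_at_top_linorderI[of "int Z"]) linarith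
  qed
  ultimately have "((\<lambda>n. a ^ nat n) \<longlongrightarrow> 0) at_top" by (rule filterlim_compose)
  moreover have "\<forall>\<^sub>F n in at_top. a ^ nat n = a powi n"
    by (rule eventually_at_top_linorderI[of 0]) (simp add: power_int_def)
  ultimately show ?thesis by (rule Lim_transform_eventually)
qed

lemma subdominant_mu:
  assumes "l \<in> param_dom"
  shows "subdominant (mu_plus l) at_top" "subdominant (mu_minus l) at_bot"
proof -
  show "subdominant (mu_plus l) at_top"
    using assms by (simp add: subdominant_def mu_nonzero filterlim_pred_int powi_tendsto_0 characteristic_roots(5))
  have "cmod (inverse (mu_minus l)) < 1"
    using characteristic_roots(6)[OF assms] by (simp add: norm_inverse inverse_less_1_iff)
  hence "((\<lambda>n. inverse (mu_minus l) powi n) \<longlongrightarrow> 0) at_top" by (rule powi_tendsto_0)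
  hence "((\<lambda>n. mu_minus l powi n) \<longlongrightarrow> 0) at_bot"
    unfolding at_bot_mirror filterlim_filtermap by (simp add: power_int_minus power_int_inverse)
  thus "subdominant (mu_minus l) at_bot"
    using assms by (simp add: subdominant_def mu_nonzero filterlim_pred_int)
qed

lemma scalar_jost_tendsto_0:
  assumes "scalar_jost \<rho> l \<mu> F z" "subdominant \<mu> F"
  shows "(z \<longlongrightarrow> 0) F"
proof -
  have lim: "((\<lambda>n. \<mu> powi n * ((\<mu> powi (- n) * z n - 1) + 1)) \<longlongrightarrow> 0 * (0 + 1)) F"
    using assms unfolding scalar_jost_def subdominant_def by (intro tendsto_intros) auto
  have "\<mu> powi n * ((\<mu> powi (- n) * z n - 1) + 1) = z n" for n
    using assms(2) by (simp add: subdominant_def power_int_minus)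
  with lim show ?thesis by (simp only:) simp
qed

lemma scalar_jost_nonzero:
  assumes "scalar_jost \<rho> l \<mu> F z" "F \<noteq> bot"
  shows "z \<noteq> (\<lambda>_. 0)"
proof
  assume "z = (\<lambda>_. 0)"
  hence "((\<lambda>n. -1 :: complex) \<longlongrightarrow> 0) F" using assms(1) by (simp add: scalar_jost_def)
  thus False using assms(2) tendsto_const_iff[of F "-1 :: complex" 0] by simp
qed

text \<open>The Wronskian of two decaying solutions is constant and tends to \<open>0\<close>, so they are proportional, and the
  normalization makes the factor \<open>1\<close>.\<close>

lemma scalar_jost_unique:
  assumes u: "scalar_jost \<rho> l \<mu> F u" and w: "scalar_jost \<rho> l \<mu> F w" and sub: "subdominant \<mu> F"
  shows "u = w"
proof -
  have F: "F \<noteq> bot" "filterlim (\<lambda>n. n - 1) F F" and nz: "\<mu> \<noteq> 0"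
    using sub by (simp_all add: subdominant_def)
  have s: "solves \<rho> l u" "solves \<rho> l w" using u w by (simp_all add: scalar_jost_def)
  have "wronskian u w 0 = 0"
    by (rule wronskian_zero_if_decaying[OF s scalar_jost_tendsto_0[OF u sub]
          scalar_jost_tendsto_0[OF w sub] F])
  then obtain c where c: "\<And>n. w n = c * u n"
    using wronskian_zero_imp_multiple[OF s _ scalar_jost_nonzero[OF u F(1)]] by metis
  have "((\<lambda>n. (\<mu> powi (- n) * w n - 1) - c * (\<mu> powi (- n) * u n - 1)) \<longlongrightarrow> 0 - c * 0) F"
    using u w unfolding scalar_jost_def by (intro tendsto_intros) auto
  moreover have "(\<mu> powi (- n) * w n - 1) - c * (\<mu> powi (- n) * u n - 1) = c - 1" for n
    by (simp add: c algebra_simps)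
  ultimately have "c = 1" using F(1) tendsto_const_iff[of F "c - 1" 0] by simp
  thus ?thesis using c by (simp add: fun_eq_iff)
qed

section \<open>Jost solutions and their Wronskian\<close>

context spectral_point
begin

lemma minus_jost: "is_z_minus \<rho> l (\<lambda>n. m powi n * amp \<rho> l n)"
proof -
  have eq: "m powi (- n) * (m powi n * amp \<rho> l n) - 1 = amp \<rho> l n - 1" for n
    using mu_nonzero[OF l] by (simp add: power_int_minus)
  have "((\<lambda>n. amp \<rho> l n - 1) \<longlongrightarrow> 1 - 1) at_bot"
    by (intro tendsto_intros amp_tendsto_at_bot)
  thus ?thesis using amp_solves unfolding scalar_jost_def eq by simp
qed

lemma z_minus_eq: "z_minus \<rho> l = (\<lambda>n. m powi n * amp \<rho> l n)"
  unfolding z_minus_def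
  using minus_jost scalar_jost_unique[OF _ _ subdominant_mu(2)[OF l]] by (intro the_equality) auto

lemma cmod_amp_le: "cmod (amp \<rho> l n) \<le> amp_bound"
  by (rule tendsto_upperbound[OF tendsto_norm[OF tamp_tendsto]])
     (auto intro: cmod_tamp_le always_eventually)

lemma z_minus_decay: "cmod (z_minus \<rho> l (- int k)) \<le> amp_bound * cmod p ^ k"
proof -
  have "cmod (m powi (- int k)) = cmod p ^ k"
    using mu_minus_eq[OF l] by (simp add: power_int_minus norm_inverse norm_power flip: power_inverse)
  thus ?thesis
    using mult_left_mono[OF cmod_amp_le[of "- int k"], of "cmod p ^ k"]
    by (simp add: z_minus_eq norm_mult mult.commute)
qed

end

definition reflect :: "(int \<Rightarrow> complex) \<Rightarrow> int \<Rightarrow> complex" where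
  "reflect z n = (-1) powi n * z (- n)"

lemma solves_reflect:
  assumes "solves \<rho> l z"
  shows "solves (\<lambda>n. \<rho> (- n)) l (reflect z)"
  unfolding solves_def
proof
  fix n
  have s: "(-1 :: complex) powi (n - 1) = - ((-1) powi n)" "(-1 :: complex) powi (n + 1) = - ((-1) powi n)"
    using power_int_add_1[of "-1 :: complex" "n - 1"] power_int_add_1[of "-1 :: complex" n] by simp_all
  have i: "- (n - 1) = - n + 1" "- (n + 1) = - n - 1" by simp_all
  have "reflect z (n - 1) - reflect z (n + 1) = (-1) powi n * (z (- n - 1) - z (- n + 1))"
    unfolding reflect_def s i right_diff_distrib by simp
  also have "z (- n - 1) - z (- n + 1) = l / of_real (\<rho> (- n)) * z (- n)"
    by (rule assms[unfolded solves_def, rule_format])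
  finally show "reflect z (n - 1) - reflect z (n + 1) = l / of_real (\<rho> (- n)) * reflect z n"
    by (simp add: reflect_def)
qed

text \<open>The reflection \<open>z\<^sub>n \<mapsto> (-1)\<^sup>n z\<^sub>-\<^sub>n\<close> exchanges the two ends of the axis, because
  \<open>\<mu>\<^sub>+ = - 1 / \<mu>\<^sub>-\<close>.\<close>

lemma reflect_jost:
  assumes l: "l \<in> param_dom" and z: "is_z_minus (\<lambda>n. \<rho> (- n)) l z"
  shows "is_z_plus \<rho> l (reflect z)"
proof -
  let ?p = "mu_plus l" and ?m = "mu_minus l"
  have nz: "?p \<noteq> 0" "?m \<noteq> 0" using mu_nonzero[OF l] by auto
  have "?p = (-1) * inverse ?m"
    using mu_minus_eq[OF l] by simp
  hence "?p powi (- n) = (-1) powi (- n) * ?m powi n" for n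
    by (simp only: power_int_mult_distrib power_int_inverse power_int_minus inverse_inverse_eq inverse_mult_distrib)
  hence "?p powi (- n) * reflect z n - 1 = ?m powi (- (- n)) * z (- n) - 1" for n
    by (simp add: reflect_def power_int_minus)
  moreover have "((\<lambda>n. ?m powi (- (- n)) * z (- n) - 1) \<longlongrightarrow> 0) at_top"
    using z unfolding scalar_jost_def at_bot_mirror filterlim_filtermap by simp
  moreover have "solves \<rho> l (reflect z)"
    using z solves_reflect[of "\<lambda>n. \<rho> (- n)" l z] by (simp add: scalar_jost_def)
  ultimately show ?thesis by (simp add: scalar_jost_def)
qed

lemma (in summable_defect) reflect_defect: "summable_defect (\<lambda>n. \<rho> (- n)) \<delta>"
proof
  show "(\<lambda>n. 1 - \<rho> (- n)) summable_on UNIV"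
    using summable_on_shift_int(2)[OF defect_summable, of 0] by simp
qed (use le1 away \<delta>_pos in auto)

context spectral_point
begin

interpretation mirror: spectral_point "\<lambda>n. \<rho> (- n)" \<delta> l
  using reflect_defect l by (simp add: spectral_point_def spectral_point_axioms_def)

lemma plus_jost: "is_z_plus \<rho> l (reflect (z_minus (\<lambda>n. \<rho> (- n)) l))"
  using reflect_jost[OF l, of \<rho>] mirror.minus_jost by (simp add: mirror.z_minus_eq)

lemma z_plus_eq_reflect: "z_plus \<rho> l = reflect (z_minus (\<lambda>n. \<rho> (- n)) l)"
  unfolding z_plus_def
  using plus_jost scalar_jost_unique[OF _ _ subdominant_mu(1)[OF l]] by (intro the_equality) auto

lemma jost_solutions: "is_z_plus \<rho> l (z_plus \<rho> l)" "is_z_minus \<rho> l (z_minus \<rho> l)"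
  using plus_jost minus_jost by (simp_all add: z_plus_eq_reflect z_minus_eq)

lemma jost_solve: "solves \<rho> l (z_plus \<rho> l)" "solves \<rho> l (z_minus \<rho> l)"
  using jost_solutions by (simp_all add: scalar_jost_def)

text \<open>Evaluate the Wronskian in the limit \<open>n \<rightarrow> \<infinity>\<close>, where \<open>z\<^sup>+\<^sub>n\<close> is asymptotic to \<open>\<mu>\<^sub>+\<^sup>n\<close> and \<open>z\<^sup>-\<^sub>n\<close> to
  \<open>\<mu>\<^sub>-\<^sup>n\<close> times the determinant. The powers cancel since \<open>\<mu>\<^sub>+ \<mu>\<^sub>- = -1\<close>.\<close>

lemma wronskian_eq_det:
  "wronskian (z_plus \<rho> l) (z_minus \<rho> l) 0 = (m - p) * fredholm_det (K_op \<rho> l)"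
proof -
  let ?D = "fredholm_det (K_op \<rho> l)"
  define a where "a n = p powi (- n) * z_plus \<rho> l n" for n
  have nz: "p \<noteq> 0" "m \<noteq> 0" using mu_nonzero[OF l] by auto
  have zp: "z_plus \<rho> l n = p powi n * a n" for n
    using nz by (simp add: a_def power_int_minus)
  have "((\<lambda>n. (a n - 1) + 1) \<longlongrightarrow> 0 + 1) at_top"
    using jost_solutions(1) unfolding scalar_jost_def a_def by (intro tendsto_intros) auto
  hence a: "(a \<longlongrightarrow> 1) at_top" by simp
  note w = amp_tendsto_at_top
  have "wronskian (z_plus \<rho> l) (z_minus \<rho> l) n =
      m * a (n - 1) * amp \<rho> l n - p * a n * amp \<rho> l (n - 1)" for n
  proof -
    have s: "p powi n = p powi (n - 1) * p" "m powi n = m powi (n - 1) * m"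
      using power_int_add_1[of p "n - 1"] power_int_add_1[of m "n - 1"] nz by simp_all
    have one: "(-1) powi (n - 1) * p powi (n - 1) * m powi (n - 1) = 1"
      unfolding power_int_mult_distrib[symmetric] using characteristic_roots(3)[OF l] by simp
    have "wronskian (z_plus \<rho> l) (z_minus \<rho> l) n =
       ((-1) powi (n - 1) * p powi (n - 1) * m powi (n - 1)) *
       (m * a (n - 1) * amp \<rho> l n - p * a n * amp \<rho> l (n - 1))"
      unfolding wronskian_def zp z_minus_eq s by (simp only: right_diff_distrib mult_ac)
    thus ?thesis unfolding one by simp
  qed
  hence "wronskian (z_plus \<rho> l) (z_minus \<rho> l) 0 =
      m * a (n - 1) * amp \<rho> l n - p * a n * amp \<rho> l (n - 1)" for n
    using wronskian_const[OF jost_solve, of n] by metis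
  moreover have "((\<lambda>n. m * a (n - 1) * amp \<rho> l n - p * a n * amp \<rho> l (n - 1)) \<longlongrightarrow>
      m * 1 * ?D - p * 1 * ?D) at_top"
    by (intro tendsto_intros a w filterlim_compose[OF a filterlim_pred_int(1)]
        filterlim_compose[OF w filterlim_pred_int(1)])
  ultimately have "((\<lambda>n::int. wronskian (z_plus \<rho> l) (z_minus \<rho> l) 0) \<longlongrightarrow>
      m * 1 * ?D - p * 1 * ?D) at_top" by simp
  hence "wronskian (z_plus \<rho> l) (z_minus \<rho> l) 0 = m * 1 * ?D - p * 1 * ?D"
    by (simp add: tendsto_const_iff)
  thus ?thesis by (simp add: algebra_simps)
qed

lemma jost_eq_det: "jost \<rho> l = - fredholm_det (K_op \<rho> l)"
proof -
  have "inverse (p - m) * (m - p) = -1"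
    using mu_nonzero(3)[OF l] by (simp add: field_simps)
  thus ?thesis unfolding jost_def wronskian_eq_det by (simp flip: mult.assoc)
qed

lemma z_plus_decay: "cmod (z_plus \<rho> l (int k)) \<le> mirror.amp_bound * cmod p ^ k"
  using mirror.z_minus_decay[of k]
  by (simp add: z_plus_eq_reflect reflect_def norm_mult norm_power)

text \<open>A square-summable solution has zero Wronskian with both Jost solutions, so it is a multiple of each of
  them. Conversely, proportional Jost solutions decay geometrically at both ends.\<close>

lemma eigenvalue_iff: "discrete_eigenvalue \<rho> l \<longleftrightarrow> fredholm_det (K_op \<rho> l) = 0"
proof -
  have nzp: "z_plus \<rho> l \<noteq> (\<lambda>_. 0)" and nzm: "z_minus \<rho> l \<noteq> (\<lambda>_. 0)"
    by (rule scalar_jost_nonzero[OF jost_solutions(1)], simp,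
        rule scalar_jost_nonzero[OF jost_solutions(2)], simp)
  have "discrete_eigenvalue \<rho> l \<longleftrightarrow> wronskian (z_plus \<rho> l) (z_minus \<rho> l) 0 = 0"
  proof
    assume "discrete_eigenvalue \<rho> l"
    then obtain z where z: "z \<in> ell2" "z \<noteq> (\<lambda>_. 0)" "solves \<rho> l z"
      unfolding discrete_eigenvalue_def by blast
    have "wronskian (z_plus \<rho> l) z 0 = 0"
      by (rule wronskian_zero_if_decaying[OF jost_solve(1) z(3)
            scalar_jost_tendsto_0[OF jost_solutions(1) subdominant_mu(1)[OF l]]
            ell2_tendsto_0(1)[OF z(1)] _ filterlim_pred_int(1)]) simp
    then obtain c where c: "\<And>n. z n = c * z_plus \<rho> l n"
      using wronskian_zero_imp_multiple[OF jost_solve(1) z(3) _ nzp] by metis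
    have "wronskian (z_minus \<rho> l) z 0 = 0"
      by (rule wronskian_zero_if_decaying[OF jost_solve(2) z(3)
            scalar_jost_tendsto_0[OF jost_solutions(2) subdominant_mu(2)[OF l]]
            ell2_tendsto_0(2)[OF z(1)] _ filterlim_pred_int(2)]) simp
    hence "wronskian (z_minus \<rho> l) (\<lambda>n. c * z_plus \<rho> l n) 0 = 0" using c by (simp add: wronskian_0)
    moreover have "c * wronskian (z_plus \<rho> l) (z_minus \<rho> l) 0 =
        - wronskian (z_minus \<rho> l) (\<lambda>n. c * z_plus \<rho> l n) 0"
      unfolding wronskian_0 by (simp add: right_diff_distrib mult_ac)
    ultimately have "c * wronskian (z_plus \<rho> l) (z_minus \<rho> l) 0 = 0" by simp
    moreover have "c \<noteq> 0" using z(2) c by (auto simp: fun_eq_iff)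
    ultimately show "wronskian (z_plus \<rho> l) (z_minus \<rho> l) 0 = 0" by simp
  next
    assume "wronskian (z_plus \<rho> l) (z_minus \<rho> l) 0 = 0"
    then obtain c where c: "\<And>n. z_minus \<rho> l n = c * z_plus \<rho> l n"
      using wronskian_zero_imp_multiple[OF jost_solve _ nzp] by metis
    have c0: "c \<noteq> 0" using nzm c by (auto simp: fun_eq_iff)
    have a1: "cmod p < 1" by (rule characteristic_roots(5)[OF l])
    have geo: "(\<lambda>k. (B * cmod p ^ k)\<^sup>2) summable_on UNIV" for B
    proof -
      have "summable (\<lambda>k. B\<^sup>2 * ((cmod p)\<^sup>2) ^ k)"
        using a1 by (intro summable_mult summable_geometric) (simp add: abs_square_less_1)
      hence "(\<lambda>k. B\<^sup>2 * ((cmod p)\<^sup>2) ^ k) summable_on UNIV"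
        by (subst summable_on_UNIV_nonneg_real_iff) auto
      thus ?thesis by (simp add: power_mult_distrib power_mult[symmetric] mult.commute)
    qed
    have "z_plus \<rho> l \<in> ell2"
      unfolding ell2_def mem_Collect_eq
    proof (rule summable_on_int_halves)
      show "(\<lambda>k. (cmod (z_plus \<rho> l (int k)))\<^sup>2) summable_on UNIV"
        by (rule summable_on_comparison_test[OF geo[of mirror.amp_bound]])
           (auto intro!: power_mono z_plus_decay)
      have "z_plus \<rho> l n = inverse c * z_minus \<rho> l n" for n using c[of n] c0 by simp
      hence "cmod (z_plus \<rho> l (- int k)) \<le> (cmod (inverse c) * amp_bound) * cmod p ^ k" for k
        using mult_left_mono[OF z_minus_decay[of k], of "cmod (inverse c)"]
        by (simp only: norm_mult mult.assoc norm_ge_zero)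
      thus "(\<lambda>k. (cmod (z_plus \<rho> l (- int k)))\<^sup>2) summable_on UNIV"
        by (intro summable_on_comparison_test[OF geo[of "cmod (inverse c) * amp_bound"]] power_mono) auto
    qed
    thus "discrete_eigenvalue \<rho> l"
      unfolding discrete_eigenvalue_def using nzp jost_solve(1) by blast
  qed
  thus ?thesis using mu_nonzero(3)[OF l] by (simp add: wronskian_eq_det)
qed

end

context summable_defect
begin

lemma spectral_pointI: "l \<in> param_dom \<Longrightarrow> spectral_point \<rho> \<delta> l"
  by unfold_locales

lemma z_minus_holomorphic: "(\<lambda>l. z_minus \<rho> l n) holomorphic_on param_dom"
proof (rule holomorphic_transform)
  show "(\<lambda>l. mu_minus l powi n * amp \<rho> l n) holomorphic_on param_dom"
    by (intro holomorphic_intros mu_holomorphic amp_holomorphic) (auto simp: mu_nonzero)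
qed (simp add: spectral_point.z_minus_eq[OF spectral_pointI])

lemma z_plus_holomorphic: "(\<lambda>l. z_plus \<rho> l n) holomorphic_on param_dom"
proof (rule holomorphic_transform)
  show "(\<lambda>l. (-1) powi n * z_minus (\<lambda>n. \<rho> (- n)) l (- n)) holomorphic_on param_dom"
    by (intro holomorphic_intros summable_defect.z_minus_holomorphic[OF reflect_defect])
qed (simp add: spectral_point.z_plus_eq_reflect[OF spectral_pointI] reflect_def)

lemma jost_holomorphic: "jost \<rho> holomorphic_on param_dom"
proof -
  have "mu_plus l - mu_minus l \<noteq> 0" if "l \<in> param_dom" for l
    using mu_nonzero(3)[OF that] by auto
  thus ?thesis
    unfolding jost_def[abs_def] wronskian_0
    by (intro holomorphic_intros mu_holomorphic z_plus_holomorphic z_minus_holomorphic)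
qed

end

section \<open>Matrix Jost solutions and the Evans function\<close>

lemma matrix2_eqI:
  fixes M N :: "complex^2^2"
  assumes "M $ 1 $ 1 = N $ 1 $ 1" "M $ 1 $ 2 = N $ 1 $ 2" "M $ 2 $ 1 = N $ 2 $ 1" "M $ 2 $ 2 = N $ 2 $ 2"
  shows "M = N"
  using assms by (simp add: vec_eq_iff forall_2)

lemma matrix2_mult_nth: "((M :: complex^2^2) ** N) $ i $ j = M $ i $ 1 * N $ 1 $ j + M $ i $ 2 * N $ 2 $ j"
  by (simp add: matrix_matrix_mult_def sum_2)

lemma scalar_matrix_mult_nth: "(mat c ** (M :: complex^2^2)) $ i $ j = c * M $ i $ j"
  using exhaust_2[of i] by (auto simp: matrix2_mult_nth mat_def)

lemma matrix_mult_scalar_commute: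
  fixes M N :: "complex^2^2"
  shows "M ** (mat c ** N) = mat c ** (M ** N)"
proof -
  have "(M ** (mat c ** N)) $ i $ j = (mat c ** (M ** N)) $ i $ j" for i j
  proof -
    have "(M ** (mat c ** N)) $ i $ j = M $ i $ 1 * (c * N $ 1 $ j) + M $ i $ 2 * (c * N $ 2 $ j)"
      by (subst matrix2_mult_nth) (simp only: scalar_matrix_mult_nth)
    also have "\<dots> = c * (M ** N) $ i $ j" by (simp add: matrix2_mult_nth algebra_simps)
    finally show ?thesis by (simp only: scalar_matrix_mult_nth)
  qed
  thus ?thesis by (simp add: vec_eq_iff)
qed

lemma scalar_matrix_mult_assoc: "mat a ** (mat b ** (M :: complex^2^2)) = mat (a * b) ** M"
  unfolding vec_eq_iff scalar_matrix_mult_nth by (simp add: mult.assoc)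

lemma matrix_inv_eqI:
  fixes A B :: "complex^2^2"
  assumes "A ** B = mat 1" "B ** A = mat 1"
  shows "matrix_inv A = B"
proof -
  have "A ** matrix_inv A = mat 1 \<and> matrix_inv A ** A = mat 1"
    unfolding matrix_inv_def by (rule someI[of _ B]) (use assms in simp)
  hence "matrix_inv A = matrix_inv A ** (A ** B)" "(matrix_inv A ** A) ** B = B"
    using assms by simp_all
  thus ?thesis by (simp add: matrix_mul_assoc)
qed

text \<open>For \<open>\<mu> \<mu>' = -1\<close>, the projection onto the eigenvector \<open>(\<mu>, 1)\<close> along the eigenvector \<open>(\<mu>', 1)\<close>.\<close>

definition eigen_proj :: "complex \<Rightarrow> complex \<Rightarrow> complex^2^2" where
  "eigen_proj \<mu> \<mu>' = vector [vector [\<mu> / (\<mu> - \<mu>'), 1 / (\<mu> - \<mu>')],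
                             vector [1 / (\<mu> - \<mu>'), - \<mu>' / (\<mu> - \<mu>')]]"

lemma eigen_proj_nth:
  "eigen_proj \<mu> \<mu>' $ 1 $ 1 = \<mu> / (\<mu> - \<mu>')" "eigen_proj \<mu> \<mu>' $ 1 $ 2 = 1 / (\<mu> - \<mu>')"
  "eigen_proj \<mu> \<mu>' $ 2 $ 1 = 1 / (\<mu> - \<mu>')" "eigen_proj \<mu> \<mu>' $ 2 $ 2 = - \<mu>' / (\<mu> - \<mu>')"
  by (simp_all add: eigen_proj_def)

lemma A_mat_nth: "A_mat l $ 1 $ 1 = - l" "A_mat l $ 1 $ 2 = 1" "A_mat l $ 2 $ 1 = 1" "A_mat l $ 2 $ 2 = 0"
  by (simp_all add: A_mat_def)

lemma Ax_mat_nth: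
  "Ax_mat \<rho> l n $ 1 $ 1 = - l / of_real (\<rho> n)" "Ax_mat \<rho> l n $ 1 $ 2 = 1"
  "Ax_mat \<rho> l n $ 2 $ 1 = 1" "Ax_mat \<rho> l n $ 2 $ 2 = 0"
  by (simp_all add: Ax_mat_def)

text \<open>The resolvent of \<open>A\<close> at \<open>\<zeta>\<close> is the adjugate of \<open>\<zeta> - A\<close> over the characteristic
  polynomial, so that the Riesz projection is its residue at \<open>\<mu>\<close>.\<close>

definition adj_A :: "complex \<Rightarrow> complex \<Rightarrow> complex^2^2" where
  "adj_A l \<zeta> = vector [vector [\<zeta>, 1], vector [1, \<zeta> + l]]"

lemma adj_A_nth:
  "adj_A l \<zeta> $ 1 $ 1 = \<zeta>" "adj_A l \<zeta> $ 1 $ 2 = 1" "adj_A l \<zeta> $ 2 $ 1 = 1" "adj_A l \<zeta> $ 2 $ 2 = \<zeta> + l"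
  by (simp_all add: adj_A_def)

lemma A_mat_resolvent:
  assumes sum: "\<mu> + \<mu>' = - l" and prd: "\<mu> * \<mu>' = -1" and "\<zeta> \<noteq> \<mu>" "\<zeta> \<noteq> \<mu>'"
  shows "matrix_inv (mat \<zeta> - A_mat l) = mat (1 / ((\<zeta> - \<mu>) * (\<zeta> - \<mu>'))) ** adj_A l \<zeta>"
proof -
  let ?D = "(\<zeta> - \<mu>) * (\<zeta> - \<mu>')"
  have D: "?D \<noteq> 0" using assms by simp
  have "?D = \<zeta> * \<zeta> - (\<mu> + \<mu>') * \<zeta> + \<mu> * \<mu>'" by (simp add: algebra_simps)
  hence char: "\<zeta> * \<zeta> + l * \<zeta> - 1 = ?D" unfolding sum prd by simp
  have entries: "(mat \<zeta> - A_mat l) $ 1 $ 1 = \<zeta> + l" "(mat \<zeta> - A_mat l) $ 1 $ 2 = -1"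
    "(mat \<zeta> - A_mat l) $ 2 $ 1 = -1" "(mat \<zeta> - A_mat l) $ 2 $ 2 = \<zeta>"
    by (simp_all add: A_mat_nth mat_def)
  have one: "(mat 1 :: complex^2^2) $ 1 $ 1 = 1" "(mat 1 :: complex^2^2) $ 1 $ 2 = 0"
    "(mat 1 :: complex^2^2) $ 2 $ 1 = 0" "(mat 1 :: complex^2^2) $ 2 $ 2 = 1"
    by (simp_all add: mat_def)
  define E where "E = 1 / ?D"
  have "E * (\<zeta> * \<zeta> + l * \<zeta> - 1) = 1" unfolding char E_def using D by simp
  hence unit: "E * (\<zeta> * \<zeta>) + E * (l * \<zeta>) = 1 + E" by (simp add: algebra_simps)
  define N where "N = mat E ** adj_A l \<zeta>"
  have N: "N $ 1 $ 1 = E * \<zeta>" "N $ 1 $ 2 = E * 1" "N $ 2 $ 1 = E * 1" "N $ 2 $ 2 = E * (\<zeta> + l)"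
    unfolding N_def scalar_matrix_mult_nth adj_A_nth by (rule refl)+
  show ?thesis
    unfolding E_def[symmetric] N_def[symmetric]
  proof (rule matrix_inv_eqI)
    show "(mat \<zeta> - A_mat l) ** N = mat 1"
      by (rule matrix2_eqI; unfold matrix2_mult_nth entries N one)
         (use unit in \<open>simp_all add: algebra_simps\<close>)
    show "N ** (mat \<zeta> - A_mat l) = mat 1"
      by (rule matrix2_eqI; unfold matrix2_mult_nth entries N one)
         (use unit in \<open>simp_all add: algebra_simps\<close>)
  qed
qed

lemma riesz_proj_A_mat:
  assumes sum: "\<mu> + \<mu>' = - l" and prd: "\<mu> * \<mu>' = -1" and ne: "\<mu> \<noteq> \<mu>'"
  shows "riesz_proj (A_mat l) \<mu> = eigen_proj \<mu> \<mu>'"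
proof -
  let ?I = "\<lambda>P r. \<forall>i j. ((\<lambda>\<zeta>. matrix_inv (mat \<zeta> - A_mat l) $ i $ j)
           has_contour_integral (2 * of_real pi * \<i> * (P $ i $ j))) (circlepath \<mu> r)"
  have "l = - (\<mu> + \<mu>')" using sum by simp
  hence lm: "\<mu> + l = - \<mu>'" by simp
  have proj: "eigen_proj \<mu> \<mu>' $ i $ j = adj_A l \<mu> $ i $ j / (\<mu> - \<mu>')" for i j
    using exhaust_2[of i] exhaust_2[of j] by (auto simp: eigen_proj_nth adj_A_nth lm)
  have I: "?I (eigen_proj \<mu> \<mu>') r" if r: "0 < r" "r < cmod (\<mu> - \<mu>')" for r
  proof (intro allI)
    fix i j :: 2
    have away: "\<zeta> \<noteq> \<mu>'" if "\<zeta> \<in> cball \<mu> r" for \<zeta>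
      using that r by (auto simp: dist_norm)
    have "(\<lambda>\<zeta>. adj_A l \<zeta> $ i $ j) holomorphic_on cball \<mu> r"
      using exhaust_2[of i] exhaust_2[of j] by (auto simp: adj_A_nth intro!: holomorphic_intros)
    hence "(\<lambda>\<zeta>. adj_A l \<zeta> $ i $ j / (\<zeta> - \<mu>')) holomorphic_on cball \<mu> r"
      using away by (intro holomorphic_intros) auto
    hence "((\<lambda>\<zeta>. adj_A l \<zeta> $ i $ j / (\<zeta> - \<mu>') / (\<zeta> - \<mu>)) has_contour_integral
        (2 * of_real pi * \<i> * (adj_A l \<mu> $ i $ j / (\<mu> - \<mu>')))) (circlepath \<mu> r)"
      by (rule Cauchy_integral_circlepath_simple) (use r in simp)
    moreover have "adj_A l \<zeta> $ i $ j / (\<zeta> - \<mu>') / (\<zeta> - \<mu>) = matrix_inv (mat \<zeta> - A_mat l) $ i $ j"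
      if "\<zeta> \<in> path_image (circlepath \<mu> r)" for \<zeta>
    proof -
      have "\<zeta> \<in> sphere \<mu> r" using that r by simp
      hence "\<zeta> \<noteq> \<mu>" "\<zeta> \<noteq> \<mu>'" using r away[of \<zeta>] by auto
      thus ?thesis by (simp add: A_mat_resolvent[OF sum prd] scalar_matrix_mult_nth)
    qed
    ultimately show "((\<lambda>\<zeta>. matrix_inv (mat \<zeta> - A_mat l) $ i $ j) has_contour_integral
        (2 * of_real pi * \<i> * (eigen_proj \<mu> \<mu>' $ i $ j))) (circlepath \<mu> r)"
      unfolding proj by (rule has_contour_integral_eq)
  qed
  have ev: "\<forall>\<^sub>F r in at_right 0. ?I (eigen_proj \<mu> \<mu>') r"
    unfolding eventually_at_right_field
    using I ne by (intro exI[of _ "cmod (\<mu> - \<mu>')"]) auto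
  show ?thesis
    unfolding riesz_proj_def
  proof (rule the_equality)
    fix P assume P: "\<forall>\<^sub>F r in at_right 0. ?I P r"
    have "\<forall>\<^sub>F r in at_right (0::real). ?I P r \<and> ?I (eigen_proj \<mu> \<mu>') r"
      using P ev by (rule eventually_conj)
    then obtain r where r: "?I P r" "?I (eigen_proj \<mu> \<mu>') r"
      using eventually_happens'[OF trivial_limit_at_right_real] by blast
    have "2 * of_real pi * \<i> * (P $ i $ j) = 2 * of_real pi * \<i> * (eigen_proj \<mu> \<mu>' $ i $ j)" for i j
      using r by (intro has_contour_integral_unique) blast+
    thus "P = eigen_proj \<mu> \<mu>'" by (simp add: vec_eq_iff)
  qed (rule ev)
qed

lemma P_plus_eq: "l \<in> param_dom \<Longrightarrow> P_plus l = eigen_proj (mu_plus l) (mu_minus l)"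
  unfolding P_plus_def using characteristic_roots(3,4)[of l] mu_nonzero(3)[of l]
  by (intro riesz_proj_A_mat) auto

lemma P_minus_eq: "l \<in> param_dom \<Longrightarrow> P_minus l = eigen_proj (mu_minus l) (mu_plus l)"
  unfolding P_minus_def using characteristic_roots(3,4)[of l] mu_nonzero(3)[of l]
  by (intro riesz_proj_A_mat) (auto simp: add.commute mult.commute)

lemma mat_powi_eigen_proj:
  assumes sum: "\<mu> + \<mu>' = - l" and prd: "\<mu> * \<mu>' = -1" and ne: "\<mu> \<noteq> \<mu>'"
  shows "mat_powi (A_mat l) n ** eigen_proj \<mu> \<mu>' = mat (\<mu> powi n) ** eigen_proj \<mu> \<mu>'"
proof -
  let ?P = "eigen_proj \<mu> \<mu>'" and ?A = "A_mat l"
  have nz: "\<mu> \<noteq> 0" using prd by auto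
  have iter: "(((**) M) ^^ k) (mat 1) ** ?P = mat (c ^ k) ** ?P"
    if "M ** ?P = mat c ** ?P" for M :: "complex^2^2" and c k
  proof (induction k)
    case 0
    show ?case by simp
  next
    case (Suc k)
    have "(((**) M) ^^ Suc k) (mat 1) ** ?P = M ** (mat (c ^ k) ** ?P)"
      by (simp add: Suc matrix_mul_assoc[symmetric])
    also have "\<dots> = mat (c ^ k) ** (M ** ?P)"
      by (rule matrix_mult_scalar_commute)
    also have "\<dots> = mat (c ^ Suc k) ** ?P"
      unfolding that scalar_matrix_mult_assoc by (simp add: mult.commute)
    finally show ?case .
  qed
  have lm: "l = - \<mu> - \<mu>'" using sum by (metis add.inverse_inverse diff_conv_add_uminus minus_add_distrib)
  have AP: "?A ** ?P = mat \<mu> ** ?P"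
    by (rule matrix2_eqI; unfold matrix2_mult_nth[of ?A ?P] scalar_matrix_mult_nth A_mat_nth eigen_proj_nth)
       (use ne prd in \<open>simp_all add: lm divide_simps, simp_all add: algebra_simps\<close>)
  (* the inverse of A *)
  let ?B = "vector [vector [0, 1], vector [1, l]] :: complex^2^2"
  have AB: "?A ** ?B = mat 1" "?B ** ?A = mat 1"
    by (rule matrix2_eqI; simp add: matrix2_mult_nth A_mat_nth mat_def)+
  have "matrix_inv ?A ** (?A ** ?P) = ?P"
    unfolding matrix_inv_eqI[OF AB] by (simp add: matrix_mul_assoc AB)
  hence inv: "matrix_inv ?A ** (mat \<mu> ** ?P) = ?P" unfolding AP .
  have "matrix_inv ?A ** ?P = mat (inverse \<mu>) ** (matrix_inv ?A ** (mat \<mu> ** ?P))"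
    unfolding matrix_mult_scalar_commute[of "matrix_inv ?A" \<mu> ?P] scalar_matrix_mult_assoc
    using nz by simp
  hence invP: "matrix_inv ?A ** ?P = mat (inverse \<mu>) ** ?P" unfolding inv .
  show ?thesis
    using iter[OF AP, of "nat n"] iter[OF invP, of "nat (- n)"]
    by (auto simp: mat_powi_def power_int_def)
qed

text \<open>The rank one matrix \<open>\<mu> (z\<^sub>n, z\<^sub>n\<^sub>-\<^sub>1)\<^sup>T \<otimes> (1, 1/\<mu>) / (\<mu> - \<mu>')\<close>. For \<open>z\<^sub>n = \<mu>\<^sup>n\<close> it is \<open>\<mu>\<^sup>n\<close> times the
  eigenprojection.\<close>

definition jost_matrix :: "complex \<Rightarrow> complex \<Rightarrow> (int \<Rightarrow> complex) \<Rightarrow> int \<Rightarrow> complex^2^2" where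
  "jost_matrix \<mu> \<mu>' z n = vector [vector [\<mu> * z n / (\<mu> - \<mu>'), z n / (\<mu> - \<mu>')],
                              vector [\<mu> * z (n - 1) / (\<mu> - \<mu>'), z (n - 1) / (\<mu> - \<mu>')]]"

lemma jost_matrix_nth:
  "jost_matrix \<mu> \<mu>' z n $ 1 $ 1 = \<mu> * z n / (\<mu> - \<mu>')" "jost_matrix \<mu> \<mu>' z n $ 1 $ 2 = z n / (\<mu> - \<mu>')"
  "jost_matrix \<mu> \<mu>' z n $ 2 $ 1 = \<mu> * z (n - 1) / (\<mu> - \<mu>')" "jost_matrix \<mu> \<mu>' z n $ 2 $ 2 = z (n - 1) / (\<mu> - \<mu>')"
  by (simp_all add: jost_matrix_def)

lemma tendsto_norm_matrix2_iff:
  fixes D :: "int \<Rightarrow> complex^2^2"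
  shows "((\<lambda>n. norm (D n)) \<longlongrightarrow> 0) F \<longleftrightarrow> (\<forall>i j. ((\<lambda>n. D n $ i $ j) \<longlongrightarrow> 0) F)"
proof
  assume "((\<lambda>n. norm (D n)) \<longlongrightarrow> 0) F"
  hence "(D \<longlongrightarrow> 0) F" by (rule tendsto_norm_zero_cancel)
  hence "((\<lambda>n. D n $ i $ j) \<longlongrightarrow> 0 $ i $ j) F" for i j by (intro tendsto_vec_nth)
  thus "\<forall>i j. ((\<lambda>n. D n $ i $ j) \<longlongrightarrow> 0) F" by simp
next
  assume "\<forall>i j. ((\<lambda>n. D n $ i $ j) \<longlongrightarrow> 0) F"
  hence "(D \<longlongrightarrow> 0) F" by (intro vec_tendstoI) simp
  thus "((\<lambda>n. norm (D n)) \<longlongrightarrow> 0) F" by (rule tendsto_norm_zero)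
qed

text \<open>The columns of a solution of the system have the form \<open>(d\<^sub>n, d\<^sub>n\<^sub>-\<^sub>1)\<close> with \<open>d\<close> a solution of the scalar
  equation. If a column of the difference of two matrix Jost solutions is added to \<open>z\<close>, the result is
  again a scalar Jost solution, so uniqueness carries over from the scalar case.\<close>

lemma matrix_jost_iff:
  assumes sum: "\<mu> + \<mu>' = - l" and prd: "\<mu> * \<mu>' = -1" and ne: "\<mu> \<noteq> \<mu>'"
    and sub: "subdominant \<mu> F" and z: "scalar_jost \<rho> l \<mu> F z"
  shows "matrix_jost \<rho> l \<mu> (eigen_proj \<mu> \<mu>') F Y \<longleftrightarrow> Y = jost_matrix \<mu> \<mu>' z"
proof -
  let ?P = "eigen_proj \<mu> \<mu>'"
  have nz: "\<mu> \<noteq> 0" "\<mu>' \<noteq> 0" using prd by auto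
  have ne': "\<mu> - \<mu>' \<noteq> 0" using ne by simp
  have zs: "solves \<rho> l z" and zl: "((\<lambda>n. \<mu> powi (- n) * z n - 1) \<longlongrightarrow> 0) F"
    using z by (simp_all add: scalar_jost_def)
  have F: "filterlim (\<lambda>n. n - 1) F F" using sub by (simp add: subdominant_def)
  have entry: "(mat (\<mu> powi (- n)) ** (Y n - mat_powi (A_mat l) n ** ?P)) $ i $ j =
      \<mu> powi (- n) * Y n $ i $ j - ?P $ i $ j" for Y i j n
    unfolding mat_powi_eigen_proj[OF sum prd ne] scalar_matrix_mult_nth
    using nz by (simp add: scalar_matrix_mult_nth right_diff_distrib power_int_minus mult.assoc[symmetric])
  have lim: "((\<lambda>n. norm (mat (\<mu> powi (- n)) ** (Y n - mat_powi (A_mat l) n ** ?P))) \<longlongrightarrow> 0) F \<longleftrightarrow>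
      (\<forall>i j. ((\<lambda>n. \<mu> powi (- n) * Y n $ i $ j - ?P $ i $ j) \<longlongrightarrow> 0) F)" for Y
    unfolding tendsto_norm_matrix2_iff entry ..
  let ?J = "jost_matrix \<mu> \<mu>' z"
  define k where "k = 1 / (\<mu> - \<mu>')"
  have k: "x / (\<mu> - \<mu>') = k * x" for x by (simp add: k_def)
  have J_step: "?J (n + 1) = Ax_mat \<rho> l n ** ?J n" for n
    by (rule matrix2_eqI; unfold matrix2_mult_nth Ax_mat_nth jost_matrix_nth solvesD[OF zs, of n] k)
       (simp_all add: algebra_simps)
  have J_lim: "\<forall>i j. ((\<lambda>n. \<mu> powi (- n) * ?J n $ i $ j - ?P $ i $ j) \<longlongrightarrow> 0) F"
  proof -
    have zl': "((\<lambda>n. \<mu> powi (- (n - 1)) * z (n - 1) - 1) \<longlongrightarrow> 0) F"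
      by (rule filterlim_compose[OF zl F])
    have mu: "\<mu> powi (- (n - 1)) = \<mu> powi (- n) * \<mu>" for n
      using power_int_add_1[of \<mu> "- n"] nz by (simp add: add.commute)
    have mm: "- \<mu>' = 1 / \<mu>" using prd nz by (simp add: field_simps)
    (* the four entries of the limit; in the second row z is evaluated at n - 1 *)
    have "((\<lambda>n. \<mu> * k * (\<mu> powi (- n) * z n - 1)) \<longlongrightarrow> \<mu> * k * 0) F"
      "((\<lambda>n. k * (\<mu> powi (- n) * z n - 1)) \<longlongrightarrow> k * 0) F"
      "((\<lambda>n. k * (\<mu> powi (- (n - 1)) * z (n - 1) - 1)) \<longlongrightarrow> k * 0) F"
      "((\<lambda>n. k / \<mu> * (\<mu> powi (- (n - 1)) * z (n - 1) - 1)) \<longlongrightarrow> k / \<mu> * 0) F"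
      by (intro tendsto_intros zl zl')+
    thus ?thesis
      unfolding forall_2 jost_matrix_nth eigen_proj_nth k mu mm
      using nz by (simp add: algebra_simps)
  qed
  have J_proj: "?J 0 = ?J 0 ** ?P"
  proof -
    have "\<mu> * \<mu> + 1 = \<mu> * (\<mu> - \<mu>')" using prd by (simp add: algebra_simps)
    hence *: "(\<mu> * \<mu> + 1) / (\<mu> - \<mu>') = \<mu>" "(\<mu> + - \<mu>') / (\<mu> - \<mu>') = 1"
      using ne' by simp_all
    have row: "\<mu> * x / (\<mu> - \<mu>') * (\<mu> / (\<mu> - \<mu>')) + x / (\<mu> - \<mu>') * (1 / (\<mu> - \<mu>')) = \<mu> * x / (\<mu> - \<mu>')"
      "\<mu> * x / (\<mu> - \<mu>') * (1 / (\<mu> - \<mu>')) + x / (\<mu> - \<mu>') * (- \<mu>' / (\<mu> - \<mu>')) = x / (\<mu> - \<mu>')" for x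
    proof -
      have "\<mu> * x / (\<mu> - \<mu>') * (\<mu> / (\<mu> - \<mu>')) + x / (\<mu> - \<mu>') * (1 / (\<mu> - \<mu>')) =
          x / (\<mu> - \<mu>') * ((\<mu> * \<mu> + 1) / (\<mu> - \<mu>'))"
        "\<mu> * x / (\<mu> - \<mu>') * (1 / (\<mu> - \<mu>')) + x / (\<mu> - \<mu>') * (- \<mu>' / (\<mu> - \<mu>')) =
          x / (\<mu> - \<mu>') * ((\<mu> + - \<mu>') / (\<mu> - \<mu>'))"
        by (simp_all only: k distrib_left mult_1_right mult_1_left mult_ac)
      thus "\<mu> * x / (\<mu> - \<mu>') * (\<mu> / (\<mu> - \<mu>')) + x / (\<mu> - \<mu>') * (1 / (\<mu> - \<mu>')) = \<mu> * x / (\<mu> - \<mu>')"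
        "\<mu> * x / (\<mu> - \<mu>') * (1 / (\<mu> - \<mu>')) + x / (\<mu> - \<mu>') * (- \<mu>' / (\<mu> - \<mu>')) = x / (\<mu> - \<mu>')"
        unfolding * by simp_all
    qed
    show ?thesis
      by (rule matrix2_eqI; unfold matrix2_mult_nth jost_matrix_nth eigen_proj_nth row) (rule refl)+
  qed
  show ?thesis
  proof
    assume "Y = ?J"
    thus "matrix_jost \<rho> l \<mu> ?P F Y"
      unfolding matrix_jost_def lim using J_step J_lim J_proj by blast
  next
    assume Y: "matrix_jost \<rho> l \<mu> ?P F Y"
    have Y_step: "Y (n + 1) = Ax_mat \<rho> l n ** Y n" for n
      using Y by (simp add: matrix_jost_def)
    have Y_lim: "\<forall>i j. ((\<lambda>n. \<mu> powi (- n) * Y n $ i $ j - ?P $ i $ j) \<longlongrightarrow> 0) F"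
      using Y unfolding matrix_jost_def lim by blast
    define d where "d j n = Y n $ 1 $ j - ?J n $ 1 $ j" for j n
    have Y1: "Y (n + 1) $ 1 $ j = - l / of_real (\<rho> n) * Y n $ 1 $ j + Y n $ 2 $ j"
      and Y2: "Y (n + 1) $ 2 $ j = Y n $ 1 $ j"
      and J1: "?J (n + 1) $ 1 $ j = - l / of_real (\<rho> n) * ?J n $ 1 $ j + ?J n $ 2 $ j"
      and J2: "?J (n + 1) $ 2 $ j = ?J n $ 1 $ j" for n j
      unfolding Y_step J_step matrix2_mult_nth Ax_mat_nth by simp_all
    have low: "Y n $ 2 $ j = Y (n - 1) $ 1 $ j" "?J n $ 2 $ j = ?J (n - 1) $ 1 $ j" for n j
      using Y2[of "n - 1" j] J2[of "n - 1" j] by simp_all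
    have dz: "d j = (\<lambda>_. 0)" for j
    proof -
      have ds: "solves \<rho> l (d j)"
        unfolding solves_def d_def Y1 J1 low by (simp add: algebra_simps)
      have "((\<lambda>n. (\<mu> powi (- n) * Y n $ 1 $ j - ?P $ 1 $ j) - (\<mu> powi (- n) * ?J n $ 1 $ j - ?P $ 1 $ j))
          \<longlongrightarrow> 0 - 0) F"
        by (intro tendsto_diff) (use Y_lim J_lim in blast)+
      hence dl: "((\<lambda>n. \<mu> powi (- n) * d j n) \<longlongrightarrow> 0) F"
        by (simp add: d_def algebra_simps)
      have "scalar_jost \<rho> l \<mu> F (\<lambda>n. z n - (-1) * d j n)"
        unfolding scalar_jost_def
      proof
        show "solves \<rho> l (\<lambda>n. z n - (-1) * d j n)" by (rule solves_linear[OF zs ds])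
        have "((\<lambda>n. (\<mu> powi (- n) * z n - 1) + \<mu> powi (- n) * d j n) \<longlongrightarrow> 0 + 0) F"
          by (intro tendsto_add zl dl)
        thus "((\<lambda>n. \<mu> powi (- n) * (z n - (-1) * d j n) - 1) \<longlongrightarrow> 0) F"
          by (simp add: algebra_simps)
      qed
      from scalar_jost_unique[OF z this sub] show ?thesis by (simp add: fun_eq_iff)
    qed
    have "Y n $ 1 $ j = ?J n $ 1 $ j" for n j
      using fun_cong[OF dz[of j], of n] by (simp add: d_def)
    hence "Y n = ?J n" for n
      using low by (intro matrix2_eqI) simp_all
    thus "Y = ?J" by (rule ext)
  qed
qed

context spectral_point
begin

lemma plus_matrix_jost_iff: "is_Y_plus \<rho> l Y \<longleftrightarrow> Y = jost_matrix p m (z_plus \<rho> l)"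
  unfolding P_plus_eq[OF l] using characteristic_roots(3,4)[OF l] mu_nonzero(3)[OF l]
  by (intro matrix_jost_iff[OF _ _ _ subdominant_mu(1)[OF l] jost_solutions(1)]) auto

lemma minus_matrix_jost_iff: "is_Y_minus \<rho> l Y \<longleftrightarrow> Y = jost_matrix m p (z_minus \<rho> l)"
  unfolding P_minus_eq[OF l] using characteristic_roots(3,4)[OF l] mu_nonzero(3)[OF l]
  by (intro matrix_jost_iff[OF _ _ _ subdominant_mu(2)[OF l] jost_solutions(2)])
     (auto simp: add.commute mult.commute)

lemma evans_eq_jost: "evans \<rho> l = - jost \<rho> l"
proof -
  define z w where "z = z_plus \<rho> l" and "w = z_minus \<rho> l"
  define k where "k = inverse (p - m)"
  have k1: "(p - m) * k = 1" using mu_nonzero(3)[OF l] by (simp add: k_def)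
  have dk: "x / (p - m) = k * x" "x / (m - p) = - (k * x)" for x
  proof -
    show "x / (p - m) = k * x" by (simp add: k_def divide_inverse mult.commute)
    have "x / (m - p) = - (x / (p - m))" by (metis minus_diff_eq minus_divide_right)
    thus "x / (m - p) = - (k * x)" by (simp add: k_def divide_inverse mult.commute)
  qed
  have "(THE Y. is_Y_plus \<rho> l Y) = jost_matrix p m z" "(THE Y. is_Y_minus \<rho> l Y) = jost_matrix m p w"
    unfolding plus_matrix_jost_iff minus_matrix_jost_iff z_def w_def by simp_all
  hence "evans \<rho> l = det (jost_matrix p m z 0 + jost_matrix m p w 0)"
    by (simp add: evans_def)
  also have "\<dots> = ((p - m) * k) * (k * (w 0 * z (-1) - z 0 * w (-1)))"
    unfolding det_2 vector_add_component jost_matrix_nth dk by (simp add: algebra_simps)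
  also have "\<dots> = k * (w 0 * z (-1) - z 0 * w (-1))" unfolding k1 by simp
  also have "\<dots> = - jost \<rho> l"
    unfolding jost_def wronskian_0 z_def[symmetric] w_def[symmetric] k_def[symmetric]
    by (simp add: algebra_simps)
  finally show ?thesis .
qed

end

section \<open>Continued fractions\<close>

text \<open>The denominators of the convergents, by the recursion that strips the first partial quotient.\<close>

fun cfrac_den :: "nat \<Rightarrow> (nat \<Rightarrow> complex) \<Rightarrow> complex" where
  "cfrac_den 0 a = 1"
| "cfrac_den (Suc 0) a = a 0"
| "cfrac_den (Suc (Suc N)) a = a 0 * cfrac_den (Suc N) (\<lambda>k. a (Suc k)) + cfrac_den N (\<lambda>k. a (Suc (Suc k)))"

lemma Re_mult_cnj_self: "Re (a * w * cnj w) = Re a * (cmod w)\<^sup>2"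
  by (simp add: cmod_power2) (simp add: power2_eq_square algebra_simps)

lemma Re_mult_cnj_swap: "Re (u * cnj w) = Re (w * cnj u)"
  by (simp add: mult.commute)

text \<open>Positivity of \<open>Re a\<^sub>k\<close> propagates backwards along the recursion for the denominators, as a
  lower bound of \<open>Re (D\<^sub>N\<^sub>+\<^sub>1 \<cdot> cnj D\<^sub>N)\<close>.\<close>

lemma cfrac_den_Re_ge:
  assumes "\<And>k. c \<le> Re (a k)" "0 < c"
  shows "c \<le> Re (cfrac_den (Suc N) a * cnj (cfrac_den N (\<lambda>k. a (Suc k)))) \<and>
         c * (cmod (cfrac_den N (\<lambda>k. a (Suc k))))\<^sup>2 \<le>
         Re (cfrac_den (Suc N) a * cnj (cfrac_den N (\<lambda>k. a (Suc k))))"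
  using assms
proof (induction N arbitrary: a)
  case 0
  show ?case using 0(1)[of 0] by simp
next
  case (Suc N)
  let ?a1 = "\<lambda>k. a (Suc k)" and ?a2 = "\<lambda>k. a (Suc (Suc k))"
  let ?w = "cfrac_den (Suc N) ?a1"
  have "Re (cfrac_den (Suc (Suc N)) a * cnj ?w) =
      Re (a 0 * ?w * cnj ?w) + Re (cfrac_den N ?a2 * cnj ?w)"
    by (simp only: cfrac_den.simps distrib_right plus_complex.sel)
  also have "\<dots> = Re (a 0) * (cmod ?w)\<^sup>2 + Re (?w * cnj (cfrac_den N ?a2))"
    by (simp only: Re_mult_cnj_self Re_mult_cnj_swap[of "cfrac_den N ?a2"])
  finally have eq: "Re (cfrac_den (Suc (Suc N)) a * cnj ?w) =
      Re (a 0) * (cmod ?w)\<^sup>2 + Re (?w * cnj (cfrac_den N ?a2))" .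
  have IH: "c \<le> Re (?w * cnj (cfrac_den N ?a2))"
    using Suc.IH[of ?a1] Suc.prems by simp
  have "c * (cmod ?w)\<^sup>2 \<le> Re (a 0) * (cmod ?w)\<^sup>2" "0 \<le> Re (a 0) * (cmod ?w)\<^sup>2"
    using Suc.prems(1)[of 0] Suc.prems(2) by (auto intro!: mult_right_mono mult_nonneg_nonneg)
  thus "c \<le> Re (cfrac_den (Suc (Suc N)) a * cnj ?w) \<and>
    c * (cmod ?w)\<^sup>2 \<le> Re (cfrac_den (Suc (Suc N)) a * cnj ?w)"
    unfolding eq using IH assms(2) by linarith
qed

lemma cfrac_den_norm_ge:
  assumes "\<And>k. c \<le> Re (a k)" "0 < c"
  shows "c \<le> cmod (cfrac_den (Suc N) a)"
proof -
  let ?u = "cmod (cfrac_den (Suc N) a)" and ?w = "cmod (cfrac_den N (\<lambda>k. a (Suc k)))"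
  have le: "Re (cfrac_den (Suc N) a * cnj (cfrac_den N (\<lambda>k. a (Suc k)))) \<le> ?u * ?w"
    by (metis complex_Re_le_cmod complex_mod_cnj norm_mult)
  have 1: "c \<le> ?u * ?w" and 2: "c * ?w\<^sup>2 \<le> ?u * ?w"
    using cfrac_den_Re_ge[where c = c and a = a and N = N, OF assms] le by linarith+
  have w: "0 < ?w"
  proof (rule ccontr)
    assume "\<not> 0 < ?w"
    hence "?w = 0" by simp
    thus False using 1 assms(2) by simp
  qed
  have "(c * ?w) * ?w \<le> ?u * ?w" using 2 by (simp add: power2_eq_square mult.assoc)
  hence "c * ?w \<le> ?u" using w by simp
  hence "?u * (c * ?w) \<le> ?u * ?u" by (intro mult_left_mono) auto
  moreover have "c * c \<le> c * (?u * ?w)" using 1 assms(2) by (intro mult_left_mono) auto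
  ultimately have "c\<^sup>2 \<le> ?u\<^sup>2" by (simp add: power2_eq_square mult_ac)
  thus ?thesis by (rule power2_le_imp_le) simp
qed

lemma cfrac_den_nonzero:
  assumes "\<And>k. c \<le> Re (a k)" "0 < c"
  shows "cfrac_den N a \<noteq> 0"
proof (cases N)
  case (Suc M)
  thus ?thesis using cfrac_den_norm_ge[where c = c and a = a and N = M, OF assms] assms(2) by auto
qed simp

lemma cfrac_conv_eq:
  assumes "\<And>k. c \<le> Re (a k)" "0 < c"
  shows "cfrac_conv (Suc N) a = cfrac_den N (\<lambda>k. a (Suc k)) / cfrac_den (Suc N) a"
  using assms
proof (induction N arbitrary: a)
  case (Suc N)
  let ?a1 = "\<lambda>k. a (Suc k)" and ?a2 = "\<lambda>k. a (Suc (Suc k))"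
  have nz: "cfrac_den (Suc N) ?a1 \<noteq> 0" "cfrac_den (Suc (Suc N)) a \<noteq> 0"
    by (rule cfrac_den_nonzero[of c]; use Suc.prems in simp)+
  have "cfrac_conv (Suc (Suc N)) a = 1 / (a 0 + cfrac_den N ?a2 / cfrac_den (Suc N) ?a1)"
    using Suc.IH[of ?a1] Suc.prems by simp
  also have "a 0 + cfrac_den N ?a2 / cfrac_den (Suc N) ?a1 =
      cfrac_den (Suc (Suc N)) a / cfrac_den (Suc N) ?a1"
    using nz(1) by (simp add: add_divide_distrib)
  finally show ?case by simp
qed simp

text \<open>Both sides are, up to sign, the conserved Wronskian of \<open>u\<close> and of the solution that takes the values
  \<open>1, 0\<close> at \<open>N + 1, N + 2\<close>, evaluated at the two ends.\<close>

lemma cfrac_error: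
  assumes "\<And>k. u k = a k * u (Suc k) + u (Suc (Suc k))"
  shows "u 1 * cfrac_den (Suc N) a - u 0 * cfrac_den N (\<lambda>k. a (Suc k)) = (-1) ^ Suc N * u (Suc (Suc N))"
  using assms
proof (induction N arbitrary: a u)
  case 0
  have "u 0 = a 0 * u 1 + u 2" using 0[of 0] by (simp add: numeral_2_eq_2)
  thus ?case by (simp add: numeral_2_eq_2 mult.commute)
next
  case (Suc N)
  let ?a1 = "\<lambda>k. a (Suc k)" and ?a2 = "\<lambda>k. a (Suc (Suc k))" and ?u1 = "\<lambda>k. u (Suc k)"
  have IH: "u 2 * cfrac_den (Suc N) ?a1 - u 1 * cfrac_den N ?a2 = (-1) ^ Suc N * u (Suc (Suc (Suc N)))"
    using Suc.IH[of ?u1 ?a1, OF Suc.prems[of "Suc _"]] by (simp add: numeral_2_eq_2)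
  have "u 0 = a 0 * u 1 + u 2" using Suc.prems[of 0] by (simp add: numeral_2_eq_2)
  hence "u 1 * cfrac_den (Suc (Suc N)) a - u 0 * cfrac_den (Suc N) ?a1 =
      - (u 2 * cfrac_den (Suc N) ?a1 - u 1 * cfrac_den N ?a2)"
    by (simp add: algebra_simps)
  thus ?case unfolding IH by simp
qed

text \<open>Pincherle's principle: the error of a convergent is, up to sign, \<open>u\<^sub>N\<^sub>+\<^sub>2 / (u\<^sub>0 D\<^sub>N\<^sub>+\<^sub>1)\<close>, and the
  denominators are bounded away from \<open>0\<close>.\<close>

lemma cfrac_tendsto:
  assumes rec: "\<And>k. u k = a k * u (Suc k) + u (Suc (Suc k))"
    and a: "\<And>k. c \<le> Re (a k)" "0 < c" and u: "u \<longlonglongrightarrow> 0" "u 0 \<noteq> 0"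
  shows "(\<lambda>N. cfrac_conv N a) \<longlonglongrightarrow> u 1 / u 0"
proof (rule LIMSEQ_imp_Suc)
  have bound: "cmod (cfrac_conv (Suc N) a - u 1 / u 0) \<le> cmod (u (N + 2)) / (cmod (u 0) * c)" for N
  proof -
    let ?d = "cfrac_den (Suc N) a"
    have d: "?d \<noteq> 0" by (rule cfrac_den_nonzero[where c = c and a = a, OF a])
    have "cfrac_conv (Suc N) a - u 1 / u 0 =
        - ((u 1 * ?d - u 0 * cfrac_den N (\<lambda>k. a (Suc k))) / (u 0 * ?d))"
      unfolding cfrac_conv_eq[where c = c and a = a, OF a] using d u(2) by (simp add: field_simps)
    also have "cmod \<dots> = cmod (u (N + 2)) / (cmod (u 0) * cmod ?d)"
      unfolding cfrac_error[where u = u and a = a, OF rec] by (simp add: norm_divide norm_mult norm_power)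
    also have "\<dots> \<le> cmod (u (N + 2)) / (cmod (u 0) * c)"
      using cfrac_den_norm_ge[where c = c and a = a and N = N, OF a] u(2) a(2) d
      by (intro divide_left_mono mult_left_mono mult_pos_pos) auto
    finally show ?thesis .
  qed
  have "(\<lambda>N. cmod (u (N + 2)) / (cmod (u 0) * c)) \<longlonglongrightarrow> cmod 0 / (cmod (u 0) * c)"
    using a(2) u(2) by (intro tendsto_intros LIMSEQ_ignore_initial_segment u(1)) auto
  hence "(\<lambda>N. cmod (u (N + 2)) / (cmod (u 0) * c)) \<longlonglongrightarrow> 0" by simp
  hence "(\<lambda>N. cfrac_conv (Suc N) a - u 1 / u 0) \<longlonglongrightarrow> 0"
    by (rule Lim_null_comparison[rotated]) (intro always_eventually allI bound)
  thus "(\<lambda>N. cfrac_conv (Suc N) a) \<longlonglongrightarrow> u 1 / u 0" by (simp add: LIM_zero_iff)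
qed

text \<open>The quantity \<open>t\<^sub>k = Re (u\<^sub>k \<cdot> cnj u\<^sub>k\<^sub>+\<^sub>1)\<close> decreases to \<open>0\<close>, so it is nonnegative, and \<open>t\<^sub>0 = 0\<close> leaves
  no room for the decrease \<open>Re a\<^sub>0 \<bar>u\<^sub>1\<bar>\<^sup>2\<close>.\<close>

lemma decaying_recursion_zero:
  assumes rec: "\<And>k. u k = a k * u (Suc k) + u (Suc (Suc k))"
    and a: "\<And>k. c \<le> Re (a k)" "0 < c" and u: "u \<longlonglongrightarrow> 0" "u 0 = 0"
  shows "u 1 = 0"
proof -
  define t where "t k = Re (u k * cnj (u (Suc k)))" for k
  have t: "t k = Re (a k) * (cmod (u (Suc k)))\<^sup>2 + t (Suc k)" for k
  proof -
    have "t k = Re (a k * u (Suc k) * cnj (u (Suc k))) + Re (u (Suc (Suc k)) * cnj (u (Suc k)))"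
      unfolding t_def by (subst rec) (simp only: distrib_right plus_complex.sel)
    thus ?thesis
      by (simp only: Re_mult_cnj_self t_def Re_mult_cnj_swap[of "u (Suc (Suc k))"])
  qed
  have "0 \<le> Re (a k) * (cmod (u (Suc k)))\<^sup>2" for k
    using a(1)[of k] a(2) by (intro mult_nonneg_nonneg) auto
  hence "decseq t" by (intro decseq_SucI) (metis t le_add_same_cancel2)
  moreover have "t \<longlonglongrightarrow> Re (0 * cnj 0)"
    unfolding t_def[abs_def] by (intro tendsto_intros u(1) LIMSEQ_Suc)
  ultimately have "0 \<le> t (Suc 0)" using decseq_ge[of t 0 "Suc 0"] by simp
  moreover have "t 0 = 0" by (simp add: t_def u(2))
  ultimately have "Re (a 0) * (cmod (u 1))\<^sup>2 \<le> 0" using t[of 0] by simp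
  moreover have "0 < Re (a 0)" using a(1)[of 0] a(2) by linarith
  ultimately have "(cmod (u 1))\<^sup>2 \<le> 0" by (simp add: mult_le_0_iff)
  thus ?thesis by simp
qed

lemma right_half_plane_subset: "0 < Re l \<Longrightarrow> l \<in> param_dom"
  by (simp add: param_dom_iff)

locale half_plane_point = spectral_point +
  assumes Re_pos: "0 < Re l" and rho_pos: "n \<noteq> 0 \<Longrightarrow> 0 < \<rho> n"
begin

lemma plus_recursion:
  fixes k :: nat
  defines "a \<equiv> \<lambda>k::nat. l / of_real (\<rho> (int k + 1))"
  shows "z_plus \<rho> l (int k) = a k * z_plus \<rho> l (int (Suc k)) + z_plus \<rho> l (int (Suc (Suc k)))"
    and "Re l \<le> Re (a k)"
proof -
  show "z_plus \<rho> l (int k) = a k * z_plus \<rho> l (int (Suc k)) + z_plus \<rho> l (int (Suc (Suc k)))"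
    using solvesD[OF jost_solve(1), of "int k + 1"] by (simp add: a_def algebra_simps)
  have r: "0 < \<rho> (int k + 1)" "\<rho> (int k + 1) \<le> 1" using rho_pos[of "int k + 1"] le1 by auto
  have "Re l * \<rho> (int k + 1) \<le> Re l * 1" using r Re_pos by (intro mult_left_mono) auto
  hence "Re l \<le> Re l / \<rho> (int k + 1)" using r by (simp add: pos_le_divide_eq)
  thus "Re l \<le> Re (a k)" by (simp add: a_def Re_divide_of_real)
qed

lemma z_plus_seq_tendsto: "(\<lambda>k. z_plus \<rho> l (int k)) \<longlonglongrightarrow> 0"
  using filterlim_compose[OF scalar_jost_tendsto_0[OF jost_solutions(1) subdominant_mu(1)[OF l]]
      filterlim_int_ray(1)[of 0]] by simp

lemma z_plus_0_nonzero: "z_plus \<rho> l 0 \<noteq> 0"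
proof
  assume z0: "z_plus \<rho> l 0 = 0"
  have "z_plus \<rho> l (int 1) = 0"
    by (rule decaying_recursion_zero[where u = "\<lambda>k. z_plus \<rho> l (int k)",
          OF plus_recursion(1) plus_recursion(2) Re_pos z_plus_seq_tendsto])
       (use z0 in simp)
  hence "z_plus \<rho> l (-1) = 0" using solvesD[OF jost_solve(1), of 0] z0 by simp
  hence "z_plus \<rho> l = (\<lambda>_. 0)" using solves_zero[OF jost_solve(1) z0] by auto
  thus False using scalar_jost_nonzero[OF jost_solutions(1)] by simp
qed

lemma g_plus_tendsto: "g_plus_conv \<rho> l \<longlonglongrightarrow> z_plus \<rho> l 1 / z_plus \<rho> l 0"
  using cfrac_tendsto[where u = "\<lambda>k. z_plus \<rho> l (int k)", OF plus_recursion(1) plus_recursion(2) Re_pos z_plus_seq_tendsto]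
    z_plus_0_nonzero by (simp add: g_plus_conv_def[abs_def])

lemma mirror_half_plane: "half_plane_point (\<lambda>n. \<rho> (- n)) \<delta> l"
proof -
  have "spectral_point (\<lambda>n. \<rho> (- n)) \<delta> l"
    using reflect_defect l by (simp add: spectral_point_def spectral_point_axioms_def)
  thus ?thesis using Re_pos rho_pos by (simp add: half_plane_point_def half_plane_point_axioms_def)
qed

lemma mirror_z_plus: "z_plus (\<lambda>n. \<rho> (- n)) l = reflect (z_minus \<rho> l)"
  using spectral_point.z_plus_eq_reflect[of "\<lambda>n. \<rho> (- n)" \<delta> l] mirror_half_plane
  by (simp add: half_plane_point_def)

lemma z_minus_0_nonzero: "z_minus \<rho> l 0 \<noteq> 0"
  using half_plane_point.z_plus_0_nonzero[OF mirror_half_plane]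
  by (simp add: mirror_z_plus reflect_def)

lemma g_minus_tendsto: "g_minus_conv \<rho> l \<longlonglongrightarrow> - z_minus \<rho> l (-1) / z_minus \<rho> l 0"
proof -
  have "- (int k + 1) = - int k - 1" for k by simp
  hence "g_plus_conv (\<lambda>n. \<rho> (- n)) l = g_minus_conv \<rho> l"
    unfolding g_plus_conv_def[abs_def] g_minus_conv_def[abs_def] by (simp only:)
  thus ?thesis
    using half_plane_point.g_plus_tendsto[OF mirror_half_plane]
    by (simp add: mirror_z_plus reflect_def)
qed

text \<open>The limits of the continued fractions are \<open>z\<^sup>+\<^sub>1 / z\<^sup>+\<^sub>0\<close> and \<open>- z\<^sup>-\<^sub>-\<^sub>1 / z\<^sup>-\<^sub>0\<close>; multiplying out and using the
  difference equation at \<open>n = 0\<close> leaves the Wronskian.\<close>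

lemma G_fun_eq_jost: "G_fun \<rho> l = jost \<rho> l"
proof -
  define z0 z1 y w0 w1 where "z0 = z_plus \<rho> l 0" and "z1 = z_plus \<rho> l 1" and "y = z_plus \<rho> l (-1)"
    and "w0 = z_minus \<rho> l 0" and "w1 = z_minus \<rho> l (-1)"
  have nz: "z0 \<noteq> 0" "w0 \<noteq> 0"
    using z_plus_0_nonzero z_minus_0_nonzero by (simp_all add: z0_def w0_def)
  have inv: "inverse (m - p) = - inverse (p - m)"
    by (metis inverse_minus_eq minus_diff_eq)
  have y: "y = z1 + l / of_real (\<rho> 0) * z0"
    using solvesD[OF jost_solve(1), of 0] by (simp add: z0_def z1_def y_def)
  have lims: "lim (g_plus_conv \<rho> l) = z1 / z0" "lim (g_minus_conv \<rho> l) = - w1 / w0"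
    using limI[OF g_plus_tendsto] limI[OF g_minus_tendsto]
    by (simp_all add: z0_def z1_def w0_def w1_def)
  have "z0 * w0 * (l / of_real (\<rho> 0) + z1 / z0 + - w1 / w0) =
      (l / of_real (\<rho> 0) * z0) * w0 + z1 * w0 - w1 * z0"
    using nz by (simp add: distrib_left right_diff_distrib)
  also have "\<dots> = y * w0 - z0 * w1" unfolding y by (simp add: algebra_simps)
  finally have *: "z0 * w0 * (l / of_real (\<rho> 0) + z1 / z0 + - w1 / w0) = y * w0 - z0 * w1" .
  have "G_fun \<rho> l = inverse (m - p) * (z0 * w0 * (l / of_real (\<rho> 0) + z1 / z0 + - w1 / w0))"
    unfolding G_fun_def lims z0_def[symmetric] w0_def[symmetric] by (simp only: mult_ac)
  also have "\<dots> = inverse (p - m) * (z0 * w1 - y * w0)"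
    unfolding * inv by (simp add: algebra_simps)
  also have "\<dots> = jost \<rho> l"
    by (simp add: jost_def wronskian_0 z0_def w1_def y_def w0_def)
  finally show ?thesis .
qed

end

section \<open>Equality of the determinants, the Evans function and the Jost function\<close>

text \<open>The deviation from \<open>1\<close> is \<open>O(1/n\<^sup>2)\<close>, hence summable; then \<open>\<bar>\<rho>\<^sub>n\<bar> < 1/2\<close> for finitely many \<open>n\<close> only,
  and a finite minimum bounds \<open>\<bar>\<rho>\<bar>\<close> from below.\<close>

lemma summable_defect_of_bigo:
  fixes \<rho> :: "int \<Rightarrow> real"
  assumes le1: "\<And>n. \<rho> n \<le> 1" and nz: "\<And>n. \<rho> n \<noteq> 0"
    and bigo: "(\<lambda>n. \<rho> n - 1) \<in> O[sup at_top at_bot](\<lambda>n. 1 / (real_of_int n)\<^sup>2)"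
  obtains \<delta> where "summable_defect \<rho> \<delta>"
proof -
  obtain c where ev: "\<forall>\<^sub>F n in sup at_top at_bot. norm (\<rho> n - 1) \<le> c * norm (1 / (real_of_int n)\<^sup>2)"
    using bigo by (elim landau_o.bigE)
  have half: "(\<lambda>k. 1 - \<rho> (f k)) summable_on UNIV"
    if f: "filterlim f F sequentially" "F \<le> sup at_top at_bot" "\<And>k. (real_of_int (f k))\<^sup>2 = (real k)\<^sup>2"
    for f :: "nat \<Rightarrow> int" and F
  proof -
    have "\<forall>\<^sub>F n in F. norm (\<rho> n - 1) \<le> c * norm (1 / (real_of_int n)\<^sup>2)"
      by (rule filter_leD[OF f(2) ev])
    hence "\<forall>\<^sub>F k in sequentially. norm (\<rho> (f k) - 1) \<le> c * norm (1 / (real_of_int (f k))\<^sup>2)"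
      using f(1) by (rule eventually_compose_filterlim)
    hence ev': "\<forall>\<^sub>F k in sequentially. norm (1 - \<rho> (f k)) \<le> c * inverse ((real k)\<^sup>2)"
      by (rule eventually_mono) (simp add: f(3) abs_minus_commute divide_inverse)
    have "summable (\<lambda>k. c * inverse ((real k)\<^sup>2))"
      by (intro summable_mult inverse_power_summable) simp
    with ev' have "summable (\<lambda>k. 1 - \<rho> (f k))" by (rule summable_comparison_test_ev)
    thus ?thesis using le1 by (subst summable_on_UNIV_nonneg_real_iff) auto
  qed
  have summ: "(\<lambda>n. 1 - \<rho> n) summable_on UNIV"
    by (rule summable_on_int_halves)
       (use half[of int at_top] half[of "\<lambda>k. - int k" at_bot] filterlim_int_ray[of 0] in auto)
  have "(\<lambda>n. complex_of_real (sqrt (1 - \<rho> n))) \<in> ell2"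
    using summ le1 by (simp add: ell2_def)
  hence fin: "finite {n. sqrt (1 / 2) \<le> cmod (complex_of_real (sqrt (1 - \<rho> n)))}" (is "finite ?B")
    by (rule ell2_finite_large_entries) simp
  define \<delta> where "\<delta> = Min (insert (1 / 2) ((\<lambda>n. \<bar>\<rho> n\<bar>) ` ?B))"
  have "0 < \<delta>" unfolding \<delta>_def using fin nz by (subst Min_gr_iff) auto
  moreover have "\<delta> \<le> \<bar>\<rho> n\<bar>" for n
  proof (cases "n \<in> ?B")
    case True
    thus ?thesis unfolding \<delta>_def using fin by (intro Min_le) auto
  next
    case False
    hence "1 / 2 \<le> \<bar>\<rho> n\<bar>" using le1[of n] by (auto simp: not_le)
    moreover have "\<delta> \<le> 1 / 2" unfolding \<delta>_def using fin by (intro Min_le) auto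
    ultimately show ?thesis by linarith
  qed
  ultimately have "summable_defect \<rho> \<delta>"
    using le1 summ by unfold_locales auto
  thus thesis by (rule that)
qed

theorem theorem1p1:
  fixes \<rho> :: "int \<Rightarrow> real"
  assumes "\<rho> 0 < 0"
    and "\<And>n. n \<noteq> 0 \<Longrightarrow> 0 < \<rho> n \<and> \<rho> n < 1"
    and "(\<lambda>n. \<rho> n - 1) \<in> O[sup at_top at_bot](\<lambda>n. 1 / (real_of_int n)\<^sup>2)"
  shows
    "(\<forall>l\<in>param_dom.
        bij_betw (L_op l) ell2 ell2 \<and> trace_class (K_op \<rho> l) \<and>
        bij_betw (M_op l) ell2 ell2 \<and> trace_class (T_op \<rho> l) \<and>
        (\<exists>!Y. is_Y_plus \<rho> l Y) \<and> (\<exists>!Y. is_Y_minus \<rho> l Y) \<and>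
        (\<exists>!z. is_z_plus \<rho> l z) \<and> (\<exists>!z. is_z_minus \<rho> l z) \<and>
        (Re l > 0 \<longrightarrow> convergent (g_plus_conv \<rho> l) \<and> convergent (g_minus_conv \<rho> l))) \<and>
     (\<lambda>l. fredholm_det (K_op \<rho> l)) holomorphic_on param_dom \<and>
     (\<lambda>l. fredholm_det (T_op \<rho> l)) holomorphic_on param_dom \<and>
     evans \<rho> holomorphic_on param_dom \<and>
     jost \<rho> holomorphic_on param_dom \<and>
     G_fun \<rho> holomorphic_on {l. Re l > 0} \<and>
     (\<forall>l\<in>param_dom.
        fredholm_det (K_op \<rho> l) = fredholm_det (T_op \<rho> l) \<and>
        fredholm_det (T_op \<rho> l) = evans \<rho> l \<and>
        evans \<rho> l = - jost \<rho> l \<and>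
        (Re l > 0 \<longrightarrow> jost \<rho> l = G_fun \<rho> l) \<and>
        (discrete_eigenvalue \<rho> l \<longleftrightarrow> fredholm_det (K_op \<rho> l) = 0) \<and>
        (discrete_eigenvalue \<rho> l \<longleftrightarrow> fredholm_det (T_op \<rho> l) = 0) \<and>
        (discrete_eigenvalue \<rho> l \<longleftrightarrow> evans \<rho> l = 0) \<and>
        (discrete_eigenvalue \<rho> l \<longleftrightarrow> jost \<rho> l = 0) \<and>
        (Re l > 0 \<longrightarrow> (discrete_eigenvalue \<rho> l \<longleftrightarrow> G_fun \<rho> l = 0)))"
proof -
  have "\<rho> n \<le> 1" "\<rho> n \<noteq> 0" for n
    using assms(1) assms(2)[of n] by (cases "n = 0"; force)+
  then obtain \<delta> where "summable_defect \<rho> \<delta>"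
    using summable_defect_of_bigo[OF _ _ assms(3)] by blast
  then interpret summable_defect \<rho> \<delta> .
  have half_plane: "half_plane_point \<rho> \<delta> l" if "0 < Re l" for l
    using spectral_pointI[OF right_half_plane_subset[OF that]] that assms(2)
    by (simp add: half_plane_point_def half_plane_point_axioms_def)
  have exist: "bij_betw (L_op l) ell2 ell2 \<and> trace_class (K_op \<rho> l) \<and>
        bij_betw (M_op l) ell2 ell2 \<and> trace_class (T_op \<rho> l) \<and>
        (\<exists>!Y. is_Y_plus \<rho> l Y) \<and> (\<exists>!Y. is_Y_minus \<rho> l Y) \<and>
        (\<exists>!z. is_z_plus \<rho> l z) \<and> (\<exists>!z. is_z_minus \<rho> l z) \<and>
        (Re l > 0 \<longrightarrow> convergent (g_plus_conv \<rho> l) \<and> convergent (g_minus_conv \<rho> l))"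
    if l: "l \<in> param_dom" for l
  proof -
    interpret spectral_point \<rho> \<delta> l by (rule spectral_pointI[OF l])
    have "\<exists>!z. is_z_plus \<rho> l z"
      using jost_solutions(1) scalar_jost_unique[OF _ _ subdominant_mu(1)[OF l]] by blast
    moreover have "\<exists>!z. is_z_minus \<rho> l z"
      using jost_solutions(2) scalar_jost_unique[OF _ _ subdominant_mu(2)[OF l]] by blast
    moreover have "convergent (g_plus_conv \<rho> l) \<and> convergent (g_minus_conv \<rho> l)" if "0 < Re l"
      using half_plane_point.g_plus_tendsto[OF half_plane[OF that]]
        half_plane_point.g_minus_tendsto[OF half_plane[OF that]] by (auto simp: convergent_def)
    ultimately show ?thesis
      using L_op_bij[OF l] M_op_bij[OF l] K_op_trace_class[OF l] T_op_trace_class[OF l]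
      by (simp add: plus_matrix_jost_iff minus_matrix_jost_iff)
  qed
  have K: "fredholm_det (K_op \<rho> l) = - jost \<rho> l" and T: "fredholm_det (T_op \<rho> l) = - jost \<rho> l"
    and E: "evans \<rho> l = - jost \<rho> l"
    and eig: "discrete_eigenvalue \<rho> l \<longleftrightarrow> jost \<rho> l = 0" if l: "l \<in> param_dom" for l
  proof -
    interpret spectral_point \<rho> \<delta> l by (rule spectral_pointI[OF l])
    show "fredholm_det (K_op \<rho> l) = - jost \<rho> l" "fredholm_det (T_op \<rho> l) = - jost \<rho> l"
      "evans \<rho> l = - jost \<rho> l" "discrete_eigenvalue \<rho> l \<longleftrightarrow> jost \<rho> l = 0"
      using jost_eq_det fredholm_det_T_eq_K[OF l] evans_eq_jost eigenvalue_iff by simp_all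
  qed
  have G: "G_fun \<rho> l = jost \<rho> l" if "0 < Re l" for l
    by (rule half_plane_point.G_fun_eq_jost[OF half_plane[OF that]])
  have minus_jost: "(\<lambda>l. - jost \<rho> l) holomorphic_on param_dom"
    by (intro holomorphic_intros jost_holomorphic)
  have hol: "(\<lambda>l. fredholm_det (K_op \<rho> l)) holomorphic_on param_dom"
    "(\<lambda>l. fredholm_det (T_op \<rho> l)) holomorphic_on param_dom" "evans \<rho> holomorphic_on param_dom"
    by (rule holomorphic_transform[OF minus_jost]; simp add: K T E)+
  have "jost \<rho> holomorphic_on {l. 0 < Re l}"
    by (rule holomorphic_on_subset[OF jost_holomorphic]) (auto simp: right_half_plane_subset)
  hence holG: "G_fun \<rho> holomorphic_on {l. 0 < Re l}"
    by (rule holomorphic_transform) (simp add: G)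
  show ?thesis
    using exist hol jost_holomorphic holG by (simp add: K T E G eig)
qed

end
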